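(* For every integer $n\ge 4$ and every $\theta\in[0,1)$, the strategy $\mathrm{FSD}(\theta)$ improves on $\mathrm{AW}(\theta)$ in expected meeting time. More precisely, for $n=4$ and every $\theta\in[0,1)$, \[ \mathbb{E}[t_{\mathrm{AW}(\theta)}]-\mathbb{E}[t_{\mathrm{FSD}(\theta)}]=\frac{8(1-\theta)^6}{81\bigl(8-(3\theta^2-2\theta+1)^3\bigr)}, \] and for every integer $n\ge 5$ and every $\theta\in[0,1)$, \[ \mathbb{E}[t_{\mathrm{AW}(\theta)}]-\mathbb{E}[t_{\mathrm{FSD}(\theta)}]\ \ge\ \frac{483(1-\theta)^6}{(n-1)^8}. \]
   Context: Let $n\ge 4$ and $[n]=\{1,\dots,n\}$ (the locations). For a finite set $S$, $\mathcal{P}(S)$ is the set of permutations of $S$, i.e. bijections $\pi\colon\{1,\dots,|S|\}\to S$. There are two players $i\in\{1,2\}$; player $i$ has home location $i$ and visits a random sequence of locations $s^i\colon\mathbb{N}\to[n]$ (with $\mathbb{N}=\{1,2,\dots\}$). The sequences of the two players are independent and generated by the same strategy $\sigma$. The meeting time is $t_\sigma=\min\{t\in\mathbb{N}: s^1(t)=s^2(t)\}$. The strategies below operate in rounds of length $n-1$: round $r\in\mathbb{N}$ consists of time steps $(r-1)(n-1)+1,\dots,r(n-1)$. Player $i$ has random decisions $\chi^i_r\in\{\mathrm{S},\mathrm{M}\}$ and random permutations $\pi^i_r\in\mathcal{P}([n]\setminus\{i\})$ for $r\in\mathbb{N}$. If $\chi^i_r=\mathrm{S}$ (stay) then $s^i((r-1)(n-1)+j)=i$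 for all $j\in\{1,\dots,n-1\}$; if $\chi^i_r=\mathrm{M}$ (move) then $s^i((r-1)(n-1)+j)=\pi^i_r(j)$ for all $j\in\{1,\dots,n-1\}$. $\mathrm{AW}(\theta)$ (Anderson--Weber): independently over rounds, $\chi^i_r=\mathrm{S}$ with probability $\theta$ and $\chi^i_r=\mathrm{M}$ with probability $1-\theta$; each $\pi^i_r$ is uniform on $\mathcal{P}([n]\setminus\{i\})$, independently over rounds (and of the decisions $\chi$). $\mathrm{FSD}(\theta)$ (First-Same-or-Different): the decisions $\chi^i_r$ are distributed as in $\mathrm{AW}(\theta)$. For $r$ not divisible by $3$, $\pi^i_r$ is uniform on $\mathcal{P}([n]\setminus\{i\})$, independently of all other rounds. For $r$ divisible by $3$, $\pi^i_r$ is chosen uniformly at random from (a) $\{\pi\in\mathcal{P}([n]\setminus\{i\}):\pi(1)=\pi^i_{r-2}(1)\}$ if $\chi^i_{r-2}=\chi^i_{r-1}=\chi^i_r=\mathrm{M}$ and $\pi^i_{r-2}(1)=\pi^i_{r-1}(1)$; (b) $\{\pi\in\mathcal{P}([n]\setminus\{i\}):\pi(1)\notin\{\pi^i_{r-2}(1),\pi^i_{r-1}(1)\}\}$ if $\chi^i_{r-2}=\chi^i_{r-1}=\chi^i_r=\mathrm{M}$ and $\pi^i_{r-2}(1)\ne\pi^i_{r-1}(1)$; (c) $\mathcal{P}([n]\setminus\{i\})$ otherwise. *)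

theory Defs
  imports "HOL-Probability.Probability" "HOL-Combinatorics.Multiset_Permutations"
begin

section \<open>Rounds and the random sequence of rounds of one player\<close>

datatype decision = Stay | Move

instance decision :: countable
  by countable_datatype

text \<open>
  The decision and the permutation drawn in a round. A permutation of a finite set \<open>S\<close> is represented
  by the list of its values, i.e. an element of \<^term>\<open>permutations_of_set S\<close>; since list positions
  start at 0, the value \<open>\<pi>(j)\<close> is \<open>\<pi> ! (j - 1)\<close>.
\<close>
type_synonym round_data = "decision \<times> nat list"

text \<open>
  The law of a player's sequence of rounds is specified by the conditional laws of each round given the
  past: \<open>K k h\<close> is the law of round \<open>k + 1\<close> given that rounds \<open>1, \<dots>, k\<close> were \<open>h 0, \<dots>, h (k - 1)\<close>.
  So an index \<open>k\<close> always stands for the round number \<open>k + 1\<close>. The locations are natural numbers, and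
  \<open>\<sigma> i\<close> is what a strategy \<open>\<sigma>\<close> prescribes for player \<open>i\<close>.
\<close>
type_synonym round_kernel = "nat \<Rightarrow> (nat \<Rightarrow> round_data) \<Rightarrow> round_data pmf"
type_synonym strategy = "nat \<Rightarrow> round_kernel"

text \<open>
  The unique law on infinite sequences of rounds with the given conditional laws (Ionescu-Tulcea
  extension). The assumptions of the library's extension theorem hold for every kernel, as shown next.
\<close>
definition round_process :: "round_kernel \<Rightarrow> (nat \<Rightarrow> round_data) measure" where
  "round_process K = projective_family.lim UNIV
     (Ionescu_Tulcea.CI (\<lambda>k h. measure_pmf (K k h)) (\<lambda>_. count_space UNIV))
     (\<lambda>_. count_space UNIV)"

lemma Ionescu_Tulcea_round_kernel:
  fixes K :: round_kernel
  shows "Ionescu_Tulcea (\<lambda>k h. measure_pmf (K k h)) (\<lambda>_. count_space UNIV)"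
proof
  fix k :: nat
  have "PiM {0..<k} (\<lambda>_. count_space (UNIV :: round_data set)) =
          count_space (PiE {0..<k} (\<lambda>_. UNIV))"
    by (rule count_space_PiM_finite) auto
  then show "(\<lambda>h. measure_pmf (K k h)) \<in>
      PiM {0..<k} (\<lambda>_. count_space UNIV) \<rightarrow>\<^sub>M subprob_algebra (count_space UNIV)"
    by (simp add: measure_pmf_in_subprob_algebra)
qed

lemma sets_round_process [measurable_cong]:
  "sets (round_process K) = sets (PiM UNIV (\<lambda>_. count_space UNIV))"
proof -
  interpret Ionescu_Tulcea "\<lambda>k h. measure_pmf (K k h)" "\<lambda>_. count_space UNIV"
    by (rule Ionescu_Tulcea_round_kernel)
  show ?thesis
    unfolding round_process_def by (rule PF.sets_lim)
qed

lemma distr_round_process: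
  "distr (round_process K) (PiM {0..<k} (\<lambda>_. count_space UNIV)) (\<lambda>\<omega>. restrict \<omega> {0..<k}) =
     Ionescu_Tulcea.C (\<lambda>k h. measure_pmf (K k h)) (\<lambda>_. count_space UNIV) 0 k (\<lambda>_. undefined)"
proof -
  interpret Ionescu_Tulcea "\<lambda>k h. measure_pmf (K k h)" "\<lambda>_. count_space UNIV"
    by (rule Ionescu_Tulcea_round_kernel)
  have up: "up_to {0..<k} = k"
    using up_to[of "{0..<k}"] by (intro antisym) (auto simp: up_to_iff_Ico)
  have "distr (round_process K) (PiM {0..<k} (\<lambda>_. count_space UNIV))
          (\<lambda>\<omega>. restrict \<omega> {0..<k}) = CI {0..<k}"
    unfolding round_process_def by (rule distr_lim) simp
  also have "\<dots> = C 0 k (\<lambda>_. undefined)"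
    using distr_C[of k k "\<lambda>_. undefined" 0] by (simp add: CI_def up)
  finally show ?thesis .
qed

lemma prob_space_round_process: "prob_space (round_process K)"
proof -
  interpret Ionescu_Tulcea "\<lambda>k h. measure_pmf (K k h)" "\<lambda>_. count_space UNIV"
    by (rule Ionescu_Tulcea_round_kernel)
  have "prob_space (distr (round_process K) (PiM {0..<0} (\<lambda>_. count_space UNIV))
          (\<lambda>\<omega>. restrict \<omega> {0..<0}))"
    unfolding distr_round_process using prob_space_C[of "\<lambda>_. undefined" 0 0] by simp
  then show ?thesis
    by (rule prob_space_distrD[rotated]) measurable
qed


section \<open>Locations and meeting time\<close>

text \<open>
  The location of player \<open>i\<close> at time \<open>t \<ge> 1\<close>. Round \<open>k + 1\<close> consists of the times
  \<open>k * (n - 1) + j\<close> with \<open>1 \<le> j \<le> n - 1\<close>, so \<open>k = (t - 1) div (n - 1)\<close> and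
  \<open>j - 1 = (t - 1) mod (n - 1)\<close>.
\<close>
definition location :: "nat \<Rightarrow> nat \<Rightarrow> (nat \<Rightarrow> round_data) \<Rightarrow> nat \<Rightarrow> nat" where
  "location n i \<omega> t =
     (case \<omega> ((t - 1) div (n - 1)) of
        (Stay, \<pi>) \<Rightarrow> i
      | (Move, \<pi>) \<Rightarrow> \<pi> ! ((t - 1) mod (n - 1)))"

text \<open>The infimum is a minimum unless the players never meet, in which case it is \<open>\<infinity>\<close>.\<close>
definition meeting_time :: "(nat \<Rightarrow> nat) \<Rightarrow> (nat \<Rightarrow> nat) \<Rightarrow> enat" where
  "meeting_time s1 s2 = (INF t\<in>{t. 1 \<le> t \<and> s1 t = s2 t}. enat t)"

definition expected_meeting_time :: "nat \<Rightarrow> strategy \<Rightarrow> ennreal" where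
  "expected_meeting_time n \<sigma> =
     (\<integral>\<^sup>+ (\<omega>1, \<omega>2). ennreal_of_enat (meeting_time (location n 1 \<omega>1) (location n 2 \<omega>2))
        \<partial>(round_process (\<sigma> 1) \<Otimes>\<^sub>M round_process (\<sigma> 2)))"

lemma measurable_location:
  "(\<lambda>\<omega>. location n i \<omega> t) \<in> round_process K \<rightarrow>\<^sub>M count_space UNIV"
  unfolding location_def by measurable

lemma measurable_meeting_time:
  "(\<lambda>(\<omega>1, \<omega>2). ennreal_of_enat (meeting_time (location n 1 \<omega>1) (location n 2 \<omega>2)))
     \<in> borel_measurable (round_process K1 \<Otimes>\<^sub>M round_process K2)"
proof -
  have *: "meeting_time s1 s2 = (INF t. if 1 \<le> t \<and> s1 t = s2 t then enat t else \<infinity>)" for s1 s2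
    unfolding meeting_time_def
  proof (rule antisym)
    show "(INF t\<in>{t. 1 \<le> t \<and> s1 t = s2 t}. enat t) \<le>
        (INF t. if 1 \<le> t \<and> s1 t = s2 t then enat t else \<infinity>)"
      by (intro INF_greatest) (auto intro: INF_lower)
    show "(INF t. if 1 \<le> t \<and> s1 t = s2 t then enat t else \<infinity>) \<le>
        (INF t\<in>{t. 1 \<le> t \<and> s1 t = s2 t}. enat t)"
    proof (rule INF_greatest)
      fix t assume "t \<in> {t. 1 \<le> t \<and> s1 t = s2 t}"
      then show "(INF t. if 1 \<le> t \<and> s1 t = s2 t then enat t else \<infinity>) \<le> enat t"
        by (intro INF_lower2[of t]) auto
    qed
  qed
  let ?M = "round_process K1 \<Otimes>\<^sub>M round_process K2"
  let ?T = "\<lambda>\<omega>. meeting_time (location n 1 (fst \<omega>)) (location n 2 (snd \<omega>))"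
  have l1: "(\<lambda>\<omega>. location n 1 (fst \<omega>) t) \<in> ?M \<rightarrow>\<^sub>M count_space UNIV" for t
    by (rule measurable_compose[OF measurable_fst measurable_location])
  have l2: "(\<lambda>\<omega>. location n 2 (snd \<omega>) t) \<in> ?M \<rightarrow>\<^sub>M count_space UNIV" for t
    by (rule measurable_compose[OF measurable_snd measurable_location])
  have "Measurable.pred ?M (\<lambda>\<omega>. location n 1 (fst \<omega>) t = location n 2 (snd \<omega>) t)" for t
    by (rule measurable_compose_countable[where f = "\<lambda>l \<omega>. location n 1 (fst \<omega>) t = l"
          and g = "\<lambda>\<omega>. location n 2 (snd \<omega>) t"])
       (rule pred_count_space_const1[OF l1], rule l2)
  then have "Measurable.pred ?M
      (\<lambda>\<omega>. 1 \<le> t \<and> location n 1 (fst \<omega>) t = location n 2 (snd \<omega>) t)" for t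
    by (rule pred_intros_logic(3)[rotated]) (rule measurable_const, simp)
  then have "{\<omega> \<in> space ?M. 1 \<le> t \<and> location n 1 (fst \<omega>) t = location n 2 (snd \<omega>) t} \<in> sets ?M" for t
    by (rule predE)
  then have "(\<lambda>\<omega>. if 1 \<le> t \<and> location n 1 (fst \<omega>) t = location n 2 (snd \<omega>) t then enat t else \<infinity>)
      \<in> ?M \<rightarrow>\<^sub>M count_space UNIV" for t
    by (rule measurable_If[rotated 2]) (rule measurable_const, simp)+
  then have "?T \<in> ?M \<rightarrow>\<^sub>M count_space UNIV"
    unfolding * by (rule measurable_INF[OF countableI_type])
  then show ?thesis
    unfolding case_prod_beta by (rule measurable_compose) (rule borel_measurable_count_space)
qed


section \<open>The strategies of Anderson--Weber and First-Same-or-Different\<close>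

definition perms :: "nat \<Rightarrow> nat \<Rightarrow> nat list set" where
  "perms n i = permutations_of_set ({1..n} - {i})"

definition decision_pmf :: "real \<Rightarrow> decision pmf" where
  "decision_pmf \<theta> = map_pmf (\<lambda>b. if b then Stay else Move) (bernoulli_pmf \<theta>)"

definition AW :: "nat \<Rightarrow> real \<Rightarrow> strategy" where
  "AW n \<theta> i k h = pair_pmf (decision_pmf \<theta>) (pmf_of_set (perms n i))"

text \<open>
  The permutations allowed in a round whose number is divisible by 3, where \<open>x\<close> and \<open>y\<close> are the data
  of the two preceding rounds and \<open>c\<close> is the decision in the present one.
\<close>
definition FSD_perms :: "nat \<Rightarrow> nat \<Rightarrow> round_data \<Rightarrow> round_data \<Rightarrow> decision \<Rightarrow> nat list set" where
  "FSD_perms n i x y c =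
     (if fst x = Move \<and> fst y = Move \<and> c = Move then
        if snd x ! 0 = snd y ! 0
        then {\<pi> \<in> perms n i. \<pi> ! 0 = snd x ! 0}
        else {\<pi> \<in> perms n i. \<pi> ! 0 \<notin> {snd x ! 0, snd y ! 0}}
      else perms n i)"

definition FSD :: "nat \<Rightarrow> real \<Rightarrow> strategy" where
  "FSD n \<theta> i k h =
     (if 3 dvd k + 1 then
        do {
          c \<leftarrow> decision_pmf \<theta>;
          \<pi> \<leftarrow> pmf_of_set (FSD_perms n i (h (k - 2)) (h (k - 1)) c);
          return_pmf (c, \<pi>)
        }
      else pair_pmf (decision_pmf \<theta>) (pmf_of_set (perms n i)))"

end

theory Submission
  imports Defs
begin

text \<open>
  Write \<open>m = n - 1\<close>. Both strategies restart after every three rounds, so the expected meeting time is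
  \<open>A / (1 - q)\<close>, where \<open>A\<close> sums the probabilities of not having met over the \<open>3 m\<close> times of such a block and \<open>q\<close>
  is the probability of not meeting within it. Under FSD any two of the three rounds of a player are still independent
  and uniform, hence the strategies differ only in the third round, and only if both players move in all three rounds.
  Conditioning on the first locations of the rounds, the difference is a sixfold sum over three \<open>m \<times> m\<close> tables,
  weighted by the deviations of the two players' third first location from uniformity. As these deviations have mean zero in
  each of the earlier locations, the sum collapses to a multiple of the covariance of two tables: the squared deviation
  \<open>(V - d)\<^sup>2\<close> of the probability \<open>V\<close> of missing each other in a whole round given the first locations, and
  the probability of missing each other for \<open>j\<close> steps. In an orthogonal basis of the two-dimensional space in
  which these tables live, both coordinates have the required sign.
\<close>

section \<open>Avoiding matches: the recursion\<close>

text \<open>Why a deviation of one player alone has no effect: against a uniform opponent the chance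
  of being missed during a whole round does not depend on one's own permutation, hence not on its
  first location. The two earlier rounds then factor out, and pairwise independence makes the
  remaining sum zero. Only the term in which both players deviate survives. Why a square appears: as
  a function of the second location \<open>b\<close>, the deviation consists of point masses at
  \<open>a\<close> and at the third location, up to a constant. All other products contain a full
  row or column sum of \<open>V - d\<close> and vanish. The sign hides a case distinction. For
  \<open>n = 4\<close> the deviations of \<open>V\<close> at equal and at distinct shared locations
  have the same square, so the second coordinate vanishes and the first one gives the exact value.
  From \<open>n = 5\<close> on the first coordinate is used only through its sign, and the lower
  bound comes from the second.\<close>

text \<open>
  \<open>avoid J M c\<close> is the probability that uniform permutations of two \<open>M\<close>-element sets with \<open>c\<close> common elements
  differ in the first \<open>J\<close> positions. The recursion removes from the event for \<open>J\<close> positions the match in one more;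
  \<open>avoid_first_step\<close> instead conditions on the first entries.
\<close>

primrec avoid :: "nat \<Rightarrow> real \<Rightarrow> real \<Rightarrow> real" where
  "avoid 0 M c = 1"
| "avoid (Suc J) M c = avoid J M c - c / M\<^sup>2 * avoid J (M - 1) (c - 1)"

text \<open>The three terms count the pairs of distinct first entries with both, exactly one or
  neither of them common, so that the overlap drops by 2, 1 or 0. As \<open>c\<close> is a real
  variable, the identity is proved algebraically from the defining recursion; \<open>J < M\<close>
  keeps the divisors \<open>M\<close>, \<open>M - 1\<close>, ... nonzero.\<close>

lemma avoid_first_step:
  assumes "real J < M"
  shows "M\<^sup>2 * avoid (Suc J) M c = c * (c - 1) * avoid J (M - 1) (c - 2)
    + 2 * c * (M - c) * avoid J (M - 1) (c - 1) + (M - c)\<^sup>2 * avoid J (M - 1) c"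
  using assms
proof (induction J arbitrary: M c)
  case 0
  then show ?case by (simp add: field_simps power2_eq_square)
next
  case (Suc J)
  have pos: "M \<noteq> 0" "M - 1 \<noteq> 0" "real J < M" "real J < M - 1"
    using Suc.prems by auto
  have *: "(M - 1)\<^sup>2 * avoid (Suc J) (M - 1) (c - 1) =
      (c - 1) * (c - 2) * avoid J (M - 2) (c - 3)
      + 2 * (c - 1) * (M - c) * avoid J (M - 2) (c - 2) + (M - c)\<^sup>2 * avoid J (M - 2) (c - 1)"
    using Suc.IH[OF pos(4), of "c - 1"] by (simp add: algebra_simps del: avoid.simps)
  have "M\<^sup>2 * avoid (Suc (Suc J)) M c = M\<^sup>2 * avoid (Suc J) M c - c * avoid (Suc J) (M - 1) (c - 1)"
    using pos by (subst avoid.simps(2)) (simp add: field_simps del: avoid.simps)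
  also have "M\<^sup>2 * avoid (Suc J) M c = c * (c - 1) * avoid J (M - 1) (c - 2)
    + 2 * c * (M - c) * avoid J (M - 1) (c - 1) + (M - c)\<^sup>2 * avoid J (M - 1) c"
    by (rule Suc.IH[OF pos(3)])
  also have "c * avoid (Suc J) (M - 1) (c - 1) = c / (M - 1)\<^sup>2 * ((M - 1)\<^sup>2 * avoid (Suc J) (M - 1) (c - 1))"
    using pos by simp
  also note *
  finally show ?case
    by (simp add: algebra_simps add_divide_distrib diff_divide_distrib)
qed

text \<open>Identify one private element of each set. Avoidance is lost exactly when the two sit at
  the same one of the first \<open>J\<close> positions, which has probability
  \<open>J / M^2\<close>, while the other \<open>J - 1\<close> positions, filled from
  \<open>M - 1\<close> elements with \<open>c\<close> common ones, show no match.\<close>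

lemma avoid_diff:
  "avoid J M (c + 1) - avoid J M c = - (real J / M\<^sup>2) * avoid (J - 1) (M - 1) c"
proof (induction J arbitrary: M c)
  case (Suc J)
  have 1: "avoid J M (c + 1) = avoid J M c - real J / M\<^sup>2 * avoid (J - 1) (M - 1) c"
    using Suc.IH[of M c] by simp
  have 2: "avoid J (M - 1) (c - 1) =
      avoid J (M - 1) c + real J / (M - 1)\<^sup>2 * avoid (J - 1) (M - 2) (c - 1)"
    using Suc.IH[of "M - 1" "c - 1"] by simp
  \<comment> \<open>The defining recursion at \<open>M - 1\<close>; the factor \<open>real J\<close>
    makes it valid also for \<open>J = 0\<close>, where \<open>J - 1\<close> truncates.\<close>
  have 3: "real J * avoid J (M - 1) c =
     real J * (avoid (J - 1) (M - 1) c - c / (M - 1)\<^sup>2 * avoid (J - 1) (M - 2) (c - 1))"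
    by (cases J) auto
  have "avoid (Suc J) M (c + 1) - avoid (Suc J) M c =
    (avoid J M (c + 1) - avoid J M c) - (c + 1) / M\<^sup>2 * avoid J (M - 1) c + c / M\<^sup>2 * avoid J (M - 1) (c - 1)"
    by simp
  also have "\<dots> = - (1 / M\<^sup>2) * (real J * (avoid (J - 1) (M - 1) c - c / (M - 1)\<^sup>2 * avoid (J - 1) (M - 2) (c - 1)) + avoid J (M - 1) c)"
    unfolding 1 2 by (simp add: algebra_simps add_divide_distrib diff_divide_distrib)
  also have "\<dots> = - (1 / M\<^sup>2) * (real J * avoid J (M - 1) c + avoid J (M - 1) c)"
    by (simp only: 3)
  finally show ?case by (simp add: algebra_simps add_divide_distrib)
qed simp

text \<open>The defining recursion subtracts, so the induction runs over the first-step identity,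
  whose coefficients are nonnegative. Where a shifted overlap would leave its range, the coefficient
  vanishes: this is the role of the cases \<open>c \<le> 1\<close>, \<open>c = 0\<close> and
  \<open>c = M\<close>.\<close>

lemma avoid_nonneg:
  assumes "J \<le> M" "c \<le> M"
  shows "0 \<le> avoid J (real M) (real c)"
  using assms
proof (induction J arbitrary: M c)
  case (Suc J)
  then obtain M' where M: "M = Suc M'" by (cases M) auto
  have J: "J \<le> M'" using Suc.prems M by simp
  have a: "0 \<le> real c * (real c - 1) * avoid J (real M - 1) (real c - 2)"
  proof (cases "c \<le> 1")
    case True then have "c = 0 \<or> c = 1" by auto
    then show ?thesis by auto
  next
    case False
    then have "0 \<le> avoid J (real M - 1) (real c - 2)" using Suc.IH[of M' "c - 2"] J Suc.prems M
      by (simp add: of_nat_diff)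
    then show ?thesis using False by (intro mult_nonneg_nonneg) auto
  qed
  have b: "0 \<le> 2 * real c * (real M - real c) * avoid J (real M - 1) (real c - 1)"
  proof (cases "c = 0")
    case False
    then show ?thesis using Suc.IH[of M' "c - 1"] J Suc.prems M
      by (simp add: of_nat_diff mult_nonneg_nonneg)
  qed simp
  have c: "0 \<le> (real M - real c)\<^sup>2 * avoid J (real M - 1) (real c)"
  proof (cases "c = M")
    case False
    then show ?thesis using Suc.IH[of M' c] J Suc.prems M by simp
  qed simp
  have "0 \<le> (real M)\<^sup>2 * avoid (Suc J) (real M) (real c)"
    unfolding avoid_first_step[of J "real M" "real c", OF Suc.prems(1)[unfolded Suc_le_eq, folded of_nat_less_iff[where 'a = real]]]
    using a b c by linarith
  then show ?case using M by (simp add: zero_le_mult_iff del: avoid.simps)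
qed simp

lemma avoid_Suc_le:
  assumes "J \<le> M" "c < M"
  shows "avoid J (real M) (real (Suc c)) \<le> avoid J (real M) (real c)"
proof (cases J)
  case (Suc J')
  have "0 \<le> avoid J' (real (M - 1)) (real c)" using assms Suc by (intro avoid_nonneg) auto
  then have "0 \<le> real J / (real M)\<^sup>2 * avoid (J - 1) (real M - 1) (real c)"
    using assms Suc by (simp add: of_nat_diff)
  then show ?thesis using avoid_diff[of J "real M" "real c"] by (simp add: add.commute)
qed simp

lemma avoid_antimono:
  assumes "J \<le> M" "c \<le> c'" "c' \<le> M"
  shows "avoid J (real M) (real c') \<le> avoid J (real M) (real c)"
  using assms(2,3)
proof (induction c' rule: dec_induct)
  case (step k)
  then show ?case using avoid_Suc_le[OF assms(1), of k] by fastforce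
qed simp

text \<open>Dropping every smaller overlap to the largest one turns the first-step identity into a bound.\<close>

lemma avoid_first_step_ge:
  assumes "J < M" "c < M"
  shows "((real M)\<^sup>2 - real c) * avoid J (real M - 1) (real c) \<le> (real M)\<^sup>2 * avoid (Suc J) (real M) (real c)"
proof -
  let ?A = "avoid J (real M - 1)"
  have M: "real M - 1 = real (M - 1)" using assms by (simp add: of_nat_diff)
  have a: "real c * (real c - 1) * ?A (real c) \<le> real c * (real c - 1) * ?A (real c - 2)"
  proof (cases "c \<le> 1")
    case True then have "c = 0 \<or> c = 1" by auto
    then show ?thesis by auto
  next
    case False
    then have "?A (real c) \<le> ?A (real (c - 2))" unfolding M using assms by (intro avoid_antimono) auto
    then show ?thesis using False by (intro mult_left_mono) (auto simp: of_nat_diff)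
  qed
  have b: "2 * real c * (real M - real c) * ?A (real c) \<le> 2 * real c * (real M - real c) * ?A (real c - 1)"
  proof (cases "c = 0")
    case False
    then have "?A (real c) \<le> ?A (real (c - 1))" unfolding M using assms by (intro avoid_antimono) auto
    then show ?thesis using False assms by (intro mult_left_mono) (auto simp: of_nat_diff)
  qed simp
  have "((real M)\<^sup>2 - real c) * ?A (real c) = real c * (real c - 1) * ?A (real c)
      + 2 * real c * (real M - real c) * ?A (real c) + (real M - real c)\<^sup>2 * ?A (real c)"
    by (simp add: algebra_simps power2_eq_square)
  also have "\<dots> \<le> (real M)\<^sup>2 * avoid (Suc J) (real M) (real c)"
    using assms a b by (subst avoid_first_step) auto
  finally show ?thesis .
qed

text \<open>The contrast needed below is a second difference in the overlap; differencing twice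
  lowers \<open>J\<close> and \<open>M\<close> by two and leaves a single term.\<close>

lemma avoid_second_diff:
  "avoid J M (c + 2) - 2 * avoid J M (c + 1) + avoid J M c =
     real J * (real J - 1) / (M\<^sup>2 * (M - 1)\<^sup>2) * avoid (J - 2) (M - 2) c"
proof -
  have "avoid J M (c + 2) - avoid J M (c + 1) = - (real J / M\<^sup>2) * avoid (J - 1) (M - 1) (c + 1)"
    using avoid_diff[of J M "c + 1"] by (simp add: add.assoc)
  moreover have "avoid J M (c + 1) - avoid J M c = - (real J / M\<^sup>2) * avoid (J - 1) (M - 1) c"
    by (rule avoid_diff)
  moreover have "x - 2 * y + z = k * (a - b)" if "x - y = k * a" "y - z = k * b" for x y z k a b :: real
    using that by (simp add: right_diff_distrib)
  ultimately have "avoid J M (c + 2) - 2 * avoid J M (c + 1) + avoid J M c =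
      - (real J / M\<^sup>2) * (avoid (J - 1) (M - 1) (c + 1) - avoid (J - 1) (M - 1) c)"
    by metis
  also have "\<dots> = - (real J / M\<^sup>2) * (- (real (J - 1) / (M - 1)\<^sup>2) * avoid (J - 1 - 1) (M - 1 - 1) c)"
    by (simp only: avoid_diff)
  finally show ?thesis by (cases J) (auto simp: numeral_2_eq_2)
qed

text \<open>Gives the sign of the first coordinate of the table for the third round, with
  \<open>M = n - 2\<close>. For \<open>J \<ge> 2\<close> the left side is
  \<open>J (J - 1) / (M (M - 1)^2)\<close> times \<open>g\<close>, the avoidance probability for
  \<open>J - 2\<close> positions and equal sets of size \<open>M - 2\<close>; two uses of
  \<open>avoid_first_step_ge\<close> bound the right side from below by a multiple of the same
  \<open>g\<close>.\<close>

lemma avoid_contrast: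
  assumes "2 \<le> M" "J \<le> M"
  shows "real M * (avoid J M M - 2 * avoid J M (real M - 1) + avoid J M (real M - 2))
     \<le> avoid J M (real M - 2)"
proof (cases "J < 2")
  case True
  then have "J = 0 \<or> J = 1" by auto
  then have *: "real J * (real J - 1) = 0" by auto
  have "avoid J M M - 2 * avoid J M (real M - 1) + avoid J M (real M - 2) = 0"
    using avoid_second_diff[of J M "real M - 2"] unfolding * by simp
  then show ?thesis
    using avoid_nonneg[of J M "M - 2"] assms by (simp add: of_nat_diff del: avoid.simps)
next
  case False
  define m where "m = real M"
  obtain K where K: "J = Suc (Suc K)" using False by (metis less_2_cases_iff not0_implies_Suc)
  obtain N where N: "M = Suc (Suc N)" using assms by (metis Suc_le_D numeral_2_eq_2 Suc_le_mono)
  define g where "g = avoid K (m - 2) (m - 2)"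
  have m: "m \<ge> 2" "m = 2 \<or> m \<ge> 3" using assms unfolding m_def by auto
  have g0: "g \<ge> 0" using avoid_nonneg[of K N N] assms K N unfolding g_def m_def by simp
  have 1: "(m\<^sup>2 - (m - 2)) * avoid (Suc K) (m - 1) (m - 2) \<le> m\<^sup>2 * avoid J m (m - 2)"
    using avoid_first_step_ge[of "Suc K" M N] assms K N unfolding m_def by (simp del: avoid.simps)
  have 2: "((m - 1)\<^sup>2 - (m - 2)) * g \<le> (m - 1)\<^sup>2 * avoid (Suc K) (m - 1) (m - 2)"
    using avoid_first_step_ge[of K "Suc N" N] assms K N unfolding m_def g_def by (simp del: avoid.simps)
  have "m * 1 \<le> m * m" using m by (intro mult_left_mono) auto
  then have pos: "m\<^sup>2 - (m - 2) \<ge> 0" unfolding power2_eq_square by linarith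
  have "(m\<^sup>2 - (m - 2)) * (((m - 1)\<^sup>2 - (m - 2)) * g) \<le> (m\<^sup>2 - (m - 2)) * ((m - 1)\<^sup>2 * avoid (Suc K) (m - 1) (m - 2))"
    using 2 pos by (rule mult_left_mono)
  also have "\<dots> = (m - 1)\<^sup>2 * ((m\<^sup>2 - (m - 2)) * avoid (Suc K) (m - 1) (m - 2))" by simp
  also have "\<dots> \<le> (m - 1)\<^sup>2 * (m\<^sup>2 * avoid J m (m - 2))" using 1 by (intro mult_left_mono) auto
  finally have A: "(m\<^sup>2 - (m - 2)) * ((m - 1)\<^sup>2 - (m - 2)) * g \<le> (m - 1)\<^sup>2 * m\<^sup>2 * avoid J m (m - 2)"
    by (simp add: mult.assoc)
  \<comment> \<open>What the two lower bounds give beyond the required \<open>m^2 (m - 1)\<close>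
    factors completely: it is zero at \<open>m = 2\<close> and positive from \<open>m = 3\<close>
    on, hence the case split on \<open>m\<close>.\<close>
  have "(m\<^sup>2 - (m - 2)) * ((m - 1)\<^sup>2 - (m - 2)) - m\<^sup>2 * (m - 1) = (m - 2) * ((m - 1) ^ 3 - 2)"
    by (simp add: algebra_simps power2_eq_square power3_eq_cube)
  moreover have "(m - 2) * ((m - 1) ^ 3 - 2) \<ge> 0"
    using m(2)
  proof
    assume "m \<ge> 3"
    then have "2 ^ 3 \<le> (m - 1) ^ 3" by (intro power_mono) auto
    with \<open>m \<ge> 3\<close> show ?thesis by (intro mult_nonneg_nonneg) auto
  qed auto
  ultimately have B: "m\<^sup>2 * (m - 1) * g \<le> (m - 1)\<^sup>2 * m\<^sup>2 * avoid J m (m - 2)"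
    using A mult_right_mono[of "m\<^sup>2 * (m - 1)" "(m\<^sup>2 - (m - 2)) * ((m - 1)\<^sup>2 - (m - 2))" g] g0
    by linarith
  have J: "real J * (real J - 1) \<le> m * (m - 1)" using assms K unfolding m_def by (intro mult_mono) auto
  have "m * (real J * (real J - 1)) * g \<le> m * (m * (m - 1)) * g"
    using J m g0 by (intro mult_right_mono mult_left_mono) auto
  also have "\<dots> \<le> (m - 1)\<^sup>2 * m\<^sup>2 * avoid J m (m - 2)"
    using B by (simp add: power2_eq_square mult.assoc)
  finally have "m * (real J * (real J - 1)) * g / (m\<^sup>2 * (m - 1)\<^sup>2) \<le> avoid J m (m - 2)"
    using m by (simp add: field_simps)
  moreover have "m * (avoid J m m - 2 * avoid J m (m - 1) + avoid J m (m - 2)) =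
     m * (real J * (real J - 1)) * g / (m\<^sup>2 * (m - 1)\<^sup>2)"
    using avoid_second_diff[of J m "m - 2"] K unfolding g_def by (simp del: avoid.simps)
  ultimately show ?thesis unfolding m_def by simp
qed

text \<open>Two permutations of the same set: the probability that a random permutation has no fixed point.\<close>

definition derange :: "nat \<Rightarrow> real" where
  "derange m = avoid m m m"

text \<open>For equal sets only the first term of the first-step identity survives.\<close>

lemma avoid_derange:
  "real m * avoid m m (real m - 1) = (real m + 1) * derange (Suc m)"
proof -
  have "(real m + 1) ^ 2 * derange (Suc m) = (real m + 1) * real m * avoid m m (real m - 1)"
    unfolding derange_def
    using avoid_first_step[of m "real (Suc m)" "real (Suc m)"] by (simp add: add.commute del: avoid.simps)
  then show ?thesis by (simp add: power2_eq_square mult.assoc del: of_nat_Suc)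
qed

text \<open>The classical \<open>d_(k+2) = (k + 1) (d_(k+1) + d_k)\<close> for derangement numbers,
  divided by \<open>(k + 1)!\<close>.\<close>

lemma derange_rec:
  "(real m + 2) * derange (Suc (Suc m)) = (real m + 1) * derange (Suc m) + derange m"
proof -
  have "avoid (Suc m) (real (Suc m)) (real m) = derange (Suc m) + derange m / (real m + 1)"
    using avoid_diff[of "Suc m" "real (Suc m)" "real m"] unfolding derange_def
    by (simp add: add.commute power2_eq_square del: avoid.simps)
  then show ?thesis
    using avoid_derange[of "Suc m"] by (simp add: field_simps del: avoid.simps)
qed

lemma derange_1: "derange 1 = 0" and derange_2: "derange 2 = 1 / 2"
  by (simp_all add: derange_def numeral_2_eq_2 power2_eq_square)

lemma derange_3: "derange 3 = 1 / 3" and derange_4: "derange 4 = 3 / 8" and derange_5: "derange 5 = 11 / 30"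
proof -
  show 3: "derange 3 = 1 / 3" using derange_rec[of 1] derange_1 derange_2 by (simp add: numeral_eq_Suc)
  show 4: "derange 4 = 3 / 8" using derange_rec[of 2] derange_2 3 by (simp add: numeral_eq_Suc)
  show "derange 5 = 11 / 30" using derange_rec[of 3] 3 4 by (simp add: numeral_eq_Suc)
qed

text \<open>The recurrence expresses \<open>derange\<close> as a convex combination of its two predecessors.\<close>

lemma derange_bounds: "4 \<le> m \<Longrightarrow> 11 / 30 \<le> derange m \<and> derange m \<le> 3 / 8"
proof (induction m rule: less_induct)
  case (less m)
  consider "m = 4" | "m = 5" | k where "m = Suc (Suc k)" "4 \<le> k"
  proof -
    assume a: "m = 4 \<Longrightarrow> thesis" "m = 5 \<Longrightarrow> thesis" "\<And>k. m = Suc (Suc k) \<Longrightarrow> 4 \<le> k \<Longrightarrow> thesis"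
    have "m = 4 \<or> m = 5 \<or> (m = Suc (Suc (m - 2)) \<and> 4 \<le> m - 2)" using less.prems by arith
    with a show thesis by blast
  qed
  then show ?case
  proof cases
    case (3 k)
    have "11 / 30 \<le> derange k \<and> derange k \<le> 3 / 8" "11 / 30 \<le> derange (Suc k) \<and> derange (Suc k) \<le> 3 / 8"
      using less.IH[of k] less.IH[of "Suc k"] 3 by auto
    moreover from this have "(real k + 1) * (11 / 30) \<le> (real k + 1) * derange (Suc k)"
      "(real k + 1) * derange (Suc k) \<le> (real k + 1) * (3 / 8)" by (intro mult_left_mono; simp)+
    ultimately have "(real k + 2) * (11 / 30) \<le> (real k + 2) * derange m"
      "(real k + 2) * derange m \<le> (real k + 2) * (3 / 8)"
      using derange_rec[of k] unfolding 3(1) by (simp_all only: distrib_right) linarith+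
    then show ?thesis by (simp del: times_divide_eq_right)
  qed (simp_all add: derange_4 derange_5)
qed

section \<open>Matches of random permutations\<close>

definition avg :: "'a set \<Rightarrow> ('a \<Rightarrow> real) \<Rightarrow> real" where
  "avg A f = sum f A / real (card A)"

lemma avg_cong: "(\<And>x. x \<in> A \<Longrightarrow> f x = g x) \<Longrightarrow> avg A f = avg A g"
  unfolding avg_def by (simp cong: sum.cong)

lemma sum_permutations_of_set:
  assumes "finite A" "A \<noteq> {}"
  shows "sum f (permutations_of_set A) = (\<Sum>x\<in>A. \<Sum>xs\<in>permutations_of_set (A - {x}). f (x # xs))"
proof -
  have "sum f (permutations_of_set A) = (\<Sum>x\<in>A. sum f ((#) x ` permutations_of_set (A - {x})))"
    using assms by (subst permutations_of_set_nonempty, simp, subst sum.UNION_disjoint) auto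
  also have "\<dots> = (\<Sum>x\<in>A. \<Sum>xs\<in>permutations_of_set (A - {x}). f (x # xs))"
    by (simp add: sum.reindex inj_on_def)
  finally show ?thesis .
qed

lemma avg_permutations_of_set:
  assumes "finite A" "A \<noteq> {}"
  shows "avg (permutations_of_set A) f =
    avg A (\<lambda>x. avg (permutations_of_set (A - {x})) (\<lambda>xs. f (x # xs)))"
proof -
  obtain k where k: "card A = Suc k" using assms by (cases "card A") auto
  show ?thesis
    using assms unfolding avg_def sum_permutations_of_set[OF assms]
    by (simp add: k card_Diff_singleton sum_divide_distrib field_simps cong: sum.cong)
qed

definition no_match :: "nat \<Rightarrow> 'a list \<Rightarrow> 'a list \<Rightarrow> bool" where
  "no_match J p q \<longleftrightarrow> (\<forall>l<J. p ! l \<noteq> q ! l)"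

lemma no_match_Suc_Cons: "no_match (Suc J) (x # p) (y # q) \<longleftrightarrow> x \<noteq> y \<and> no_match J p q"
  unfolding no_match_def by (auto simp: nth_Cons less_Suc_eq_0_disj split: nat.splits)

text \<open>Identifies the real recursion with a probability. After first entries
  \<open>x \<noteq> y\<close> the tails are uniform on \<open>A - {x}\<close> and
  \<open>B - {y}\<close>, whose overlap has dropped by the number of common elements among
  \<open>x\<close> and \<open>y\<close>; counting the pairs reproduces
  \<open>avoid_first_step\<close>.\<close>

lemma avg_no_match:
  assumes "finite A" "finite B" "card A = M" "card B = M" "J \<le> M"
  shows "avg (permutations_of_set A) (\<lambda>p. avg (permutations_of_set B) (\<lambda>q. of_bool (no_match J p q)))
    = avoid J (real M) (real (card (A \<inter> B)))"
  using assms
proof (induction J arbitrary: A B M)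
  case 0
  then show ?case by (auto simp: no_match_def avg_def)
next
  case (Suc J)
  obtain M' where M: "M = Suc M'" using Suc.prems by (cases M) auto
  have ne: "A \<noteq> {}" "B \<noteq> {}" using Suc.prems M by auto
  define C where "C = A \<inter> B"
  define c where "c = card C"
  have C: "finite C" "C \<subseteq> A" "C \<subseteq> B" using Suc.prems by (auto simp: C_def)
  \<comment> \<open>\<open>k\<close> is the number of common elements used up by the two first
    entries.\<close>
  define h where "h k = avoid J (real M - 1) (real c - k)" for k
  have step: "avg (permutations_of_set (A - {x})) (\<lambda>p. avg (permutations_of_set (B - {y}))
        (\<lambda>q. of_bool (no_match (Suc J) (x # p) (y # q)))) =
      (if x = y then 0 else h (of_bool (x \<in> C) + of_bool (y \<in> C)))" (is "?L = _") if "x \<in> A" "y \<in> B" for x y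
  proof (cases "x = y")
    case False
    have eq: "(A - {x}) \<inter> (B - {y}) = C - {x} - {y}" by (auto simp: C_def)
    have sub: "{x, y} \<inter> C \<subseteq> C" by auto
    have "card ({x, y} \<inter> C) = of_bool (x \<in> C) + of_bool (y \<in> C)" using False by auto
    moreover have "C - {x} - {y} = C - ({x, y} \<inter> C)" by auto
    ultimately have "real (card (C - {x} - {y})) = real c - (of_bool (x \<in> C) + of_bool (y \<in> C))"
      using C card_mono[OF C(1) sub] by (simp add: c_def card_Diff_subset of_nat_diff)
    moreover have "?L = avoid J (real M') (real (card ((A - {x}) \<inter> (B - {y}))))"
      using Suc.IH[of "A - {x}" "B - {y}" M'] Suc.prems that M False
      by (simp add: no_match_Suc_Cons card_Diff_singleton)
    ultimately show ?thesis using False unfolding eq h_def M by simp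
  qed (simp add: no_match_Suc_Cons avg_def)
  have inner: "(\<Sum>y\<in>B. if x = y then 0 else h (of_bool (x \<in> C) + of_bool (y \<in> C))) =
      (if x \<in> C then (real c - 1) * h 2 + (real M - real c) * h 1
       else real c * h 1 + (real M - real c) * h 0)" if "x \<in> A" for x
  proof -
    have cB: "real (card (B - C)) = real M - real c"
      using C Suc.prems card_mono[of B C] by (simp add: card_Diff_subset of_nat_diff c_def)
    have "(\<Sum>y\<in>B. if x = y then 0 else h (of_bool (x \<in> C) + of_bool (y \<in> C))) =
        (\<Sum>y\<in>B - C. if x = y then 0 else h (of_bool (x \<in> C))) +
        (\<Sum>y\<in>C. if x = y then 0 else h (of_bool (x \<in> C) + 1))"
      using C Suc.prems by (subst sum.subset_diff[of C B]) (auto intro!: arg_cong2[of _ _ _ _ "(+)"] sum.cong)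
    also have "(\<Sum>y\<in>B - C. if x = y then 0 else h (of_bool (x \<in> C))) = (\<Sum>y\<in>B - C. h (of_bool (x \<in> C)))"
      using that by (intro sum.cong) (auto simp: C_def)
    also have "\<dots> = (real M - real c) * h (of_bool (x \<in> C))" by (simp add: cB)
    also have "(\<Sum>y\<in>C. if x = y then 0 else h (of_bool (x \<in> C) + 1)) =
        (\<Sum>y\<in>C - {x}. h (of_bool (x \<in> C) + 1))"
      using C by (intro sum.mono_neutral_cong_right) auto
    also have "\<dots> = (real c - of_bool (x \<in> C)) * h (of_bool (x \<in> C) + 1)"
      using C card_gt_0_iff[of C] by (auto simp: c_def card_Diff_singleton of_nat_diff)
    finally show ?thesis by (auto simp: add.commute)
  qed
  have cA: "real (card (A - C)) = real M - real c"
    using C Suc.prems card_mono[of A C] by (simp add: card_Diff_subset of_nat_diff c_def)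
  have "avg (permutations_of_set A) (\<lambda>p. avg (permutations_of_set B) (\<lambda>q. of_bool (no_match (Suc J) p q)))
      = avg A (\<lambda>x. avg (permutations_of_set (A - {x})) (\<lambda>p. avg B (\<lambda>y. avg (permutations_of_set (B - {y}))
        (\<lambda>q. of_bool (no_match (Suc J) (x # p) (y # q))))))"
    using Suc.prems ne by (simp add: avg_permutations_of_set)
  also have "\<dots> = avg A (\<lambda>x. avg B (\<lambda>y. avg (permutations_of_set (A - {x})) (\<lambda>p. avg (permutations_of_set (B - {y}))
        (\<lambda>q. of_bool (no_match (Suc J) (x # p) (y # q))))))"
    unfolding avg_def sum_divide_distrib by (subst sum.swap) (simp add: mult_ac)
  also have "\<dots> = avg A (\<lambda>x. avg B (\<lambda>y. if x = y then 0 else h (of_bool (x \<in> C) + of_bool (y \<in> C))))"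
    by (intro avg_cong step)
  also have "\<dots> = (\<Sum>x\<in>A. if x \<in> C then (real c - 1) * h 2 + (real M - real c) * h 1
       else real c * h 1 + (real M - real c) * h 0) / (real M)\<^sup>2"
    unfolding avg_def using Suc.prems inner
    by (simp add: sum_divide_distrib[symmetric] power2_eq_square cong: sum.cong)
  also have "(\<Sum>x\<in>A. if x \<in> C then (real c - 1) * h 2 + (real M - real c) * h 1
       else real c * h 1 + (real M - real c) * h 0) =
       real c * ((real c - 1) * h 2 + (real M - real c) * h 1) +
       (real M - real c) * (real c * h 1 + (real M - real c) * h 0)"
    using C Suc.prems by (subst sum.subset_diff[of C A]) (auto simp: cA c_def[symmetric])
  also have "\<dots> = real c * (real c - 1) * h 2 + 2 * real c * (real M - real c) * h 1 + (real M - real c)\<^sup>2 * h 0"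
    by (simp add: algebra_simps power2_eq_square)
  also have "\<dots> = (real M)\<^sup>2 * avoid (Suc J) (real M) (real c)"
    using Suc.prems avoid_first_step[of J "real M" "real c"] unfolding h_def by (simp del: avoid.simps)
  finally show ?case using M unfolding c_def C_def by (simp del: avoid.simps)
qed

section \<open>Histories of finitely many rounds\<close>

text \<open>\<open>history\<close> evaluates kernels on \<open>(!) xs\<close>, which is unspecified
  beyond the end of the list; causality makes this harmless.\<close>

definition causal :: "round_kernel \<Rightarrow> bool" where
  "causal K \<longleftrightarrow> (\<forall>k h h'. (\<forall>i<k. h i = h' i) \<longrightarrow> K k h = K k h')"

primrec history :: "round_kernel \<Rightarrow> nat \<Rightarrow> round_data list pmf" where
  "history K 0 = return_pmf []"
| "history K (Suc k) = bind_pmf (history K k) (\<lambda>xs. map_pmf (\<lambda>x. xs @ [x]) (K k ((!) xs)))"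

lemma length_history: "xs \<in> set_pmf (history K k) \<Longrightarrow> length xs = k"
  by (induction k arbitrary: xs) auto

lemma measurable_prefix:
  "(\<lambda>\<omega>. map \<omega> [0..<k]) \<in> PiM {0..<k} (\<lambda>_. count_space (UNIV :: 'a :: countable set)) \<rightarrow>\<^sub>M count_space UNIV"
proof -
  have "PiM {0..<k} (\<lambda>_. count_space (UNIV :: 'a set)) = count_space (PiE {0..<k} (\<lambda>_. UNIV))"
    by (rule count_space_PiM_finite) auto
  then show ?thesis by simp
qed

text \<open>Brings the Ionescu-Tulcea construction down to discrete laws on lists: both sides are
  built by adding one round at a time.\<close>

lemma distr_C_history:
  assumes "causal K"
  shows "distr (Ionescu_Tulcea.C (\<lambda>k h. measure_pmf (K k h)) (\<lambda>_. count_space UNIV) 0 k (\<lambda>_. undefined))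
    (count_space UNIV) (\<lambda>\<omega>. map \<omega> [0..<k]) = measure_pmf (history K k)"
proof -
  interpret Ionescu_Tulcea "\<lambda>k h. measure_pmf (K k h)" "\<lambda>_. count_space UNIV"
    by (rule Ionescu_Tulcea_round_kernel)
  have u: "(\<lambda>_. undefined) \<in> space (PiM {0..<0} (\<lambda>_. count_space UNIV))" by (simp add: space_PiM PiE_iff extensional_def)
  show ?thesis
  proof (induction k)
    case 0
    have "(\<lambda>\<omega>. []) \<in> PiM {0..<0} (\<lambda>_. count_space (UNIV :: round_data set)) \<rightarrow>\<^sub>M count_space UNIV" by simp
    then show ?case
      by (simp add: distr_return return_pmf.rep_eq space_PiM)
  next
    case (Suc k)
    let ?P = "\<lambda>k. PiM {0..<k} (\<lambda>_. count_space (UNIV :: round_data set))"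
    let ?F = "\<lambda>xs. measure_pmf (map_pmf (\<lambda>x. xs @ [x]) (K k ((!) xs)))"
    have sp: "space (C 0 k (\<lambda>_. undefined)) = space (?P k)"
      and se: "sets (C 0 k (\<lambda>_. undefined)) = sets (?P k)"
      using space_C[OF u, of k] sets_C[OF u, of k] by auto
    have step: "distr (eP k \<omega>) (count_space UNIV) (\<lambda>\<omega>. map \<omega> [0..<Suc k]) = ?F (map \<omega> [0..<k])"
      if \<omega>: "\<omega> \<in> space (?P k)" for \<omega>
    proof -
      have "distr (eP k \<omega>) (count_space UNIV) (\<lambda>\<omega>. map \<omega> [0..<Suc k]) =
          distr (measure_pmf (K k \<omega>)) (count_space UNIV) ((\<lambda>\<omega>. map \<omega> [0..<Suc k]) \<circ> fun_upd \<omega> k)"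
        unfolding eP_def using \<omega>
        by (intro distr_distr measurable_prefix) (auto simp: space_PiM PiE_iff extensional_def)
      also have "(\<lambda>\<omega>. map \<omega> [0..<Suc k]) \<circ> fun_upd \<omega> k = (\<lambda>x. map \<omega> [0..<k] @ [x])"
        by (auto simp: fun_eq_iff)
      \<comment> \<open>The sequence and the list agree below \<open>k\<close>, which is all that a
        causal kernel sees.\<close>
      also have "K k \<omega> = K k ((!) (map \<omega> [0..<k]))"
        using assms unfolding causal_def by (metis add_0 diff_zero nth_map_upt)
      finally show ?thesis by (simp add: map_pmf_rep_eq)
    qed
    have "distr (C 0 (Suc k) (\<lambda>_. undefined)) (count_space UNIV) (\<lambda>\<omega>. map \<omega> [0..<Suc k])
        = C 0 k (\<lambda>_. undefined) \<bind> (\<lambda>\<omega>. distr (eP k \<omega>) (count_space UNIV) (\<lambda>\<omega>. map \<omega> [0..<Suc k]))"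
      unfolding C.simps add_0
      by (rule distr_bind[where K = "?P (Suc k)"]) (auto simp: sp measurable_cong_sets[OF se refl] measurable_prefix space_PiM_empty_iff simp del: upt_Suc intro: measurable_eP)
    also have "\<dots> = C 0 k (\<lambda>_. undefined) \<bind> (\<lambda>\<omega>. ?F (map \<omega> [0..<k]))"
      by (intro bind_cong refl step) (simp add: sp)
    also have "\<dots> = distr (C 0 k (\<lambda>_. undefined)) (count_space UNIV) (\<lambda>\<omega>. map \<omega> [0..<k]) \<bind> ?F"
      by (rule bind_distr[where K = "count_space UNIV", symmetric])
        (auto simp: sp measurable_cong_sets[OF se refl] measurable_prefix measure_pmf_in_subprob_algebra space_PiM_empty_iff simp del: measurable_count_space_eq2_countable)
    finally show ?case by (simp only: Suc history.simps measure_pmf_bind)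
  qed
qed

lemma measurable_prefix_round_process:
  "(\<lambda>\<omega>. map \<omega> [0..<k]) \<in> round_process K \<rightarrow>\<^sub>M count_space UNIV"
proof -
  have "(\<lambda>\<omega>. map (restrict \<omega> {0..<k}) [0..<k]) \<in> round_process K \<rightarrow>\<^sub>M count_space UNIV"
    by (rule measurable_compose[OF _ measurable_prefix]) (simp add: measurable_cong_sets[OF sets_round_process])
  moreover have "map (restrict \<omega> {0..<k}) [0..<k] = map \<omega> [0..<k]" for \<omega> :: "nat \<Rightarrow> round_data" by simp
  ultimately show ?thesis by simp
qed

lemma distr_round_process_history:
  assumes "causal K"
  shows "distr (round_process K) (count_space UNIV) (\<lambda>\<omega>. map \<omega> [0..<k]) = measure_pmf (history K k)"
proof -
  have "distr (round_process K) (count_space UNIV) (\<lambda>\<omega>. map \<omega> [0..<k]) =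
      distr (distr (round_process K) (PiM {0..<k} (\<lambda>_. count_space UNIV)) (\<lambda>\<omega>. restrict \<omega> {0..<k}))
       (count_space UNIV) (\<lambda>\<omega>. map \<omega> [0..<k])"
    by (subst distr_distr[OF measurable_prefix])
      (auto simp: measurable_cong_sets[OF sets_round_process] o_def intro!: distr_cong)
  also have "\<dots> = measure_pmf (history K k)"
    unfolding distr_round_process by (rule distr_C_history[OF assms])
  finally show ?thesis .
qed

text \<open>The product measure is integrated one player at a time, and each marginal is replaced by
  its discrete law.\<close>

lemma emeasure_two_histories:
  assumes "causal K1" "causal K2"
  shows "emeasure (round_process K1 \<Otimes>\<^sub>M round_process K2)
      {\<omega> \<in> space (round_process K1 \<Otimes>\<^sub>M round_process K2). Q (map (fst \<omega>) [0..<k]) (map (snd \<omega>) [0..<k])} =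
    emeasure (pair_pmf (history K1 k) (history K2 k)) {x. Q (fst x) (snd x)}"
proof -
  let ?M1 = "round_process K1" and ?M2 = "round_process K2"
  let ?p = "\<lambda>\<omega>. map \<omega> [0..<k]"
  interpret M1: prob_space ?M1 by (rule prob_space_round_process)
  interpret M2: prob_space ?M2 by (rule prob_space_round_process)
  have [measurable]: "?p \<in> ?M1 \<rightarrow>\<^sub>M count_space UNIV" "?p \<in> ?M2 \<rightarrow>\<^sub>M count_space UNIV"
    by (rule measurable_prefix_round_process)+
  have "(\<lambda>\<omega>. (?p (fst \<omega>), ?p (snd \<omega>))) \<in> ?M1 \<Otimes>\<^sub>M ?M2 \<rightarrow>\<^sub>M count_space UNIV \<Otimes>\<^sub>M count_space UNIV"
    by measurable
  then have m: "(\<lambda>\<omega>. (?p (fst \<omega>), ?p (snd \<omega>))) \<in> ?M1 \<Otimes>\<^sub>M ?M2 \<rightarrow>\<^sub>M count_space UNIV"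
    by (simp add: pair_measure_countable)
  have "{\<omega> \<in> space (?M1 \<Otimes>\<^sub>M ?M2). Q (?p (fst \<omega>)) (?p (snd \<omega>))} =
      (\<lambda>\<omega>. (?p (fst \<omega>), ?p (snd \<omega>))) -` {x. Q (fst x) (snd x)} \<inter> space (?M1 \<Otimes>\<^sub>M ?M2)" by auto
  also have "\<dots> \<in> sets (?M1 \<Otimes>\<^sub>M ?M2)" by (rule measurable_sets[OF m]) simp
  finally have S: "{\<omega> \<in> space (?M1 \<Otimes>\<^sub>M ?M2). Q (?p (fst \<omega>)) (?p (snd \<omega>))} \<in> sets (?M1 \<Otimes>\<^sub>M ?M2)" .
  have "emeasure (?M1 \<Otimes>\<^sub>M ?M2) {\<omega> \<in> space (?M1 \<Otimes>\<^sub>M ?M2). Q (?p (fst \<omega>)) (?p (snd \<omega>))} =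
     (\<integral>\<^sup>+x. \<integral>\<^sup>+y. indicator {x. Q (fst x) (snd x)} (?p x, ?p y) \<partial>?M2 \<partial>?M1)"
    unfolding M2.emeasure_pair_measure[OF S]
    by (intro nn_integral_cong) (auto simp: space_pair_measure split: split_indicator)
  also have "\<dots> = (\<integral>\<^sup>+x. \<integral>\<^sup>+y. indicator {x. Q (fst x) (snd x)} (?p x, y) \<partial>history K2 k \<partial>?M1)"
    by (subst distr_round_process_history[OF assms(2), symmetric], subst nn_integral_distr) auto
  also have "\<dots> = (\<integral>\<^sup>+x. \<integral>\<^sup>+y. indicator {x. Q (fst x) (snd x)} (x, y) \<partial>history K2 k \<partial>history K1 k)"
    by (subst distr_round_process_history[OF assms(1), symmetric], subst nn_integral_distr) auto
  finally show ?thesis by (simp add: nn_integral_pair_pmf'[symmetric])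
qed

section \<open>Tail sums for the expected meeting time\<close>

lemma less_meeting_time_iff:
  "enat s < meeting_time s1 s2 \<longleftrightarrow> (\<forall>t\<in>{1..s}. s1 t \<noteq> s2 t)"
  unfolding meeting_time_def Suc_ile_eq[symmetric] le_INF_iff
  by (auto simp: not_less_eq_eq[symmetric])

lemma location_cong:
  "1 \<le> t \<Longrightarrow> t \<le> k * (n - 1) \<Longrightarrow> (\<And>i. i < k \<Longrightarrow> \<omega> i = \<omega>' i) \<Longrightarrow> location n i \<omega> t = location n i \<omega>' t"
proof -
  assume a: "1 \<le> t" "t \<le> k * (n - 1)" "\<And>i. i < k \<Longrightarrow> \<omega> i = \<omega>' i"
  from a have "0 < n - 1" by (cases "n - 1") auto
  then have "(t - 1) div (n - 1) < k" using a by (subst div_less_iff_less_mult) auto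
  with a show ?thesis unfolding location_def by simp
qed

definition apart :: "nat \<Rightarrow> nat \<Rightarrow> round_data list \<Rightarrow> round_data list \<Rightarrow> bool" where
  "apart n s xs ys \<longleftrightarrow> (\<forall>t\<in>{1..s}. location n 1 ((!) xs) t \<noteq> location n 2 ((!) ys) t)"

text \<open>The mean of an \<open>enat\<close>-valued variable is the sum of the probabilities that
  it exceeds \<open>s\<close>. The number \<open>k s\<close> of inspected rounds is left free,
  subject to covering the times up to \<open>s\<close>.\<close>

lemma expected_meeting_time_eq:
  assumes "causal (\<sigma> 1)" "causal (\<sigma> 2)" "\<And>s. s \<le> k s * (n - 1)"
  shows "expected_meeting_time n \<sigma> = (\<Sum>s. emeasure (pair_pmf (history (\<sigma> 1) (k s)) (history (\<sigma> 2) (k s)))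
     {x. apart n s (fst x) (snd x)})"
proof -
  let ?M = "round_process (\<sigma> 1) \<Otimes>\<^sub>M round_process (\<sigma> 2)"
  have "expected_meeting_time n \<sigma> =
     (\<Sum>s. emeasure ?M {\<omega> \<in> space ?M. enat s < meeting_time (location n 1 (fst \<omega>)) (location n 2 (snd \<omega>))})"
  proof -
    \<comment> \<open>The tail formula asks for measurability into \<open>enat\<close>, which is
      recovered from the \<open>ennreal\<close> version through preimages of single points.\<close>
    have "(\<lambda>\<omega>. meeting_time (location n 1 (fst \<omega>)) (location n 2 (snd \<omega>))) \<in> ?M \<rightarrow>\<^sub>M count_space UNIV"
      (is "?T \<in> _")
    proof (subst measurable_count_space_eq2_countable, intro CollectI conjI ballI)
      fix a
      have "?T -` {a} \<inter> space ?M = (\<lambda>(\<omega>1, \<omega>2). ennreal_of_enat (meeting_time (location n 1 \<omega>1) (location n 2 \<omega>2)))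
         -` {ennreal_of_enat a} \<inter> space ?M"
        by auto
      also have "\<dots> \<in> sets ?M"
        by (rule measurable_sets[OF measurable_meeting_time]) simp
      finally show "?T -` {a} \<inter> space ?M \<in> sets ?M" .
    qed auto
    from nn_integral_enat_function[OF this] show ?thesis
      unfolding expected_meeting_time_def by (simp add: split_def)
  qed
  also have "\<dots> = (\<Sum>s. emeasure ?M {\<omega> \<in> space ?M. apart n s (map (fst \<omega>) [0..<k s]) (map (snd \<omega>) [0..<k s])})"
  proof (intro suminf_cong arg_cong2[where f = emeasure] refl Collect_cong conj_cong)
    fix s and \<omega> :: "(nat \<Rightarrow> round_data) \<times> (nat \<Rightarrow> round_data)"
    have "location n i ((!) (map \<omega>' [0..<k s])) t = location n i \<omega>' t" if "t \<in> {1..s}" for i t \<omega>'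
      using that assms(3)[of s] by (intro location_cong[of t "k s"]) auto
    then show "enat s < meeting_time (location n 1 (fst \<omega>)) (location n 2 (snd \<omega>)) \<longleftrightarrow>
       apart n s (map (fst \<omega>) [0..<k s]) (map (snd \<omega>) [0..<k s])"
      unfolding less_meeting_time_iff apart_def by simp
  qed
  finally show ?thesis by (simp only: emeasure_two_histories[OF assms(1,2)])
qed

section \<open>Periodic strategies\<close>

text \<open>The kernel starts afresh after \<open>p\<close> rounds and ignores what came before.
  \<open>FSD\<close> satisfies this with \<open>p = 3\<close>, \<open>AW\<close> with every
  \<open>p\<close>.\<close>

definition periodic :: "nat \<Rightarrow> round_kernel \<Rightarrow> bool" where
  "periodic p K \<longleftrightarrow> (\<forall>k h. K (p + k) h = K k (\<lambda>i. h (p + i)))"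

lemma history_append:
  assumes "periodic p K"
  shows "history K (p + k) = bind_pmf (history K p) (\<lambda>ys. map_pmf ((@) ys) (history K k))"
proof (induction k)
  case 0
  then show ?case by (simp add: bind_return_pmf')
next
  case (Suc k)
  have "history K (p + Suc k) = bind_pmf (history K p) (\<lambda>ys. bind_pmf (history K k)
      (\<lambda>xs. map_pmf (\<lambda>x. (ys @ xs) @ [x]) (K (p + k) ((!) (ys @ xs)))))"
    by (simp add: Suc bind_assoc_pmf bind_map_pmf)
  also have "\<dots> = bind_pmf (history K p) (\<lambda>ys. map_pmf ((@) ys) (history K (Suc k)))"
  proof (intro bind_pmf_cong refl)
    fix ys assume "ys \<in> set_pmf (history K p)"
    then have ys: "length ys = p" by (rule length_history)
    have "K (p + k) ((!) (ys @ xs)) = K k ((!) xs)" for xs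
    proof -
      have "K (p + k) ((!) (ys @ xs)) = K k (\<lambda>i. (ys @ xs) ! (p + i))"
        using assms unfolding periodic_def by blast
      also have "(\<lambda>i. (ys @ xs) ! (p + i)) = (!) xs" using ys by (auto simp: fun_eq_iff nth_append)
      finally show ?thesis .
    qed
    then show "bind_pmf (history K k) (\<lambda>xs. map_pmf (\<lambda>x. (ys @ xs) @ [x]) (K (p + k) ((!) (ys @ xs))))
        = map_pmf ((@) ys) (history K (Suc k))"
      by (simp add: map_bind_pmf map_pmf_comp)
  qed
  finally show ?case .
qed

lemma apart_append:
  assumes "length ys1 = p" "length ys2 = p" "0 < n - 1"
  shows "apart n (p * (n - 1) + s) (ys1 @ xs1) (ys2 @ xs2) \<longleftrightarrow>
    apart n (p * (n - 1)) ys1 ys2 \<and> apart n s xs1 xs2"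
proof -
  let ?m = "n - 1"
  have fst_part: "location n i ((!) (ys @ xs)) t = location n i ((!) ys) t"
    if "t \<in> {1..p * ?m}" "length ys = p" for i t xs and ys :: "round_data list"
    using that by (intro location_cong[of t p]) (auto simp: nth_append)
  have snd_part: "location n i ((!) (ys @ xs)) (p * ?m + t) = location n i ((!) xs) t"
    if "t \<ge> 1" "length ys = p" for i t xs and ys :: "round_data list"
  proof -
    have "p * ?m + t - 1 = (t - 1) + p * ?m" using that by simp
    then have d: "(p * ?m + t - 1) div ?m = p + (t - 1) div ?m" "(p * ?m + t - 1) mod ?m = (t - 1) mod ?m"
      using assms(3) by simp_all
    have "(ys @ xs) ! (p + (t - 1) div ?m) = xs ! ((t - 1) div ?m)" using that by (simp add: nth_append)
    then show ?thesis unfolding location_def d by (simp only:)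
  qed
  have split: "{1..p * ?m + s} = {1..p * ?m} \<union> (+) (p * ?m) ` {1..s}"
    by (simp only: image_add_atLeastAtMost) auto
  show ?thesis
    unfolding apart_def split ball_Un ball_simps using fst_part snd_part assms
    by (auto simp del: image_add_atLeastAtMost)
qed

definition apart_prob :: "nat \<Rightarrow> strategy \<Rightarrow> nat \<Rightarrow> nat \<Rightarrow> real" where
  "apart_prob n \<sigma> k s =
     measure_pmf.prob (pair_pmf (history (\<sigma> 1) k) (history (\<sigma> 2) k)) {x. apart n s (fst x) (snd x)}"

text \<open>Blocks and players are independent; exchanging the two middle draws groups the four of
  them by block instead of by player.\<close>

lemma apart_prob_add:
  assumes "periodic p (\<sigma> 1)" "periodic p (\<sigma> 2)" "0 < n - 1"
  shows "apart_prob n \<sigma> (p + k) (p * (n - 1) + s) = apart_prob n \<sigma> p (p * (n - 1)) * apart_prob n \<sigma> k s"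
proof -
  let ?H = "\<lambda>k. pair_pmf (history (\<sigma> 1) k) (history (\<sigma> 2) k)"
  let ?app = "\<lambda>((a, b), (c, d)). (a @ c, b @ d)"
  have "?H (p + k) = bind_pmf (history (\<sigma> 1) p) (\<lambda>a. bind_pmf (history (\<sigma> 1) k) (\<lambda>c.
      bind_pmf (history (\<sigma> 2) p) (\<lambda>b. bind_pmf (history (\<sigma> 2) k) (\<lambda>d. return_pmf (a @ c, b @ d)))))"
    unfolding history_append[OF assms(1)] history_append[OF assms(2)]
    by (simp add: pair_pmf_def bind_assoc_pmf bind_return_pmf map_pmf_def)
  also have "\<dots> = bind_pmf (history (\<sigma> 1) p) (\<lambda>a. bind_pmf (history (\<sigma> 2) p) (\<lambda>b.
      bind_pmf (history (\<sigma> 1) k) (\<lambda>c. bind_pmf (history (\<sigma> 2) k) (\<lambda>d. return_pmf (a @ c, b @ d)))))"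
    by (rule bind_pmf_cong[OF refl], rule bind_commute_pmf)
  also have "\<dots> = map_pmf ?app (pair_pmf (?H p) (?H k))"
    by (simp add: pair_pmf_def bind_assoc_pmf bind_return_pmf map_pmf_def)
  finally have H: "?H (p + k) = map_pmf ?app (pair_pmf (?H p) (?H k))" .
  from H have "apart_prob n \<sigma> (p + k) (p * (n - 1) + s) =
      measure_pmf.prob (pair_pmf (?H p) (?H k)) (?app -` {x. apart n (p * (n - 1) + s) (fst x) (snd x)})"
    unfolding apart_prob_def by simp
  \<comment> \<open>The two events can differ only outside the support, where the first lists need
    not have length \<open>p\<close>.\<close>
  also have "\<dots> = measure_pmf.prob (pair_pmf (?H p) (?H k))
      ({x. apart n (p * (n - 1)) (fst x) (snd x)} \<times> {x. apart n s (fst x) (snd x)})"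
    by (intro measure_prob_cong_0)
       (auto simp: pmf_eq_0_set_pmf apart_append[OF refl _ assms(3)] simp del: One_nat_def dest!: length_history)
  also have "\<dots> = apart_prob n \<sigma> p (p * (n - 1)) * apart_prob n \<sigma> k s"
    unfolding apart_prob_def by (rule measure_pmf_prob_product) auto
  finally show ?thesis .
qed

text \<open>A geometric series in blocks of length \<open>L\<close>. Nonnegativity gives
  \<open>S_N \<le> S_(L+N) = S_L + q S_N\<close>, hence bounded partial sums; once convergence is
  known, the same shift yields the value.\<close>

lemma sums_quasi_periodic:
  fixes f :: "nat \<Rightarrow> real"
  assumes "\<And>s. 0 \<le> f s" "\<And>s. f (L + s) = q * f s" "0 \<le> q" "q < 1"
  shows "f sums (sum f {..<L} / (1 - q))"
proof -
  have "sum f {..<N} \<le> sum f {..<L} / (1 - q)" for N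
  proof -
    have "sum f {..<N} \<le> sum f {..<L + N}"
      using assms(1) by (intro sum_mono2) auto
    also have "sum f {..<L + N} = sum f {..<L} + q * sum f {..<N}"
      by (induction N) (simp_all add: assms(2) distrib_left)
    finally have "sum f {..<N} * (1 - q) \<le> sum f {..<L}" unfolding right_diff_distrib by (simp add: mult.commute)
    then show ?thesis using assms(4) by (simp add: pos_le_divide_eq)
  qed
  then have s: "summable f" using assms(1) by (intro summableI_nonneg_bounded) auto
  have "suminf f = (\<Sum>n. f (n + L)) + sum f {..<L}"
    by (rule suminf_split_initial_segment[OF s])
  also have "(\<Sum>n. f (n + L)) = q * suminf f"
    by (simp only: add.commute[of _ L] assms(2) suminf_mult[OF s])
  finally have "suminf f - q * suminf f = sum f {..<L}" by linarith
  then have "suminf f * (1 - q) = sum f {..<L}" by (simp only: right_diff_distrib mult.commute[of q] mult_1_right)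
  then have "suminf f = sum f {..<L} / (1 - q)" using assms(4) by (simp only: nonzero_eq_divide_eq)
  with s show ?thesis by (simp add: sums_iff)
qed

lemma expected_meeting_time_periodic:
  assumes "causal (\<sigma> 1)" "causal (\<sigma> 2)" "periodic p (\<sigma> 1)" "periodic p (\<sigma> 2)" "0 < n - 1"
    and q: "apart_prob n \<sigma> p (p * (n - 1)) < 1"
  shows "expected_meeting_time n \<sigma> =
    ennreal ((\<Sum>s<p * (n - 1). apart_prob n \<sigma> (s div (n - 1) + 1) s) / (1 - apart_prob n \<sigma> p (p * (n - 1))))"
proof -
  let ?m = "n - 1"
  \<comment> \<open>One round more than those completed at time \<open>s\<close>: enough to cover
    the times up to \<open>s\<close>, and shifting \<open>s\<close> by \<open>p\<close> whole rounds
    adds exactly \<open>p\<close>.\<close>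
  let ?f = "\<lambda>s. apart_prob n \<sigma> (s div ?m + 1) s"
  have k: "s \<le> (s div ?m + 1) * ?m" for s
    using dividend_less_times_div[OF assms(5), of s]
    by (simp only: distrib_right mult_1 mult.commute[of "s div ?m"])
  have "expected_meeting_time n \<sigma> = (\<Sum>s. emeasure (pair_pmf (history (\<sigma> 1) (s div ?m + 1))
      (history (\<sigma> 2) (s div ?m + 1))) {x. apart n s (fst x) (snd x)})"
    by (rule expected_meeting_time_eq[OF assms(1,2) k])
  also have "\<dots> = (\<Sum>s. ennreal (?f s))"
    unfolding apart_prob_def measure_pmf.emeasure_eq_measure ..
  also have "\<dots> = ennreal (sum ?f {..<p * ?m} / (1 - apart_prob n \<sigma> p (p * ?m)))"
  proof -
    have "?f (p * ?m + s) = apart_prob n \<sigma> p (p * ?m) * ?f s" for s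
    proof -
      have "(p * ?m + s) div ?m + 1 = p + (s div ?m + 1)" using assms(5) by (simp only: div_mult_self3)
      then show ?thesis using apart_prob_add[OF assms(3,4,5), of "s div ?m + 1" s] by (simp only:)
    qed
    then have "?f sums (sum ?f {..<p * ?m} / (1 - apart_prob n \<sigma> p (p * ?m)))"
      by (rule sums_quasi_periodic[rotated]) (fact q | simp add: apart_prob_def)+
    then show ?thesis
      by (rule suminf_ennreal_eq[rotated]) (simp add: apart_prob_def)
  qed
  finally show ?thesis .
qed

section \<open>Signed perturbations of the third round\<close>

lemma sum_swap_pairs:
  "(\<Sum>a\<in>A. \<Sum>b\<in>B. \<Sum>c\<in>C. \<Sum>d\<in>D. f a b c d) = (\<Sum>c\<in>C. \<Sum>d\<in>D. \<Sum>a\<in>A. \<Sum>b\<in>B. f a b c d)"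
proof -
  have "(\<Sum>a\<in>A. \<Sum>b\<in>B. \<Sum>c\<in>C. \<Sum>d\<in>D. f a b c d) = (\<Sum>a\<in>A. \<Sum>c\<in>C. \<Sum>b\<in>B. \<Sum>d\<in>D. f a b c d)"
    by (intro sum.cong refl sum.swap)
  also have "\<dots> = (\<Sum>c\<in>C. \<Sum>a\<in>A. \<Sum>b\<in>B. \<Sum>d\<in>D. f a b c d)" by (rule sum.swap)
  also have "\<dots> = (\<Sum>c\<in>C. \<Sum>a\<in>A. \<Sum>d\<in>D. \<Sum>b\<in>B. f a b c d)" by (intro sum.cong refl sum.swap)
  also have "\<dots> = (\<Sum>c\<in>C. \<Sum>d\<in>D. \<Sum>a\<in>A. \<Sum>b\<in>B. f a b c d)" by (intro sum.cong refl sum.swap)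
  finally show ?thesis .
qed

text \<open>An expectation over three rounds of both players: \<open>w\<close> and \<open>w'\<close>
  weigh each of the first two rounds, \<open>u\<close> and \<open>u'\<close> the third given those
  two, \<open>N\<close> and \<open>N'\<close> will be indicators of not meeting. The weights may be
  signed, so that the third round can be perturbed linearly.\<close>

definition three_rounds :: "'a set \<Rightarrow> 'b set \<Rightarrow> ('a \<Rightarrow> real) \<Rightarrow> ('b \<Rightarrow> real) \<Rightarrow> ('a \<Rightarrow> 'b \<Rightarrow> real) \<Rightarrow>
    ('a \<Rightarrow> 'b \<Rightarrow> real) \<Rightarrow> ('a \<Rightarrow> 'a \<Rightarrow> 'a \<Rightarrow> real) \<Rightarrow> ('b \<Rightarrow> 'b \<Rightarrow> 'b \<Rightarrow> real) \<Rightarrow> real" where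
  "three_rounds X Y w w' N N' u u' =
    (\<Sum>x\<in>X. \<Sum>x'\<in>Y. w x * w' x' * N x x' * (\<Sum>y\<in>X. \<Sum>y'\<in>Y. w y * w' y' * N y y' *
      (\<Sum>z\<in>X. \<Sum>z'\<in>Y. u x y z * u' x' y' z' * N' z z')))"

lemma three_rounds_add:
  "three_rounds X Y w w' N N' (\<lambda>x y z. u x y z + d x y z) u' =
     three_rounds X Y w w' N N' u u' + three_rounds X Y w w' N N' d u'"
  "three_rounds X Y w w' N N' u (\<lambda>x y z. u' x y z + d' x y z) =
     three_rounds X Y w w' N N' u u' + three_rounds X Y w w' N N' u d'"
  unfolding three_rounds_def by (simp_all add: distrib_left distrib_right sum.distrib)

lemma three_rounds_swap:
  "three_rounds X Y w w' N N' u u' = three_rounds Y X w' w (\<lambda>a b. N b a) (\<lambda>a b. N' b a) u' u"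
  unfolding three_rounds_def
  by (subst (1 2 3) sum.swap) (simp add: mult_ac)

text \<open>For FSD, the type \<open>ty x\<close> of a round is its decision together with its first location, and \<open>A\<close> are the
  types that move: a moving player is missed with the same probability whatever the first location.\<close>

lemma three_rounds_eq_0:
  assumes d: "\<And>x y z. x \<in> X \<Longrightarrow> y \<in> X \<Longrightarrow> z \<in> X \<Longrightarrow> d x y z = d' (ty x) (ty y) z"
    and supp: "\<And>s t z. s \<notin> A \<or> t \<notin> A \<Longrightarrow> d' s t z = 0"
    and avg: "\<And>\<phi>. (\<And>t. t \<notin> A \<Longrightarrow> \<phi> t = 0) \<Longrightarrow>
      (\<Sum>x\<in>X. w x * ((\<Sum>x'\<in>Y. w' x' * N x x') * \<phi> (ty x))) = g * (\<Sum>x\<in>X. w x * \<phi> (ty x))"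
    and zero: "\<And>z. z \<in> X \<Longrightarrow> (\<Sum>x\<in>X. \<Sum>y\<in>X. w x * w y * d x y z) = 0"
  shows "three_rounds X Y w w' N N' d (\<lambda>_ _. u') = 0"
proof -
  define h where "h z = (\<Sum>z'\<in>Y. u' z' * N' z z')" for z
  define e where "e s t = (\<Sum>z\<in>X. d' s t z * h z)" for s t
  define G where "G x = (\<Sum>x'\<in>Y. w' x' * N x x')" for x
  have G: "(\<Sum>x'\<in>Y. w x * w' x' * N x x' * K) = w x * (G x * K)" for x K
    by (simp add: G_def sum_distrib_left sum_distrib_right mult_ac)
  have E: "(\<Sum>z\<in>X. \<Sum>z'\<in>Y. d x y z * u' z' * N' z z') = e (ty x) (ty y)" if "x \<in> X" "y \<in> X" for x y
    using that d by (simp add: e_def h_def sum_distrib_left mult.assoc)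
  have e0: "e s t = 0" if "s \<notin> A \<or> t \<notin> A" for s t
    using supp that unfolding e_def by simp
  have avg': "(\<Sum>x\<in>X. w x * (G x * \<phi> (ty x))) = g * (\<Sum>x\<in>X. w x * \<phi> (ty x))"
    if "\<And>t. t \<notin> A \<Longrightarrow> \<phi> t = 0" for \<phi>
    unfolding G_def using avg that by blast
  have "three_rounds X Y w w' N N' d (\<lambda>_ _. u') =
      (\<Sum>x\<in>X. \<Sum>x'\<in>Y. w x * w' x' * N x x' * (\<Sum>y\<in>X. \<Sum>y'\<in>Y. w y * w' y' * N y y' * e (ty x) (ty y)))"
    unfolding three_rounds_def
    by (intro sum.cong refl arg_cong2[of _ _ _ _ "(*)"] E)
  also have "\<dots> = (\<Sum>x\<in>X. w x * (G x * (\<Sum>y\<in>X. w y * (G y * e (ty x) (ty y)))))"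
    unfolding G ..
  \<comment> \<open>Hypothesis \<open>avg\<close> for the second round, at a fixed type of
    \<open>x\<close>; the next step applies it to the first round. Each use contributes a factor
    \<open>g\<close>.\<close>
  also have "\<dots> = (\<Sum>x\<in>X. w x * (G x * (g * (\<Sum>y\<in>X. w y * e (ty x) (ty y)))))"
    using e0 by (intro sum.cong refl arg_cong2[of _ _ _ _ "(*)"] avg') auto
  also have "\<dots> = g * (\<Sum>x\<in>X. w x * (g * (\<Sum>y\<in>X. w y * e (ty x) (ty y))))"
    using e0 by (intro avg'[of "\<lambda>s. g * (\<Sum>y\<in>X. w y * e s (ty y))"]) auto
  also have "\<dots> = (\<Sum>x\<in>X. \<Sum>y\<in>X. g\<^sup>2 * (w x * (w y * e (ty x) (ty y))))"
    by (simp add: sum_distrib_left power2_eq_square mult_ac)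
  also have "\<dots> = (\<Sum>x\<in>X. \<Sum>y\<in>X. \<Sum>z\<in>X. g\<^sup>2 * h z * (w x * w y * d x y z))"
    using d by (intro sum.cong refl) (simp add: e_def sum_distrib_left mult_ac)
  also have "\<dots> = (\<Sum>z\<in>X. \<Sum>x\<in>X. \<Sum>y\<in>X. g\<^sup>2 * h z * (w x * w y * d x y z))"
    by (rule trans[OF sum.cong[OF refl sum.swap] sum.swap])
  also have "\<dots> = (\<Sum>z\<in>X. g\<^sup>2 * h z * (\<Sum>x\<in>X. \<Sum>y\<in>X. w x * w y * d x y z))"
    by (simp add: sum_distrib_left)
  also have "\<dots> = 0" using zero by simp
  finally show ?thesis .
qed

text \<open>
  If the first locations of two rounds were \<open>a\<close> and \<open>b\<close>, then FSD visits \<open>f\<close> first in the third round with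
  probability \<open>1 / m + pert m f a b\<close>.
\<close>

definition pert :: "real \<Rightarrow> nat \<Rightarrow> nat \<Rightarrow> nat \<Rightarrow> real" where
  "pert m f a b = (m * of_bool (a = b) * (of_bool (f = a) - 1 / m)
      - (of_bool (f = a) - 1 / m) - (of_bool (f = b) - 1 / m)) / (m - 2)"

lemma pert_commute: "pert m f a b = pert m f b a"
  unfolding pert_def by (cases "a = b") auto

text \<open>Pairwise independence of the three first locations: when one earlier location is
  averaged out, the bonus at \<open>a = b\<close> balances the penalties.\<close>

lemma sum_pert:
  assumes "finite I" "card I = k" "k > 0" "f \<in> I" "b \<in> I"
  shows "(\<Sum>a\<in>I. pert (real k) f a b) = 0"
proof -
  have d: "(\<Sum>a\<in>I. of_bool (f = a) - 1 / real k) = 0"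
    using assms by (simp add: sum_subtractf of_bool_def)
  have "(\<Sum>a\<in>I. real k * of_bool (a = b) * (of_bool (f = a) - 1 / real k)) = real k * (of_bool (f = b) - 1 / real k)"
    using assms by (simp add: of_bool_def if_distrib[of "\<lambda>x. x * _"] if_distrib[of "\<lambda>x. _ * x"] cong: if_cong)
  then show ?thesis
    unfolding pert_def sum_divide_distrib[symmetric] sum_subtractf d using assms
    by (simp add: right_diff_distrib)
qed

section \<open>Sums against doubly centred tables\<close>

lemma bilinear_deviation:
  fixes V :: "'a \<Rightarrow> 'b \<Rightarrow> real"
  assumes "finite I" "finite J" "(\<Sum>a\<in>I. p a) = 0" "(\<Sum>b\<in>J. q b) = 0"
  shows "(\<Sum>a\<in>I. \<Sum>b\<in>J. V a b * (p a * q b)) = (\<Sum>a\<in>I. \<Sum>b\<in>J. (V a b - d) * (p a * q b))"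
proof -
  have "(\<Sum>a\<in>I. \<Sum>b\<in>J. d * (p a * q b)) = d * (\<Sum>a\<in>I. p a) * (\<Sum>b\<in>J. q b)"
    by (simp add: sum_distrib_left sum_distrib_right mult_ac)
  then show ?thesis using assms by (simp add: left_diff_distrib sum_subtractf)
qed

lemma bilinear_shift:
  fixes U :: "'a \<Rightarrow> 'b \<Rightarrow> real"
  assumes "\<And>a. a \<in> I \<Longrightarrow> (\<Sum>b\<in>J. U a b) = 0" "\<And>b. b \<in> J \<Longrightarrow> (\<Sum>a\<in>I. U a b) = 0"
  shows "(\<Sum>a\<in>I. \<Sum>b\<in>J. U a b * ((p a + r) * (q b + s))) = (\<Sum>a\<in>I. \<Sum>b\<in>J. U a b * (p a * q b))"
proof -
  have 1: "(\<Sum>a\<in>I. \<Sum>b\<in>J. U a b * (p a * s)) = 0"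
  proof -
    have "(\<Sum>a\<in>I. \<Sum>b\<in>J. U a b * (p a * s)) = (\<Sum>a\<in>I. (\<Sum>b\<in>J. U a b) * (p a * s))"
      by (simp add: sum_distrib_right)
    then show ?thesis using assms(1) by simp
  qed
  have 2: "(\<Sum>a\<in>I. \<Sum>b\<in>J. U a b * (r * t b)) = 0" for t
  proof -
    have "(\<Sum>a\<in>I. \<Sum>b\<in>J. U a b * (r * t b)) = (\<Sum>b\<in>J. (\<Sum>a\<in>I. U a b) * (r * t b))"
      by (subst sum.swap) (simp add: sum_distrib_right)
    then show ?thesis using assms(2) by simp
  qed
  have "U a b * ((p a + r) * (q b + s)) = U a b * (p a * q b) + U a b * (p a * s) + U a b * (r * (q b + s))" for a b
    by (simp add: algebra_simps)
  then show ?thesis by (simp add: sum.distrib 1 2)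
qed

lemma bilinear_delta:
  fixes U :: "nat \<Rightarrow> nat \<Rightarrow> real"
  assumes "finite I" "finite J" "a1 \<in> I" "f1 \<in> I" "a2 \<in> J" "f2 \<in> J"
  shows "(\<Sum>b1\<in>I. \<Sum>b2\<in>J. U b1 b2 * ((of_bool (b1 = a1) * p - of_bool (b1 = f1)) * (of_bool (b2 = a2) * q - of_bool (b2 = f2))))
    = U a1 a2 * (p * q) - U a1 f2 * p - U f1 a2 * q + U f1 f2"
proof -
  have one: "(\<Sum>b\<in>J. g b * (of_bool (b = a2) * q - of_bool (b = f2))) = g a2 * q - g f2" for g :: "nat \<Rightarrow> real"
    using assms by (simp add: right_diff_distrib sum_subtractf of_bool_def if_distrib[of "\<lambda>x. x * _"] if_distrib[of "\<lambda>x. _ * x"] cong: if_cong)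
  have two: "(\<Sum>b\<in>I. (of_bool (b = a1) * p - of_bool (b = f1)) * g b) = p * g a1 - g f1" for g :: "nat \<Rightarrow> real"
    using assms by (simp add: left_diff_distrib sum_subtractf of_bool_def if_distrib[of "\<lambda>x. x * _"] if_distrib[of "\<lambda>x. _ * x"] cong: if_cong)
  have "(\<Sum>b1\<in>I. \<Sum>b2\<in>J. U b1 b2 * ((of_bool (b1 = a1) * p - of_bool (b1 = f1)) * (of_bool (b2 = a2) * q - of_bool (b2 = f2)))) =
    (\<Sum>b1\<in>I. (of_bool (b1 = a1) * p - of_bool (b1 = f1)) * (\<Sum>b2\<in>J. U b1 b2 * (of_bool (b2 = a2) * q - of_bool (b2 = f2))))"
    by (simp only: sum_distrib_left mult_ac)
  then show ?thesis unfolding one two by (simp add: algebra_simps)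
qed

text \<open>With \<open>V = d + U\<close> and \<open>U\<close> doubly centred, the sum over
  \<open>b1\<close>, \<open>b2\<close> picks out the entries of \<open>U\<close> at
  \<open>(a1, a2)\<close>, \<open>(a1, f2)\<close>, \<open>(f1, a2)\<close> and
  \<open>(f1, f2)\<close>. Multiplied by \<open>U a1 a2\<close> and summed, the last three contain a
  full row or column sum of \<open>U\<close> and vanish; only the square remains.\<close>

lemma pert_correlation:
  fixes V :: "nat \<Rightarrow> nat \<Rightarrow> real"
  assumes I: "finite I" "card I = k" and J: "finite J" "card J = k" and k: "k > 2"
    and rows: "\<And>a. a \<in> I \<Longrightarrow> (\<Sum>b\<in>J. V a b) = k * d"
    and cols: "\<And>b. b \<in> J \<Longrightarrow> (\<Sum>a\<in>I. V a b) = k * d"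
    and f: "f1 \<in> I" "f2 \<in> J"
  shows "(\<Sum>a1\<in>I. \<Sum>a2\<in>J. V a1 a2 * (\<Sum>b1\<in>I. \<Sum>b2\<in>J. V b1 b2 * (pert k f1 a1 b1 * pert k f2 a2 b2)))
    = (real k / (real k - 2))\<^sup>2 * (\<Sum>a1\<in>I. \<Sum>a2\<in>J. (V a1 a2 - d)\<^sup>2 *
         ((of_bool (f1 = a1) - 1 / k) * (of_bool (f2 = a2) - 1 / k)))"
proof -
  define U where "U a b = V a b - d" for a b
  define e where "e f a = of_bool (f = a) - 1 / real k" for f a :: nat
  let ?m = "real k" and ?c = "1 / (real k - 2)\<^sup>2"
  have U: "(\<Sum>b\<in>J. U a b) = 0" if "a \<in> I" for a using rows[OF that] J by (simp add: U_def sum_subtractf)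
  have U': "(\<Sum>a\<in>I. U a b) = 0" if "b \<in> J" for b using cols[OF that] I by (simp add: U_def sum_subtractf)
  have z1: "(\<Sum>b\<in>I. pert k f1 a b) = 0" if "a \<in> I" for a
    using I k f that by (subst pert_commute, intro sum_pert) auto
  have z2: "(\<Sum>b\<in>J. pert k f2 a b) = 0" if "a \<in> J" for a
    using J k f that by (subst pert_commute, intro sum_pert) auto
  \<comment> \<open>As a function of \<open>b\<close>: a point mass at \<open>a\<close>, one at
    \<open>f\<close>, and a constant that \<open>U\<close> annihilates.\<close>
  have pert_eq: "pert k f a b =
      ((of_bool (b = a) * (?m * e f a) - of_bool (b = f)) + (1 / ?m - e f a)) / (?m - 2)" for f a b
    unfolding pert_def e_def by (cases "a = b"; cases "f = a"; cases "f = b") simp_all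
  have S: "(\<Sum>b1\<in>I. \<Sum>b2\<in>J. V b1 b2 * (pert k f1 a1 b1 * pert k f2 a2 b2)) =
     ?c * (U a1 a2 * (?m * e f1 a1 * (?m * e f2 a2)) - U a1 f2 * (?m * e f1 a1) - U f1 a2 * (?m * e f2 a2) + U f1 f2)"
    if a: "a1 \<in> I" "a2 \<in> J" for a1 a2
  proof -
    have "(\<Sum>b1\<in>I. \<Sum>b2\<in>J. V b1 b2 * (pert k f1 a1 b1 * pert k f2 a2 b2)) =
        (\<Sum>b1\<in>I. \<Sum>b2\<in>J. U b1 b2 * (pert k f1 a1 b1 * pert k f2 a2 b2))"
      unfolding U_def using I J z1 z2 a by (intro bilinear_deviation) auto
    also have "\<dots> = (\<Sum>b1\<in>I. \<Sum>b2\<in>J. ?c * (U b1 b2 *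
        (((of_bool (b1 = a1) * (?m * e f1 a1) - of_bool (b1 = f1)) + (1 / ?m - e f1 a1)) *
         ((of_bool (b2 = a2) * (?m * e f2 a2) - of_bool (b2 = f2)) + (1 / ?m - e f2 a2)))))"
      unfolding pert_eq by (intro sum.cong refl) (simp add: power2_eq_square)
    also have "\<dots> = ?c * (\<Sum>b1\<in>I. \<Sum>b2\<in>J. U b1 b2 *
        ((of_bool (b1 = a1) * (?m * e f1 a1) - of_bool (b1 = f1)) *
         (of_bool (b2 = a2) * (?m * e f2 a2) - of_bool (b2 = f2))))"
      unfolding sum_distrib_left[symmetric] by (subst bilinear_shift[OF U U']) auto
    also have "\<dots> = ?c * (U a1 a2 * (?m * e f1 a1 * (?m * e f2 a2)) - U a1 f2 * (?m * e f1 a1) - U f1 a2 * (?m * e f2 a2) + U f1 f2)"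
      using I J a f by (subst bilinear_delta) auto
    finally show ?thesis .
  qed
  let ?S = "\<lambda>a1 a2. \<Sum>b1\<in>I. \<Sum>b2\<in>J. V b1 b2 * (pert k f1 a1 b1 * pert k f2 a2 b2)"
  \<comment> \<open>As the total of \<open>?S\<close> vanishes, the outer \<open>V\<close> may be
    replaced by \<open>U\<close> as well.\<close>
  have S0: "(\<Sum>a1\<in>I. \<Sum>a2\<in>J. ?S a1 a2) = 0"
  proof -
    have 0: "(\<Sum>a1\<in>I. \<Sum>a2\<in>J. V b1 b2 * (pert k f1 a1 b1 * pert k f2 a2 b2)) = 0" if "b1 \<in> I" for b1 b2
      using sum_pert[of I k f1 b1] I k f that
      by (simp add: sum_distrib_left[symmetric] sum_distrib_right[symmetric])
    have "(\<Sum>a1\<in>I. \<Sum>a2\<in>J. ?S a1 a2) =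
        (\<Sum>b1\<in>I. \<Sum>b2\<in>J. \<Sum>a1\<in>I. \<Sum>a2\<in>J. V b1 b2 * (pert k f1 a1 b1 * pert k f2 a2 b2))"
      by (rule sum_swap_pairs)
    then show ?thesis using 0 by simp
  qed
  have "(\<Sum>a1\<in>I. \<Sum>a2\<in>J. V a1 a2 * ?S a1 a2) = (\<Sum>a1\<in>I. \<Sum>a2\<in>J. U a1 a2 * ?S a1 a2 + d * ?S a1 a2)"
    by (intro sum.cong refl) (simp only: U_def left_diff_distrib)
  also have "\<dots> = (\<Sum>a1\<in>I. \<Sum>a2\<in>J. U a1 a2 * ?S a1 a2)"
    using S0 by (simp only: sum.distrib sum_distrib_left[symmetric])
  also have "\<dots> = (\<Sum>a1\<in>I. \<Sum>a2\<in>J. ?c * (?m\<^sup>2 * ((U a1 a2)\<^sup>2 * (e f1 a1 * e f2 a2))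
      - U a1 a2 * (?m * e f1 a1 * U a1 f2) - U a1 a2 * (?m * e f2 a2 * U f1 a2) + U a1 a2 * U f1 f2))"
    by (intro sum.cong refl) (simp add: S algebra_simps power2_eq_square)
  also have "\<dots> = ?c * (?m\<^sup>2 * (\<Sum>a1\<in>I. \<Sum>a2\<in>J. (U a1 a2)\<^sup>2 * (e f1 a1 * e f2 a2))
     - (\<Sum>a1\<in>I. \<Sum>a2\<in>J. U a1 a2 * (?m * e f1 a1 * U a1 f2))
     - (\<Sum>a1\<in>I. \<Sum>a2\<in>J. U a1 a2 * (?m * e f2 a2 * U f1 a2))
     + (\<Sum>a1\<in>I. \<Sum>a2\<in>J. U a1 a2 * U f1 f2))"
    by (simp only: sum_distrib_left[symmetric] sum.distrib sum_subtractf)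
  also have "(\<Sum>a1\<in>I. \<Sum>a2\<in>J. U a1 a2 * (?m * e f1 a1 * U a1 f2)) = 0"
    using U by (simp only: sum_distrib_right[symmetric]) simp
  also have "(\<Sum>a1\<in>I. \<Sum>a2\<in>J. U a1 a2 * U f1 f2) = 0"
    using U by (simp only: sum_distrib_right[symmetric]) simp
  also have "(\<Sum>a1\<in>I. \<Sum>a2\<in>J. U a1 a2 * (?m * e f2 a2 * U f1 a2)) = 0"
    using U' by (subst sum.swap) (simp only: sum_distrib_right[symmetric], simp)
  finally show ?thesis
    by (simp add: U_def e_def power_divide)
qed

text \<open>The entries of a table indexed by two sets that share \<open>B\<close> and have one private element each
  are constant on the classes private/private, private/shared, equal and distinct.\<close>

definition patterned :: "'a \<Rightarrow> 'a \<Rightarrow> 'a set \<Rightarrow> ('a \<Rightarrow> 'a \<Rightarrow> real) \<Rightarrow> real \<Rightarrow> real \<Rightarrow> real \<Rightarrow> real \<Rightarrow> bool" where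
  "patterned u v B X \<alpha> \<beta> \<delta> \<gamma> \<longleftrightarrow> finite B \<and> u \<notin> B \<and> v \<notin> B \<and> X u v = \<alpha> \<and>
    (\<forall>b\<in>B. X u b = \<beta> \<and> X b v = \<beta> \<and> X b b = \<delta> \<and> (\<forall>c\<in>B. b \<noteq> c \<longrightarrow> X b c = \<gamma>))"

lemma patterned_row:
  assumes "patterned u v B X \<alpha> \<beta> \<delta> \<gamma>"
  shows "(\<Sum>c\<in>insert v B. X u c) = \<alpha> + real (card B) * \<beta>"
    and "b \<in> B \<Longrightarrow> (\<Sum>c\<in>insert v B. X b c) = \<beta> + \<delta> + (real (card B) - 1) * \<gamma>"
proof -
  show "(\<Sum>c\<in>insert v B. X u c) = \<alpha> + real (card B) * \<beta>"
    using assms unfolding patterned_def by simp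
  assume b: "b \<in> B"
  have "(\<Sum>c\<in>B. X b c) = X b b + (\<Sum>c\<in>B - {b}. X b c)"
    using assms b unfolding patterned_def by (intro sum.remove) auto
  also have "(\<Sum>c\<in>B - {b}. X b c) = (\<Sum>c\<in>B - {b}. \<gamma>)"
    using assms b unfolding patterned_def by (intro sum.cong) auto
  also have "\<dots> = (real (card B) - 1) * \<gamma>"
    using assms b card_gt_0_iff[of B] unfolding patterned_def by (auto simp: card_Diff_singleton of_nat_diff)
  finally show "(\<Sum>c\<in>insert v B. X b c) = \<beta> + \<delta> + (real (card B) - 1) * \<gamma>"
    using assms b unfolding patterned_def by auto
qed

lemma patterned_transpose:
  "patterned u v B X \<alpha> \<beta> \<delta> \<gamma> \<Longrightarrow> patterned v u B (\<lambda>a b. X b a) \<alpha> \<beta> \<delta> \<gamma>"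
  unfolding patterned_def by (auto simp: eq_commute)

lemma patterned_mult:
  "patterned u v B X \<alpha> \<beta> \<delta> \<gamma> \<Longrightarrow> patterned u v B Y \<alpha>' \<beta>' \<delta>' \<gamma>' \<Longrightarrow>
     patterned u v B (\<lambda>a b. X a b * Y a b) (\<alpha> * \<alpha>') (\<beta> * \<beta>') (\<delta> * \<delta>') (\<gamma> * \<gamma>')"
  unfolding patterned_def by auto

lemma patterned_total:
  assumes "patterned u v B X \<alpha> \<beta> \<delta> \<gamma>" "real (card B) = M"
  shows "(\<Sum>a\<in>insert u B. \<Sum>b\<in>insert v B. X a b) = \<alpha> + 2 * M * \<beta> + M * \<delta> + M * (M - 1) * \<gamma>"
proof -
  have "(\<Sum>a\<in>insert u B. \<Sum>b\<in>insert v B. X a b) =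
      (\<Sum>b\<in>insert v B. X u b) + (\<Sum>a\<in>B. \<Sum>b\<in>insert v B. X a b)"
    using assms unfolding patterned_def by (intro sum.insert) auto
  also have "\<dots> = \<alpha> + M * \<beta> + M * (\<beta> + \<delta> + (M - 1) * \<gamma>)"
    using patterned_row[OF assms(1)] assms(2) by simp
  finally show ?thesis by (simp add: algebra_simps)
qed

text \<open>The covariance of two such tables under the uniform distribution, written in the orthogonal basis of
  the two-dimensional space of doubly centred tables with this pattern.\<close>

lemma patterned_correlation:
  assumes S: "patterned u v B S s\<^sub>0 s\<^sub>1 s\<^sub>2 s\<^sub>3" and X: "patterned u v B X \<alpha> \<beta> \<delta> \<gamma>"
    and M: "real (card B) = m - 1" and m: "m \<noteq> 0"
  shows "(\<Sum>a\<in>insert u B. \<Sum>b\<in>insert v B. S a b * (\<Sum>f\<in>insert u B. \<Sum>g\<in>insert v B. X f g *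
      ((of_bool (f = a) - 1 / m) * (of_bool (g = b) - 1 / m)))) =
    ((m - 1) * (s\<^sub>0 - 2 * s\<^sub>1) + s\<^sub>2 + (m - 2) * s\<^sub>3) * ((m - 1) * (\<alpha> - 2 * \<beta>) + \<delta> + (m - 2) * \<gamma>) / m\<^sup>2
     + (m - 2) * (s\<^sub>2 - s\<^sub>3) * (\<delta> - \<gamma>)"
proof -
  define I J where "I = insert u B" and "J = insert v B"
  have fin: "finite I" "finite J" using S unfolding patterned_def I_def J_def by auto
  define r where "r a = (\<Sum>g\<in>J. X a g)" for a
  define c where "c b = (\<Sum>f\<in>I. X f b)" for b
  define t where "t = (\<Sum>f\<in>I. \<Sum>g\<in>J. X f g)"
  \<comment> \<open>The double centring of \<open>X\<close>: summation against
    \<open>of_bool (f = a) - 1 / m\<close> evaluates at \<open>a\<close> and subtracts a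
    mean.\<close>
  define Y where "Y a b = X a b - r a / m - c b / m + t / m\<^sup>2" for a b
  have Y: "(\<Sum>f\<in>I. \<Sum>g\<in>J. X f g * ((of_bool (f = a) - 1 / m) * (of_bool (g = b) - 1 / m))) = Y a b"
    if "a \<in> I" "b \<in> J" for a b
  proof -
    have "(\<Sum>g\<in>J. X f g * ((of_bool (f = a) - 1 / m) * (of_bool (g = b) - 1 / m))) =
        (of_bool (f = a) - 1 / m) * (\<Sum>g\<in>J. X f g * (of_bool (g = b) - 1 / m))" for f
      by (simp only: sum_distrib_left mult_ac)
    also have "(\<Sum>g\<in>J. X f g * (of_bool (g = b) - 1 / m)) = X f b - r f / m" for f
      using fin that unfolding r_def
      by (simp add: right_diff_distrib sum_subtractf sum_divide_distrib of_bool_def if_distrib[of "\<lambda>x. _ * x"] cong: if_cong)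
    finally have 1: "(\<Sum>g\<in>J. X f g * ((of_bool (f = a) - 1 / m) * (of_bool (g = b) - 1 / m))) =
        (of_bool (f = a) - 1 / m) * (X f b - r f / m)" for f .
    have "(\<Sum>f\<in>I. (of_bool (f = a) - 1 / m) * (X f b - r f / m)) = (X a b - r a / m) - (\<Sum>f\<in>I. X f b - r f / m) / m"
      using fin that
      by (simp add: left_diff_distrib sum_subtractf sum_divide_distrib diff_divide_distrib of_bool_def if_distrib[of "\<lambda>x. x * _"] cong: if_cong)
    also have "(\<Sum>f\<in>I. X f b - r f / m) = c b - t / m"
      by (simp add: sum_subtractf c_def t_def r_def sum_divide_distrib)
    finally show ?thesis unfolding 1 Y_def using m by (simp add: diff_divide_distrib power2_eq_square)
  qed
  have rows: "r u = \<alpha> + (m - 1) * \<beta>" "b \<in> B \<Longrightarrow> r b = \<beta> + \<delta> + (m - 2) * \<gamma>"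
    and cols: "c v = \<alpha> + (m - 1) * \<beta>" "b \<in> B \<Longrightarrow> c b = \<beta> + \<delta> + (m - 2) * \<gamma>" for b
    using patterned_row[OF X] patterned_row[OF patterned_transpose[OF X]] M
    unfolding r_def c_def I_def J_def by auto
  have t: "t = \<alpha> + 2 * (m - 1) * \<beta> + (m - 1) * \<delta> + (m - 1) * (m - 2) * \<gamma>"
    using patterned_total[OF X M] unfolding t_def I_def J_def by (simp add: algebra_simps)
  define R R' where "R = \<alpha> + (m - 1) * \<beta>" and "R' = \<beta> + \<delta> + (m - 2) * \<gamma>"
  have "patterned u v B Y (\<alpha> - R / m - R / m + t / m\<^sup>2) (\<beta> - R / m - R' / m + t / m\<^sup>2)
      (\<delta> - R' / m - R' / m + t / m\<^sup>2) (\<gamma> - R' / m - R' / m + t / m\<^sup>2)"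
    using X rows cols unfolding patterned_def Y_def R_def R'_def by auto
  from patterned_total[OF patterned_mult[OF S this] M]
  have "(\<Sum>a\<in>I. \<Sum>b\<in>J. S a b * Y a b) = s\<^sub>0 * (\<alpha> - R / m - R / m + t / m\<^sup>2) +
     2 * (m - 1) * (s\<^sub>1 * (\<beta> - R / m - R' / m + t / m\<^sup>2)) + (m - 1) * (s\<^sub>2 * (\<delta> - R' / m - R' / m + t / m\<^sup>2)) +
     (m - 1) * (m - 1 - 1) * (s\<^sub>3 * (\<gamma> - R' / m - R' / m + t / m\<^sup>2))"
    unfolding I_def J_def .
  \<comment> \<open>The first basis table is the outer product of two vectors that are
    \<open>m - 1\<close> at the private element and \<open>-1\<close> on \<open>B\<close>, of
    squared length \<open>(m (m - 1))^2\<close>. The second lives on pairs from \<open>B\<close> and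
    is the identity minus its mean \<open>1 / (m - 1)\<close>, of squared length
    \<open>m - 2\<close>. Each summand is a product of coordinates divided by the squared
    length.\<close>
  also have "\<dots> = ((m - 1) * (s\<^sub>0 - 2 * s\<^sub>1) + s\<^sub>2 + (m - 2) * s\<^sub>3) * ((m - 1) * (\<alpha> - 2 * \<beta>) + \<delta> + (m - 2) * \<gamma>) / m\<^sup>2
     + (m - 2) * (s\<^sub>2 - s\<^sub>3) * (\<delta> - \<gamma>)"
    unfolding R_def R'_def t using m by (simp add: divide_simps) (simp add: algebra_simps power2_eq_square)
  finally have "(\<Sum>a\<in>I. \<Sum>b\<in>J. S a b * Y a b) = \<dots>" .
  moreover have "(\<Sum>a\<in>I. \<Sum>b\<in>J. S a b * Y a b) = (\<Sum>a\<in>I. \<Sum>b\<in>J. S a b * (\<Sum>f\<in>I. \<Sum>g\<in>J. X f g *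
      ((of_bool (f = a) - 1 / m) * (of_bool (g = b) - 1 / m))))"
    by (intro sum.cong refl) (simp only: Y)
  ultimately show ?thesis unfolding I_def J_def by simp
qed

section \<open>Three rounds of FSD\<close>

lemma sum_permutations_of_set_head:
  assumes "finite A" "A \<noteq> {}" "card A = k"
  shows "(\<Sum>\<pi>\<in>permutations_of_set A. g (\<pi> ! 0)) = fact (k - 1) * (\<Sum>x\<in>A. g x :: real)"
  using assms unfolding sum_permutations_of_set[OF assms(1,2)]
  by (simp add: sum_distrib_left card_Diff_singleton)

lemma card_permutations_of_set_head:
  assumes "finite A" "F \<subseteq> A" "A \<noteq> {}" "card A = k"
  shows "real (card {\<pi> \<in> permutations_of_set A. \<pi> ! 0 \<in> F}) = fact (k - 1) * real (card F)"
proof -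
  have "real (card {\<pi> \<in> permutations_of_set A. \<pi> ! 0 \<in> F}) =
      (\<Sum>\<pi>\<in>permutations_of_set A. of_bool (\<pi> ! 0 \<in> F))"
    by (simp add: sum.If_cases Int_def of_bool_def)
  also have "\<dots> = fact (k - 1) * (\<Sum>x\<in>A. of_bool (x \<in> F))"
    by (rule sum_permutations_of_set_head[OF assms(1,3,4)])
  also have "(\<Sum>x\<in>A. of_bool (x \<in> F)) = real (card F)"
    using assms by (simp add: sum.If_cases of_bool_def Int_absorb1)
  finally show ?thesis .
qed

definition rounds :: "nat \<Rightarrow> nat \<Rightarrow> round_data set" where
  "rounds n i = UNIV \<times> perms n i"

lemma UNIV_decision: "(UNIV :: decision set) = {Stay, Move}"
  using decision.exhaust by auto

lemma finite_rounds: "finite (rounds n i)"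
  by (simp add: rounds_def UNIV_decision perms_def)

lemma perms_ne: "perms n i \<noteq> {}" by (simp add: perms_def)

lemma finite_perms: "finite (perms n i)" by (simp add: perms_def)

lemma expectation_bind_bind:
  fixes h :: "'c \<Rightarrow> real"
  assumes "finite X" "finite Y" "set_pmf R \<subseteq> X" "set_pmf R' \<subseteq> Y"
    and Q: "\<And>x y. x \<in> X \<Longrightarrow> y \<in> Y \<Longrightarrow> finite (set_pmf (Q x y))"
  shows "measure_pmf.expectation (bind_pmf R (\<lambda>x. bind_pmf R' (\<lambda>y. Q x y))) h =
      (\<Sum>x\<in>X. \<Sum>y\<in>Y. pmf R x * pmf R' y * measure_pmf.expectation (Q x y) h)"
    and "finite (set_pmf (bind_pmf R (\<lambda>x. bind_pmf R' (\<lambda>y. Q x y))))"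
proof -
  have fin: "finite (set_pmf R)" "finite (set_pmf R')" using assms finite_subset by blast+
  have 1: "finite (set_pmf (bind_pmf R' (\<lambda>y. Q x y)))" if "x \<in> X" for x
    unfolding set_bind_pmf using fin(2) Q[OF that] assms(4) by (intro finite_UN_I) auto
  show "finite (set_pmf (bind_pmf R (\<lambda>x. bind_pmf R' (\<lambda>y. Q x y))))"
    unfolding set_bind_pmf[of R] using fin(1) 1 assms(3) by (intro finite_UN_I) auto
  have "measure_pmf.expectation (bind_pmf R (\<lambda>x. bind_pmf R' (\<lambda>y. Q x y))) h =
      (\<Sum>x\<in>X. pmf R x *\<^sub>R measure_pmf.expectation (bind_pmf R' (\<lambda>y. Q x y)) h)"
    using assms(1) 1 assms(3) by (rule pmf_expectation_bind)
  also have "\<dots> = (\<Sum>x\<in>X. pmf R x *\<^sub>R (\<Sum>y\<in>Y. pmf R' y *\<^sub>R measure_pmf.expectation (Q x y) h))"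
    using Q assms(2,4) by (intro sum.cong refl arg_cong2[of _ _ _ _ "(*\<^sub>R)"] pmf_expectation_bind) auto
  finally show "measure_pmf.expectation (bind_pmf R (\<lambda>x. bind_pmf R' (\<lambda>y. Q x y))) h =
      (\<Sum>x\<in>X. \<Sum>y\<in>Y. pmf R x * pmf R' y * measure_pmf.expectation (Q x y) h)"
    by (simp add: sum_distrib_left mult.assoc)
qed

text \<open>Independence of the players allows the draws to be reordered so that equal rounds of the
  two players are adjacent, which is the nesting of \<open>three_rounds\<close>.\<close>

lemma expectation_three_rounds:
  assumes R: "set_pmf R \<subseteq> X" "finite X" and R': "set_pmf R' \<subseteq> Y" "finite Y"
    and Z: "\<And>x y. x \<in> X \<Longrightarrow> y \<in> X \<Longrightarrow> set_pmf (Z x y) \<subseteq> X"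
    and Z': "\<And>x y. x \<in> Y \<Longrightarrow> y \<in> Y \<Longrightarrow> set_pmf (Z' x y) \<subseteq> Y"
  shows "measure_pmf.expectation (pair_pmf
      (bind_pmf R (\<lambda>x. bind_pmf R (\<lambda>y. map_pmf (\<lambda>z. [x, y, z]) (Z x y))))
      (bind_pmf R' (\<lambda>x. bind_pmf R' (\<lambda>y. map_pmf (\<lambda>z. [x, y, z]) (Z' x y)))))
      (\<lambda>p. f (hd (fst p)) (hd (snd p)) * f (fst p ! 1) (snd p ! 1) * g (fst p ! 2) (snd p ! 2))
    = three_rounds X Y (pmf R) (pmf R') f g (\<lambda>x y z. pmf (Z x y) z) (\<lambda>x y z. pmf (Z' x y) z)"
    (is "measure_pmf.expectation ?P ?h = _")
proof -
  have "?P = bind_pmf R (\<lambda>x. bind_pmf R (\<lambda>y. bind_pmf (Z x y) (\<lambda>z.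
      bind_pmf R' (\<lambda>x'. bind_pmf R' (\<lambda>y'. bind_pmf (Z' x' y') (\<lambda>z'. return_pmf ([x, y, z], [x', y', z'])))))))"
    by (simp add: pair_pmf_def map_pmf_def bind_assoc_pmf bind_return_pmf)
  also have "\<dots> = bind_pmf R (\<lambda>x. bind_pmf R (\<lambda>y. bind_pmf R' (\<lambda>x'. bind_pmf (Z x y) (\<lambda>z.
      bind_pmf R' (\<lambda>y'. bind_pmf (Z' x' y') (\<lambda>z'. return_pmf ([x, y, z], [x', y', z'])))))))"
    by (intro bind_pmf_cong refl bind_commute_pmf)
  also have "\<dots> = bind_pmf R (\<lambda>x. bind_pmf R' (\<lambda>x'. bind_pmf R (\<lambda>y. bind_pmf (Z x y) (\<lambda>z.
      bind_pmf R' (\<lambda>y'. bind_pmf (Z' x' y') (\<lambda>z'. return_pmf ([x, y, z], [x', y', z'])))))))"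
    by (intro bind_pmf_cong refl bind_commute_pmf)
  also have "\<dots> = bind_pmf R (\<lambda>x. bind_pmf R' (\<lambda>x'. bind_pmf R (\<lambda>y. bind_pmf R' (\<lambda>y'. bind_pmf (Z x y) (\<lambda>z.
      bind_pmf (Z' x' y') (\<lambda>z'. return_pmf ([x, y, z], [x', y', z'])))))))"
    by (intro bind_pmf_cong refl bind_commute_pmf)
  finally have P: "?P = \<dots>" .
  define Q where "Q x x' y y' = bind_pmf (Z x y) (\<lambda>z. bind_pmf (Z' x' y') (\<lambda>z'. return_pmf ([x, y, z], [x', y', z'])))"
    for x x' y y'
  have Q: "measure_pmf.expectation (Q x x' y y') ?h
      = (\<Sum>z\<in>X. \<Sum>z'\<in>Y. pmf (Z x y) z * pmf (Z' x' y') z' * (f x x' * f y y' * g z z'))"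
    "finite (set_pmf (Q x x' y y'))"
    if "x \<in> X" "x' \<in> Y" "y \<in> X" "y' \<in> Y" for x y x' y'
  proof -
    have ZX: "set_pmf (Z x y) \<subseteq> X" "set_pmf (Z' x' y') \<subseteq> Y" using Z Z' that by auto
    show "measure_pmf.expectation (Q x x' y y') ?h
        = (\<Sum>z\<in>X. \<Sum>z'\<in>Y. pmf (Z x y) z * pmf (Z' x' y') z' * (f x x' * f y y' * g z z'))"
      unfolding Q_def using R R' ZX by (subst expectation_bind_bind[of X Y]) auto
    show "finite (set_pmf (Q x x' y y'))"
      unfolding Q_def using R R' ZX by (intro expectation_bind_bind(2)[of X Y]) auto
  qed
  define P where "P x x' = bind_pmf R (\<lambda>y. bind_pmf R' (\<lambda>y'. Q x x' y y'))" for x x'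
  have P': "measure_pmf.expectation (P x x') ?h =
      (\<Sum>y\<in>X. \<Sum>y'\<in>Y. pmf R y * pmf R' y' * measure_pmf.expectation (Q x x' y y') ?h)"
    "finite (set_pmf (P x x'))"
    if "x \<in> X" "x' \<in> Y" for x x'
    unfolding P_def using R R' Q(2)[OF that]
    by (intro expectation_bind_bind(1), auto)[1] (intro expectation_bind_bind(2)[of X Y], use R R' Q(2)[OF that] in auto)
  have "measure_pmf.expectation ?P ?h =
      (\<Sum>x\<in>X. \<Sum>x'\<in>Y. pmf R x * pmf R' x' * measure_pmf.expectation (P x x') ?h)"
    unfolding P Q_def[symmetric] P_def[symmetric] using R R' P'(2) by (intro expectation_bind_bind) auto
  also have "\<dots> = (\<Sum>x\<in>X. \<Sum>x'\<in>Y. pmf R x * pmf R' x' * (\<Sum>y\<in>X. \<Sum>y'\<in>Y. pmf R y * pmf R' y' *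
      (\<Sum>z\<in>X. \<Sum>z'\<in>Y. pmf (Z x y) z * pmf (Z' x' y') z' * (f x x' * f y y' * g z z'))))"
    by (simp only: P'(1) Q(1) cong: sum.cong)
  also have "\<dots> = three_rounds X Y (pmf R) (pmf R') f g (\<lambda>x y z. pmf (Z x y) z) (\<lambda>x y z. pmf (Z' x y) z)"
    unfolding three_rounds_def by (simp add: sum_distrib_left mult_ac)
  finally show ?thesis .
qed

lemma pmf_decision_bind:
  "pmf (bind_pmf D (\<lambda>c. bind_pmf (F c) (\<lambda>\<pi>. return_pmf (c, \<pi>)))) (c :: decision, \<pi>) = pmf D c * pmf (F c) \<pi>"
proof -
  have "pmf (bind_pmf (F c') (\<lambda>\<pi>. return_pmf (c', \<pi>))) (c, \<pi>) = of_bool (c' = c) * pmf (F c) \<pi>" for c'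
  proof -
    have "bind_pmf (F c') (\<lambda>\<pi>. return_pmf (c', \<pi>)) = map_pmf (Pair c') (F c')"
      by (simp add: map_pmf_def)
    moreover have "pmf (map_pmf (Pair c') (F c')) (c, \<pi>) = of_bool (c' = c) * pmf (F c) \<pi>"
      by (cases "c' = c") (auto simp: pmf_map_inj' inj_on_def intro!: pmf_map_outside)
    ultimately show ?thesis by simp
  qed
  then show ?thesis
    unfolding pmf_bind by (subst integral_measure_pmf_real[of UNIV], simp_all only:) (cases c; simp add: UNIV_decision)+
qed


section \<open>Laws of single rounds\<close>

definition round_law :: "nat \<Rightarrow> real \<Rightarrow> nat \<Rightarrow> round_data pmf" where
  "round_law n \<theta> i = pair_pmf (decision_pmf \<theta>) (pmf_of_set (perms n i))"

lemma set_round_law: "set_pmf (round_law n \<theta> i) \<subseteq> rounds n i"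
  by (auto simp: round_law_def rounds_def perms_ne finite_perms)

lemma AW_eq: "AW n \<theta> i k h = round_law n \<theta> i"
  by (simp add: AW_def round_law_def)

lemma FSD_eq: "\<not> 3 dvd k + 1 \<Longrightarrow> FSD n \<theta> i k h = round_law n \<theta> i"
  by (simp add: FSD_def round_law_def)

lemma head_in:
  assumes "\<pi> \<in> perms n i" "i \<in> {1..n}" "n \<ge> 2"
  shows "\<pi> ! 0 \<in> {1..n} - {i}"
proof -
  have "length \<pi> = card ({1..n} - {i})" "set \<pi> = {1..n} - {i}"
    using assms(1) permutations_of_setD length_finite_permutations_of_set unfolding perms_def by blast+
  moreover have "card ({1..n} - {i}) > 0" using assms by (simp add: card_Diff_singleton)
  ultimately show ?thesis by (metis nth_mem)
qed

text \<open>\<open>n \<ge> 4\<close> leaves a location besides the home and the two earlier first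
  locations. Nonemptiness matters because \<open>pmf_of_set\<close> is specified only for nonempty
  finite sets.\<close>

lemma FSD_perms_ne:
  assumes "i \<in> {1..n}" "n \<ge> 4" "x \<in> rounds n i" "y \<in> rounds n i"
  shows "FSD_perms n i x y c \<noteq> {}" "finite (FSD_perms n i x y c)"
proof -
  have F: "\<exists>\<pi>\<in>perms n i. \<pi> ! 0 = a" if "a \<in> {1..n} - {i}" for a
  proof -
    obtain p where "p \<in> permutations_of_set ({1..n} - {i} - {a})"
      using permutations_of_set_empty_iff[of "{1..n} - {i} - {a}"] by blast
    then have "a # p \<in> perms n i"
      unfolding perms_def using that by (subst permutations_of_set_nonempty) blast+
    then show ?thesis by (intro bexI[of _ "a # p"]) auto
  qed
  show "finite (FSD_perms n i x y c)" by (auto simp: FSD_perms_def finite_perms)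
  have "card {i, snd x ! 0, snd y ! 0} \<le> 3"
    using card_insert_le_m1[of 3 "{snd x ! 0, snd y ! 0}" i] card_insert_le_m1[of 2 "{snd y ! 0}" "snd x ! 0"] by simp
  then have "\<not> {1..n} \<subseteq> {i, snd x ! 0, snd y ! 0}"
    using card_mono[of "{i, snd x ! 0, snd y ! 0}" "{1..n}"] assms by auto
  then obtain a where a: "a \<in> {1..n} - {i}" "a \<notin> {snd x ! 0, snd y ! 0}" by blast
  have x0: "snd x \<in> perms n i" "snd x ! 0 \<in> {1..n} - {i}"
    using assms head_in[of "snd x" n i] unfolding rounds_def by (auto simp del: Diff_iff)
  show "FSD_perms n i x y c \<noteq> {}"
    using F[OF a(1)] a(2) x0(1) unfolding FSD_perms_def by auto
qed

lemma pmf_decision_Move: "0 \<le> \<theta> \<Longrightarrow> \<theta> \<le> 1 \<Longrightarrow> pmf (decision_pmf \<theta>) Move = 1 - \<theta>"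
  using pmf_map_inj'[of "\<lambda>b. if b then Stay else Move" "bernoulli_pmf \<theta>" False]
  by (simp add: decision_pmf_def inj_on_def)

lemma pmf_decision_Stay: "0 \<le> \<theta> \<Longrightarrow> \<theta> \<le> 1 \<Longrightarrow> pmf (decision_pmf \<theta>) Stay = \<theta>"
  using pmf_map_inj'[of "\<lambda>b. if b then Stay else Move" "bernoulli_pmf \<theta>" True]
  by (simp add: decision_pmf_def inj_on_def)

lemma card_perms: "i \<in> {1..n} \<Longrightarrow> card (perms n i) = fact (n - 1)"
  by (simp add: perms_def card_Diff_singleton)

lemma pmf_round_law:
  "i \<in> {1..n} \<Longrightarrow> \<pi> \<in> perms n i \<Longrightarrow> pmf (round_law n \<theta> i) (c, \<pi>) = pmf (decision_pmf \<theta>) c / fact (n - 1)"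
  by (simp add: round_law_def pmf_pair pmf_of_set finite_perms perms_ne card_perms)

text \<open>Only the first location is biased; given it, the other \<open>n - 2\<close> entries are
  uniform, whence \<open>fact (n - 2)\<close>. The factor \<open>1 - \<theta>\<close> is the
  probability of moving in the third round.\<close>

definition FSD_pert :: "nat \<Rightarrow> real \<Rightarrow> round_data \<Rightarrow> round_data \<Rightarrow> round_data \<Rightarrow> real" where
  "FSD_pert n \<theta> x y z = of_bool (fst x = Move \<and> fst y = Move \<and> fst z = Move) *
     ((1 - \<theta>) / fact (n - 2) * pert (real (n - 1)) (snd z ! 0) (snd x ! 0) (snd y ! 0))"

text \<open>\<open>pert\<close> merges the two rules: for \<open>a = b\<close> it equals
  \<open>of_bool (f = a) - 1 / m\<close>, for \<open>a \<noteq> b\<close> it is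
  \<open>- 1 / m\<close> on \<open>{a, b}\<close> and \<open>1 / (m - 2) - 1 / m\<close>
  elsewhere.\<close>

lemma pmf_FSD:
  assumes i: "i \<in> {1..n}" and n: "n \<ge> 4" and \<theta>: "0 \<le> \<theta>" "\<theta> \<le> 1"
    and x: "x \<in> rounds n i" and y: "y \<in> rounds n i" and z: "z \<in> rounds n i"
  shows "pmf (FSD n \<theta> i 2 ((!) [x, y])) z = pmf (round_law n \<theta> i) z + FSD_pert n \<theta> x y z"
proof -
  obtain c \<pi> where z': "z = (c, \<pi>)" "\<pi> \<in> perms n i" using z by (auto simp: rounds_def)
  have "pmf (FSD n \<theta> i 2 ((!) [x, y])) z = pmf (decision_pmf \<theta>) c * pmf (pmf_of_set (FSD_perms n i x y c)) \<pi>"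
    unfolding FSD_def z' by (simp add: pmf_decision_bind)
  also have "\<dots> = pmf (decision_pmf \<theta>) c * (of_bool (\<pi> \<in> FSD_perms n i x y c) / card (FSD_perms n i x y c))"
    using FSD_perms_ne[OF i n x y] by (simp add: pmf_of_set)
  also have "\<dots> = pmf (round_law n \<theta> i) z + FSD_pert n \<theta> x y z"
  proof (cases "fst x = Move \<and> fst y = Move \<and> c = Move")
    case False
    then have "FSD_perms n i x y c = perms n i" unfolding FSD_perms_def by auto
    then show ?thesis using False z' i by (auto simp: FSD_pert_def pmf_round_law card_perms)
  next
    case True
    define m where "m = real (n - 1)"
    define a b where "a = snd x ! 0" and "b = snd y ! 0"
    have m: "m > 2" "m \<noteq> 0" "m - 2 \<noteq> 0" and fm: "(fact (n - 1) :: real) = m * fact (n - 2)"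
      using n unfolding m_def by (auto simp: fact_reduce numeral_2_eq_2)
    let ?I = "{1..n} - {i}"
    have cI: "card ?I = n - 1" using i by (simp add: card_Diff_singleton)
    have "?I \<noteq> {}"
    proof
      assume "?I = {}"
      then have "card ?I = 0" by (simp only: card.empty)
      with cI n show False by simp
    qed
    with cI have I: "finite ?I" "?I \<noteq> {}" "card ?I = n - 1" by simp_all
    have "snd x \<in> perms n i" "snd y \<in> perms n i" using x y by (auto simp: rounds_def)
    then have ab: "a \<in> ?I" "b \<in> ?I" unfolding a_def b_def using n by (intro head_in i; simp)+
    have f0: "(fact (n - 2) :: real) \<noteq> 0" by simp
    have w: "pmf (round_law n \<theta> i) z = (1 - \<theta>) / (m * fact (n - 2))"
      using z' True i \<theta> by (simp add: pmf_round_law pmf_decision_Move fm[unfolded One_nat_def])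
    have d: "FSD_pert n \<theta> x y z = (1 - \<theta>) / fact (n - 2) * pert m (\<pi> ! 0) a b"
      using True z' by (simp add: FSD_pert_def m_def a_def b_def)
    show ?thesis
    proof (cases "a = b")
      case eq: True
      have F: "FSD_perms n i x y c = {\<pi> \<in> permutations_of_set ?I. \<pi> ! 0 \<in> {a}}"
        using True eq unfolding FSD_perms_def perms_def a_def b_def by auto
      have cc: "real (card (FSD_perms n i x y c)) = fact (n - 2)"
        unfolding F using ab I card_permutations_of_set_head[of ?I "{a}" "n - 1"] by (simp add: numeral_2_eq_2)
      have mm: "\<pi> \<in> FSD_perms n i x y c \<longleftrightarrow> \<pi> ! 0 = a" using z' unfolding F perms_def by auto
      show ?thesis
        unfolding w d cc mm using True \<theta> m f0 eq
        by (cases "\<pi> ! 0 = a") (simp_all add: pmf_decision_Move pert_def field_simps)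
    next
      case ne: False
      have F: "FSD_perms n i x y c = {\<pi> \<in> permutations_of_set ?I. \<pi> ! 0 \<in> ?I - {a, b}}"
        using True ne i n unfolding FSD_perms_def perms_def[symmetric] a_def b_def
        by (auto dest: head_in simp del: Diff_iff simp: Diff_iff[of "_ :: nat" _ "{_, _}"])
      have "card (?I - {a, b}) = n - 3" using ab ne I by (simp add: card_Diff_subset)
      then have cc: "real (card (FSD_perms n i x y c)) = fact (n - 2) * (m - 2)"
        unfolding F using ab I n card_permutations_of_set_head[of ?I "?I - {a, b}" "n - 1"]
        by (simp add: m_def of_nat_diff numeral_2_eq_2 numeral_3_eq_3)
      have mm: "\<pi> \<in> FSD_perms n i x y c \<longleftrightarrow> \<pi> ! 0 \<noteq> a \<and> \<pi> ! 0 \<noteq> b"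
        using z' head_in[OF z'(2) i] n unfolding F perms_def by auto
      show ?thesis
        unfolding w d cc mm using True \<theta> m f0 ne
        by (cases "\<pi> ! 0 = a"; cases "\<pi> ! 0 = b") (simp_all add: pmf_decision_Move pert_def field_simps)
    qed
  qed
  finally show ?thesis .
qed

section \<open>First locations\<close>

lemma history_3:
  "history K 3 = bind_pmf (K 0 ((!) [])) (\<lambda>x. bind_pmf (K 1 ((!) [x])) (\<lambda>y. map_pmf (\<lambda>z. [x, y, z]) (K 2 ((!) [x, y]))))"
  by (simp add: numeral_3_eq_3 numeral_2_eq_2 map_pmf_def bind_assoc_pmf bind_return_pmf)

lemma apart_three:
  assumes "0 < n - 1"
  shows "apart n (2 * (n - 1) + j) [x, y, z] [x', y', z'] \<longleftrightarrow>
    apart n (n - 1) [x] [x'] \<and> apart n (n - 1) [y] [y'] \<and> apart n j [z] [z']"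
proof -
  have "apart n (1 * (n - 1) + (1 * (n - 1) + j)) ([x] @ [y, z]) ([x'] @ [y', z']) \<longleftrightarrow>
      apart n (1 * (n - 1)) [x] [x'] \<and> apart n (1 * (n - 1) + j) ([y] @ [z]) ([y'] @ [z'])"
    using assms by (subst apart_append) auto
  also have "apart n (1 * (n - 1) + j) ([y] @ [z]) ([y'] @ [z']) \<longleftrightarrow>
      apart n (1 * (n - 1)) [y] [y'] \<and> apart n j [z] [z']"
    using assms by (intro apart_append) auto
  also have "1 * (n - 1) + (1 * (n - 1) + j) = 2 * (n - 1) + j" by simp
  finally show ?thesis by simp
qed

lemma apart_prob_three_rounds:
  assumes "0 < n - 1"
    and first: "\<And>i h. \<sigma> i 0 h = round_law n \<theta> i" "\<And>i h. \<sigma> i 1 h = round_law n \<theta> i"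
    and third: "\<And>i x y. i \<in> {1, 2} \<Longrightarrow> x \<in> rounds n i \<Longrightarrow> y \<in> rounds n i \<Longrightarrow> set_pmf (\<sigma> i 2 ((!) [x, y])) \<subseteq> rounds n i"
  shows "apart_prob n \<sigma> 3 (2 * (n - 1) + j) = three_rounds (rounds n 1) (rounds n 2)
    (pmf (round_law n \<theta> 1)) (pmf (round_law n \<theta> 2))
    (\<lambda>x x'. of_bool (apart n (n - 1) [x] [x'])) (\<lambda>x x'. of_bool (apart n j [x] [x']))
    (\<lambda>x y. pmf (\<sigma> 1 2 ((!) [x, y]))) (\<lambda>x y. pmf (\<sigma> 2 2 ((!) [x, y])))"
proof -
  let ?P = "pair_pmf (history (\<sigma> 1) 3) (history (\<sigma> 2) 3)"
  let ?f = "\<lambda>x x'. of_bool (apart n (n - 1) [x] [x']) :: real" and ?g = "\<lambda>x x'. of_bool (apart n j [x] [x']) :: real"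
  have "apart_prob n \<sigma> 3 (2 * (n - 1) + j) =
      measure_pmf.expectation ?P (indicator {x. apart n (2 * (n - 1) + j) (fst x) (snd x)})"
    unfolding apart_prob_def by simp
  also have "\<dots> = measure_pmf.expectation ?P
      (\<lambda>p. ?f (hd (fst p)) (hd (snd p)) * ?f (fst p ! 1) (snd p ! 1) * ?g (fst p ! 2) (snd p ! 2))"
  proof (rule integral_cong_AE)
    show "AE p in ?P. indicator {x. apart n (2 * (n - 1) + j) (fst x) (snd x)} p =
       ?f (hd (fst p)) (hd (snd p)) * ?f (fst p ! 1) (snd p ! 1) * ?g (fst p ! 2) (snd p ! 2)"
    proof (subst AE_measure_pmf_iff, intro ballI)
      fix p assume "p \<in> set_pmf ?P"
      then have "length (fst p) = 3" "length (snd p) = 3" using length_history by (auto simp: mem_Times_iff)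
      then obtain x y z x' y' z' where p: "fst p = [x, y, z]" "snd p = [x', y', z']"
        by (auto simp: numeral_3_eq_3 length_Suc_conv)
      show "indicator {x. apart n (2 * (n - 1) + j) (fst x) (snd x)} p =
         ?f (hd (fst p)) (hd (snd p)) * ?f (fst p ! 1) (snd p ! 1) * ?g (fst p ! 2) (snd p ! 2)"
        unfolding indicator_def mem_Collect_eq p apart_three[OF assms(1)] by (simp add: of_bool_conj)
    qed
  qed auto
  also have "\<dots> = three_rounds (rounds n 1) (rounds n 2) (pmf (round_law n \<theta> 1)) (pmf (round_law n \<theta> 2))
    ?f ?g (\<lambda>x y. pmf (\<sigma> 1 2 ((!) [x, y]))) (\<lambda>x y. pmf (\<sigma> 2 2 ((!) [x, y])))"
    unfolding history_3 first
    by (rule expectation_three_rounds) (use third in \<open>auto simp: set_round_law finite_rounds\<close>)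
  finally show ?thesis .
qed

section \<open>Meeting within a single round\<close>

lemma ball_atLeast1_iff: "(\<forall>t\<in>{1..s}. P (t - 1)) \<longleftrightarrow> (\<forall>l<s. P l)" for s :: nat
proof safe
  fix l assume "\<forall>t\<in>{1..s}. P (t - 1)" "l < s"
  then show "P l" by (auto dest: bspec[of _ _ "Suc l"])
qed auto

lemma location_single:
  assumes "s \<le> n - 1" "t \<in> {1..s}"
  shows "location n i ((!) [(c, \<pi>)]) t = (case c of Stay \<Rightarrow> i | Move \<Rightarrow> \<pi> ! (t - 1))"
  using assms unfolding location_def by (auto split: decision.splits)

lemma apart_single:
  assumes "s \<le> n - 1"
  shows "apart n s [(c, \<pi>)] [(c', \<pi>')] \<longleftrightarrow>
    (\<forall>l<s. (case c of Stay \<Rightarrow> 1 | Move \<Rightarrow> \<pi> ! l) \<noteq> (case c' of Stay \<Rightarrow> 2 | Move \<Rightarrow> \<pi>' ! l))"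
  unfolding apart_def
  by (subst ball_atLeast1_iff[symmetric], intro ball_cong refl) (simp only: location_single[OF assms])

lemma apart_Move_Move:
  "s \<le> n - 1 \<Longrightarrow> apart n s [(Move, \<pi>)] [(Move, \<pi>')] \<longleftrightarrow> no_match s \<pi> \<pi>'"
  by (simp add: apart_single no_match_def)

lemma mem_perms_nth:
  assumes "\<pi> \<in> perms n i" "a \<in> {1..n}" "a \<noteq> i" "i \<in> {1..n}"
  shows "\<exists>l<n - 1. \<pi> ! l = a"
proof -
  have "length \<pi> = card ({1..n} - {i})" "set \<pi> = {1..n} - {i}"
    using assms(1) permutations_of_setD length_finite_permutations_of_set unfolding perms_def by blast+
  moreover have "card ({1..n} - {i}) = n - 1" using assms by (simp add: card_Diff_singleton)
  moreover have "a \<in> {1..n} - {i}" using assms by simp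
  ultimately show ?thesis by (metis in_set_conv_nth)
qed

text \<open>During a whole round a mover visits every location but its own home, in particular the
  home of the opponent.\<close>

lemma apart_Move_Stay: "\<pi> \<in> perms n 1 \<Longrightarrow> n \<ge> 2 \<Longrightarrow> \<not> apart n (n - 1) [(Move, \<pi>)] [(Stay, \<pi>')]"
  using mem_perms_nth[of \<pi> n 1 2] by (auto simp: apart_single)

lemma apart_Stay_Move: "\<pi>' \<in> perms n 2 \<Longrightarrow> n \<ge> 2 \<Longrightarrow> \<not> apart n (n - 1) [(Stay, \<pi>)] [(Move, \<pi>')]"
  using mem_perms_nth[of \<pi>' n 2 1] by (auto simp: apart_single)

text \<open>For \<open>J = n - 1\<close> this is the table \<open>V\<close> of the overview; smaller
  \<open>J\<close> give the tables for an unfinished third round.\<close>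

definition heads :: "nat \<Rightarrow> nat \<Rightarrow> nat \<Rightarrow> nat \<Rightarrow> nat \<Rightarrow> nat \<Rightarrow> real" where
  "heads n i i' J a b = avg (permutations_of_set ({1..n} - {i} - {a}))
     (\<lambda>p. avg (permutations_of_set ({1..n} - {i'} - {b})) (\<lambda>q. of_bool (no_match J (a # p) (b # q))))"

lemma sum_no_match_heads:
  assumes "i \<in> {1..n}" "i' \<in> {1..n}" "n \<ge> 2"
  shows "(\<Sum>\<pi>\<in>perms n i. \<Sum>\<pi>'\<in>perms n i'. of_bool (no_match J \<pi> \<pi>') * H (\<pi> ! 0) (\<pi>' ! 0)) =
    (fact (n - 2))\<^sup>2 * (\<Sum>a\<in>{1..n} - {i}. \<Sum>b\<in>{1..n} - {i'}. heads n i i' J a b * H a b)"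
proof -
  have ne: "{1..n} - {k} \<noteq> {}" if "k \<in> {1..n}" for k
  proof
    assume "{1..n} - {k} = {}"
    then have "card ({1..n} - {k}) = 0" by (simp only: card.empty)
    with that assms(3) show False by (simp add: card_Diff_singleton)
  qed
  have card2: "card ({1..n} - {k} - {a}) = n - 2" if "k \<in> {1..n}" "a \<in> {1..n} - {k}" for k a
    using that by (simp add: card_Diff_singleton numeral_2_eq_2)
  have "(\<Sum>\<pi>\<in>perms n i. \<Sum>\<pi>'\<in>perms n i'. of_bool (no_match J \<pi> \<pi>') * H (\<pi> ! 0) (\<pi>' ! 0)) =
    (\<Sum>a\<in>{1..n} - {i}. \<Sum>p\<in>permutations_of_set ({1..n} - {i} - {a}). \<Sum>b\<in>{1..n} - {i'}.
      \<Sum>q\<in>permutations_of_set ({1..n} - {i'} - {b}). of_bool (no_match J (a # p) (b # q)) * H a b)"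
    unfolding perms_def sum_permutations_of_set[OF finite_Diff[OF finite_atLeastAtMost] ne[OF assms(1)]]
      sum_permutations_of_set[OF finite_Diff[OF finite_atLeastAtMost] ne[OF assms(2)]] by simp
  also have "\<dots> = (\<Sum>a\<in>{1..n} - {i}. \<Sum>b\<in>{1..n} - {i'}. \<Sum>p\<in>permutations_of_set ({1..n} - {i} - {a}).
      \<Sum>q\<in>permutations_of_set ({1..n} - {i'} - {b}). of_bool (no_match J (a # p) (b # q)) * H a b)"
    by (intro sum.cong refl sum.swap)
  also have "\<dots> = (\<Sum>a\<in>{1..n} - {i}. \<Sum>b\<in>{1..n} - {i'}. (fact (n - 2))\<^sup>2 * (heads n i i' J a b * H a b))"
  proof (intro sum.cong refl)
    fix a b assume "a \<in> {1..n} - {i}" "b \<in> {1..n} - {i'}"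
    then have "card ({1..n} - {i} - {a}) = n - 2" "card ({1..n} - {i'} - {b}) = n - 2"
      using card2 assms by blast+
    then show "(\<Sum>p\<in>permutations_of_set ({1..n} - {i} - {a}).
      \<Sum>q\<in>permutations_of_set ({1..n} - {i'} - {b}). of_bool (no_match J (a # p) (b # q)) * H a b) =
      (fact (n - 2))\<^sup>2 * (heads n i i' J a b * H a b)"
      unfolding heads_def avg_def
      by (simp add: sum_distrib_right[symmetric] sum_divide_distrib[symmetric] power2_eq_square)
  qed
  finally show ?thesis by (simp add: sum_distrib_left)
qed

text \<open>The private location of each player is the other's home. Of the \<open>n - 2\<close>
  locations left to each player all are common after two private starts, \<open>n - 3\<close> after
  one, and \<open>n - 4\<close> after two distinct shared starts; equal starts meet at once.\<close>

lemma heads_patterned: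
  assumes i: "i \<in> {1..n}" "i' \<in> {1..n}" "i \<noteq> i'" and n: "n \<ge> 4" and J: "J \<le> n - 2"
  shows "patterned i' i ({1..n} - {i, i'}) (heads n i i' (Suc J))
    (avoid J (real n - 2) (real n - 2)) (avoid J (real n - 2) (real n - 3)) 0 (avoid J (real n - 2) (real n - 4))"
proof -
  define B where "B = {1..n} - {i, i'}"
  have B: "finite B" "card B = n - 2" "i \<notin> B" "i' \<notin> B" "{1..n} - {i} = insert i' B" "{1..n} - {i'} = insert i B"
    using i unfolding B_def by (auto simp: card_Diff_subset)
  have c2: "card ({1..n} - {k} - {a}) = n - 2" if "k \<in> {1..n}" "a \<in> {1..n} - {k}" for k a
    using that by (simp add: card_Diff_singleton numeral_2_eq_2)
  have h: "heads n i i' (Suc J) a b = avoid J (real n - 2) (real k)"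
    if "a \<in> insert i' B" "b \<in> insert i B" "a \<noteq> b"
      and C: "({1..n} - {i} - {a}) \<inter> ({1..n} - {i'} - {b}) = C" "card C = k" for a b C k
  proof -
    have ab: "a \<in> {1..n} - {i}" "b \<in> {1..n} - {i'}" using that(1,2) B(5,6) by blast+
    have "heads n i i' (Suc J) a b = avoid J (real (n - 2)) (real k)"
      unfolding heads_def using avg_no_match[of "{1..n} - {i} - {a}" "{1..n} - {i'} - {b}" "n - 2" J]
        c2[OF i(1) ab(1)] c2[OF i(2) ab(2)] J that(3)
      by (simp only: no_match_Suc_Cons C finite_Diff finite_atLeastAtMost simp_thms)
    then show ?thesis using n by (simp add: of_nat_diff)
  qed
  have r: "real (n - 2) = real n - 2" "real (n - 3) = real n - 3" "real (n - 4) = real n - 4" using n by auto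
  have c3: "card (B - {b}) = n - 3" if "b \<in> B" for b using card_Diff_singleton[OF that] B(2) by simp
  have c4: "card (B - {b, c}) = n - 4" if "b \<in> B" "c \<in> B" "b \<noteq> c" for b c
    using card_Diff_subset[of "{b, c}" B] that B(1,2) by simp
  have "heads n i i' (Suc J) i' i = avoid J (real n - 2) (real n - 2)"
    using h[of i' i B "n - 2"] i(3) B(2) unfolding r by (auto simp: B_def)
  moreover have "heads n i i' (Suc J) i' b = avoid J (real n - 2) (real n - 3)" if "b \<in> B" for b
  proof -
    have "i' \<noteq> b" "({1..n} - {i} - {i'}) \<inter> ({1..n} - {i'} - {b}) = B - {b}" using that unfolding B_def by auto
    from h[OF insertI1 insertI2[OF that] this c3[OF that]] show ?thesis unfolding r .
  qed
  moreover have "heads n i i' (Suc J) b i = avoid J (real n - 2) (real n - 3)" if "b \<in> B" for b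
  proof -
    have "b \<noteq> i" "({1..n} - {i} - {b}) \<inter> ({1..n} - {i'} - {i}) = B - {b}" using that unfolding B_def by auto
    from h[OF insertI2[OF that] insertI1 this c3[OF that]] show ?thesis unfolding r .
  qed
  moreover have "heads n i i' (Suc J) b b = 0" for b
    by (simp add: heads_def avg_def no_match_Suc_Cons)
  moreover have "heads n i i' (Suc J) b c = avoid J (real n - 2) (real n - 4)" if "b \<in> B" "c \<in> B" "b \<noteq> c" for b c
  proof -
    have "({1..n} - {i} - {b}) \<inter> ({1..n} - {i'} - {c}) = B - {b, c}" unfolding B_def by auto
    from h[OF insertI2[OF that(1)] insertI2[OF that(2)] that(3) this c4[OF that]] show ?thesis unfolding r .
  qed
  ultimately show ?thesis unfolding patterned_def B_def[symmetric] using B(1,3,4) by blast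
qed

text \<open>The probability that two movers miss each other in a whole round:
  \<open>avoid m m (m - 1)\<close> with \<open>m = n - 1\<close>, rewritten by
  \<open>avoid_derange\<close>.\<close>

definition miss_prob :: "nat \<Rightarrow> real" where
  "miss_prob n = real n * derange n / (real n - 1)"

text \<open>Against a uniform opponent, relabelling the time steps shows that the chance of being
  missed in a whole round is the same for every own permutation. Here this is checked on the two
  kinds of rows, through the identities \<open>e1\<close> and \<open>e2\<close>.\<close>

lemma heads_row:
  assumes i: "i \<in> {1..n}" "i' \<in> {1..n}" "i \<noteq> i'" and n: "n \<ge> 4" and a: "a \<in> {1..n} - {i}"
  shows "(\<Sum>b\<in>{1..n} - {i'}. heads n i i' (n - 1) a b) = real (n - 1) * miss_prob n"
proof -
  define M where "M = n - 2"
  have M: "M \<ge> 2" "n = Suc (Suc M)" "real n = real M + 2" "Suc M = n - 1" using n unfolding M_def by auto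
  let ?B = "{1..n} - {i, i'}"
  have cB: "real (card ?B) = real M" using i unfolding M_def by (simp add: card_Diff_subset)
  have I: "{1..n} - {i} = insert i' ?B" "{1..n} - {i'} = insert i ?B" using i by auto
  have p: "patterned i' i ?B (heads n i i' (n - 1)) (avoid M M M) (avoid M M (real M - 1)) 0 (avoid M M (real M - 2))"
  proof -
    have "real n - 2 = real M" "real n - 3 = real M - 1" "real n - 4 = real M - 2" using M(3) by auto
    then show ?thesis using heads_patterned[OF i n, of M] unfolding M_def[symmetric] M(4) by simp
  qed
  have e1: "real M * avoid M M (real M - 1) + avoid M M M = (real M + 2) * derange n"
    using avoid_derange[of M] derange_rec[of M] unfolding M(2) derange_def[of M] by linarith
  have e2: "avoid M M (real M - 1) + (real M - 1) * avoid M M (real M - 2) = real M * avoid M M (real M - 1) + avoid M M M"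
  proof -
    have "avoid M M (real M - 1) - avoid M M (real M - 2) = - (1 / real M) * avoid (M - 1) (real (M - 1)) (real (M - 1) - 1)"
      using avoid_diff[of M "real M" "real M - 2"] M by (simp add: power2_eq_square of_nat_diff)
    moreover have "real (M - 1) * avoid (M - 1) (real (M - 1)) (real (M - 1) - 1) = real M * derange M"
      using avoid_derange[of "M - 1"] M(1) by (simp add: of_nat_diff)
    ultimately have "(real M - 1) * (avoid M M (real M - 1) - avoid M M (real M - 2)) = - (1 / real M) * (real M * derange M)"
      using M(1) by (simp add: of_nat_diff)
    then have "(real M - 1) * (avoid M M (real M - 1) - avoid M M (real M - 2)) = - derange M"
      using M(1) by simp
    then show ?thesis unfolding derange_def by (simp add: algebra_simps)
  qed
  have "(\<Sum>b\<in>{1..n} - {i'}. heads n i i' (n - 1) a b) = (real M + 2) * derange n"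
  proof (cases "a = i'")
    case True
    then show ?thesis using patterned_row(1)[OF p] cB e1 unfolding I by simp
  next
    case False
    then have "a \<in> ?B" using a by auto
    then show ?thesis using patterned_row(2)[OF p, of a] cB e1 e2 unfolding I by simp
  qed
  moreover have "real (n - 1) = real n - 1" "real n - 1 > 0" using n by auto
  ultimately show ?thesis unfolding miss_prob_def using M(3) by simp
qed

section \<open>Deviation of a single player\<close>

lemma sum_rounds: "(\<Sum>x\<in>rounds n i. f x) = (\<Sum>\<pi>\<in>perms n i. f (Stay, \<pi>)) + (\<Sum>\<pi>\<in>perms n i. f (Move, \<pi>) :: real)"
proof -
  have "(\<Sum>x\<in>rounds n i. f x) = (\<Sum>c\<in>UNIV. \<Sum>\<pi>\<in>perms n i. f (c, \<pi>))"
    by (simp add: rounds_def sum.cartesian_product)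
  then show ?thesis by (simp add: UNIV_decision)
qed

lemma sum_perms_head:
  assumes "i \<in> {1..n}" "n \<ge> 2"
  shows "(\<Sum>\<pi>\<in>perms n i. g (\<pi> ! 0)) = fact (n - 2) * (\<Sum>a\<in>{1..n} - {i}. g a :: real)"
proof -
  have c: "card ({1..n} - {i}) = n - 1" using assms by (simp add: card_Diff_singleton)
  have "{1..n} - {i} \<noteq> {}"
  proof
    assume "{1..n} - {i} = {}"
    then have "card ({1..n} - {i}) = 0" by (simp only: card.empty)
    with c assms(2) show False by simp
  qed
  then show ?thesis
    unfolding perms_def using sum_permutations_of_set_head[of "{1..n} - {i}" "n - 1" g] c
    by (simp add: numeral_2_eq_2)
qed

text \<open>Stated for abstract \<open>N\<close> and homes \<open>i\<close>, \<open>i'\<close>, so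
  that together with \<open>three_rounds_swap\<close> it serves either player. By \<open>NS\<close>
  only a moving opponent counts, and by \<open>heads_row\<close> the chance of being missed is the
  same for every first location.\<close>

lemma three_rounds_FSD_pert_eq_0:
  assumes i: "i \<in> {1..n}" "i' \<in> {1..n}" "i \<noteq> i'" and n: "n \<ge> 4" and \<theta>: "0 \<le> \<theta>" "\<theta> \<le> 1"
    and NM: "\<And>\<pi> \<pi>'. \<pi> \<in> perms n i \<Longrightarrow> \<pi>' \<in> perms n i' \<Longrightarrow> N (Move, \<pi>) (Move, \<pi>') = of_bool (no_match (n - 1) \<pi> \<pi>')"
    and NS: "\<And>\<pi> \<pi>'. \<pi> \<in> perms n i \<Longrightarrow> \<pi>' \<in> perms n i' \<Longrightarrow> N (Move, \<pi>) (Stay, \<pi>') = 0"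
  shows "three_rounds (rounds n i) (rounds n i') (pmf (round_law n \<theta> i)) (pmf (round_law n \<theta> i')) N N'
    (FSD_pert n \<theta>) (\<lambda>_ _. u') = 0"
proof -
  define m where "m = real (n - 1)"
  have m: "m > 2" "m \<noteq> 0" and fm: "(fact (n - 1) :: real) = m * fact (n - 2)"
    using n unfolding m_def by (auto simp: fact_reduce numeral_2_eq_2)
  have f0: "(fact (n - 2) :: real) \<noteq> 0" by simp
  have wM: "pmf (round_law n \<theta> k) (Move, \<pi>) = (1 - \<theta>) / (m * fact (n - 2))" if "k \<in> {1..n}" "\<pi> \<in> perms n k" for k \<pi>
    using that \<theta> by (simp add: pmf_round_law pmf_decision_Move fm[unfolded One_nat_def])
  let ?ty = "\<lambda>x :: round_data. (fst x, snd x ! 0)"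
  let ?A = "{Move} \<times> (UNIV :: nat set)"
  let ?d = "\<lambda>s t (z :: round_data). of_bool (fst s = Move \<and> fst t = Move \<and> fst z = Move) *
     ((1 - \<theta>) / fact (n - 2) * pert (real (n - 1)) (snd z ! 0) (snd s) (snd t))"
  show ?thesis
  \<comment> \<open>\<open>g\<close> is the probability that the opponent moves and misses a moving
    player.\<close>
  proof (rule three_rounds_eq_0[where ty = ?ty and A = ?A and d' = ?d and g = "(1 - \<theta>) * miss_prob n"])
    fix x y z
    show "FSD_pert n \<theta> x y z = ?d (?ty x) (?ty y) z" by (simp add: FSD_pert_def)
  next
    fix s t z assume "s \<notin> ?A \<or> t \<notin> ?A"
    then show "?d s t z = 0" by (cases s; cases t) auto
  next
    fix \<phi> :: "decision \<times> nat \<Rightarrow> real"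
    assume \<phi>: "\<And>t. t \<notin> ?A \<Longrightarrow> \<phi> t = 0"
    then have S0: "\<phi> (Stay, a) = 0" for a by simp
    let ?I = "{1..n} - {i}"
    have inner: "(\<Sum>x'\<in>rounds n i'. pmf (round_law n \<theta> i') x' * N (Move, \<pi>) x') =
        (1 - \<theta>) / (m * fact (n - 2)) * (\<Sum>\<pi>'\<in>perms n i'. of_bool (no_match (n - 1) \<pi> \<pi>'))" if "\<pi> \<in> perms n i" for \<pi>
      unfolding sum_rounds using that i by (simp add: NS NM wM sum_distrib_left)
    have "(\<Sum>x\<in>rounds n i. pmf (round_law n \<theta> i) x *
          ((\<Sum>x'\<in>rounds n i'. pmf (round_law n \<theta> i') x' * N x x') * \<phi> (?ty x))) =
        (\<Sum>\<pi>\<in>perms n i. (1 - \<theta>) / (m * fact (n - 2)) *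
          ((1 - \<theta>) / (m * fact (n - 2)) * (\<Sum>\<pi>'\<in>perms n i'. of_bool (no_match (n - 1) \<pi> \<pi>')) * \<phi> (Move, \<pi> ! 0)))"
      using i(1) by (simp add: sum_rounds[of _ n i] S0 inner wM)
    also have "\<dots> = ((1 - \<theta>) / (m * fact (n - 2)))\<^sup>2 *
        (\<Sum>\<pi>\<in>perms n i. \<Sum>\<pi>'\<in>perms n i'. of_bool (no_match (n - 1) \<pi> \<pi>') * \<phi> (Move, \<pi> ! 0))"
    proof -
      have "(\<Sum>\<pi>\<in>P. K * (K * (\<Sum>\<pi>'\<in>P'. g \<pi> \<pi>') * h \<pi>)) = K\<^sup>2 * (\<Sum>\<pi>\<in>P. \<Sum>\<pi>'\<in>P'. g \<pi> \<pi>' * h \<pi>)"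
        for K :: real and P P' :: "nat list set" and g h
        by (simp add: sum_distrib_left sum_distrib_right power2_eq_square mult_ac)
      then show ?thesis .
    qed
    also have "(\<Sum>\<pi>\<in>perms n i. \<Sum>\<pi>'\<in>perms n i'. of_bool (no_match (n - 1) \<pi> \<pi>') * \<phi> (Move, \<pi> ! 0)) =
        (fact (n - 2))\<^sup>2 * (\<Sum>a\<in>?I. \<Sum>b\<in>{1..n} - {i'}. heads n i i' (n - 1) a b * \<phi> (Move, a))"
      using sum_no_match_heads[of i n i' "n - 1" "\<lambda>a b. \<phi> (Move, a)"] i n by simp
    also have "\<dots> = (fact (n - 2))\<^sup>2 * (\<Sum>a\<in>?I. m * miss_prob n * \<phi> (Move, a))"
      unfolding sum_distrib_right[symmetric] m_def
      by (intro arg_cong2[of _ _ _ _ "(*)"] refl sum.cong heads_row[OF i n])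
    also have "\<dots> = (fact (n - 2))\<^sup>2 * (m * miss_prob n) * (\<Sum>a\<in>?I. \<phi> (Move, a))"
      by (simp add: sum_distrib_left mult.assoc)
    also have "((1 - \<theta>) / (m * fact (n - 2)))\<^sup>2 * \<dots> =
        (1 - \<theta>) * miss_prob n * ((1 - \<theta>) / (m * fact (n - 2)) * (fact (n - 2) * (\<Sum>a\<in>?I. \<phi> (Move, a))))"
      using m(2) f0 by (simp add: power2_eq_square)
    also have "fact (n - 2) * (\<Sum>a\<in>?I. \<phi> (Move, a)) = (\<Sum>\<pi>\<in>perms n i. \<phi> (Move, \<pi> ! 0))"
      using sum_perms_head[of i n "\<lambda>a. \<phi> (Move, a)"] i(1) n by simp
    also have "(1 - \<theta>) / (m * fact (n - 2)) * \<dots> = (\<Sum>x\<in>rounds n i. pmf (round_law n \<theta> i) x * \<phi> (?ty x))"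
      unfolding sum_rounds using i(1) by (simp add: S0 wM sum_distrib_left)
    finally show "(\<Sum>x\<in>rounds n i. pmf (round_law n \<theta> i) x *
          ((\<Sum>x'\<in>rounds n i'. pmf (round_law n \<theta> i') x' * N x x') * \<phi> (?ty x))) =
        (1 - \<theta>) * miss_prob n * (\<Sum>x\<in>rounds n i. pmf (round_law n \<theta> i) x * \<phi> (?ty x))" .
  next
    fix z assume z: "z \<in> rounds n i"
    let ?w = "pmf (round_law n \<theta> i)"
    let ?I = "{1..n} - {i}"
    define f where "f = snd z ! 0"
    have f: "f \<in> ?I" using z i(1) n unfolding f_def rounds_def by (intro head_in) auto
    have cI: "card ?I = n - 1" using i(1) by (simp add: card_Diff_singleton)
    \<comment> \<open>The sum over the second round alone is already zero, by
      \<open>sum_pert\<close>.\<close>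
    have "(\<Sum>y\<in>rounds n i. ?w x * ?w y * FSD_pert n \<theta> x y z) = 0" if x: "x \<in> rounds n i" for x
    proof (cases "fst x = Move")
      case False
      then show ?thesis by (simp add: FSD_pert_def)
    next
      case True
      let ?a = "snd x ! 0"
      have a: "?a \<in> ?I" using x i(1) n unfolding rounds_def by (intro head_in) auto
      have "(\<Sum>y\<in>rounds n i. ?w x * ?w y * FSD_pert n \<theta> x y z) =
          (\<Sum>\<pi>\<in>perms n i. ?w x * ((1 - \<theta>) / (m * fact (n - 2))) * (of_bool (fst z = Move) *
            ((1 - \<theta>) / fact (n - 2) * pert m f ?a (\<pi> ! 0))))"
        unfolding sum_rounds using i(1) True by (simp add: FSD_pert_def wM m_def f_def)
      also have "\<dots> = ?w x * ((1 - \<theta>) / (m * fact (n - 2))) * (of_bool (fst z = Move) *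
            ((1 - \<theta>) / fact (n - 2) * (\<Sum>\<pi>\<in>perms n i. pert m f ?a (\<pi> ! 0))))"
        by (simp only: sum_distrib_left)
      also have "(\<Sum>\<pi>\<in>perms n i. pert m f ?a (\<pi> ! 0)) = fact (n - 2) * (\<Sum>b\<in>?I. pert m f ?a b)"
        using sum_perms_head[of i n "pert m f ?a"] i(1) n by simp
      also have "(\<Sum>b\<in>?I. pert m f ?a b) = 0"
        unfolding m_def using sum_pert[OF _ cI _ f a] n by (subst pert_commute) simp
      finally show ?thesis by simp
    qed
    then show "(\<Sum>x\<in>rounds n i. \<Sum>y\<in>rounds n i. ?w x * ?w y * FSD_pert n \<theta> x y z) = 0" by simp
  qed
qed

section \<open>Deviation of both players\<close>

lemma sum_Move_heads:
  assumes "s \<le> n - 1" "n \<ge> 4"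
  shows "(\<Sum>x\<in>rounds n 1. \<Sum>x'\<in>rounds n 2. of_bool (fst x = Move \<and> fst x' = Move) *
      (of_bool (apart n s [x] [x']) * H (snd x ! 0) (snd x' ! 0))) =
    (fact (n - 2))\<^sup>2 * (\<Sum>a\<in>{1..n} - {1}. \<Sum>b\<in>{1..n} - {2}. heads n 1 2 s a b * H a b)"
proof -
  have "(\<Sum>x\<in>rounds n 1. \<Sum>x'\<in>rounds n 2. of_bool (fst x = Move \<and> fst x' = Move) *
      (of_bool (apart n s [x] [x']) * H (snd x ! 0) (snd x' ! 0))) =
    (\<Sum>\<pi>\<in>perms n 1. \<Sum>\<pi>'\<in>perms n 2. of_bool (no_match s \<pi> \<pi>') * H (\<pi> ! 0) (\<pi>' ! 0))"
    unfolding sum_rounds using assms(1) by (simp add: apart_Move_Move)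
  also have "\<dots> = (fact (n - 2))\<^sup>2 * (\<Sum>a\<in>{1..n} - {1}. \<Sum>b\<in>{1..n} - {2}. heads n 1 2 s a b * H a b)"
    using assms(2) by (intro sum_no_match_heads) auto
  finally show ?thesis .
qed

text \<open>Each of the four early rounds contributes \<open>(1 - \<theta>) / m\<close>, for moving
  and for its first location. Each third round contributes only \<open>1 - \<theta>\<close>, since
  \<open>pert\<close> stands in place of \<open>1 / m\<close>.\<close>

lemma three_rounds_FSD_pert:
  assumes n: "n \<ge> 4" and \<theta>: "0 \<le> \<theta>" "\<theta> \<le> 1" and j: "j \<le> n - 1"
  shows "three_rounds (rounds n 1) (rounds n 2) (pmf (round_law n \<theta> 1)) (pmf (round_law n \<theta> 2))
      (\<lambda>x x'. of_bool (apart n (n - 1) [x] [x'])) (\<lambda>x x'. of_bool (apart n j [x] [x']))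
      (FSD_pert n \<theta>) (FSD_pert n \<theta>) = (1 - \<theta>) ^ 6 / real (n - 1) ^ 4 *
    (\<Sum>a\<in>{1..n} - {1}. \<Sum>a'\<in>{1..n} - {2}. heads n 1 2 (n - 1) a a' *
      (\<Sum>b\<in>{1..n} - {1}. \<Sum>b'\<in>{1..n} - {2}. heads n 1 2 (n - 1) b b' *
        (\<Sum>f\<in>{1..n} - {1}. \<Sum>f'\<in>{1..n} - {2}. heads n 1 2 j f f' *
          (pert (real (n - 1)) f a b * pert (real (n - 1)) f' a' b'))))"
proof -
  define m where "m = real (n - 1)"
  have m: "m > 2" "m \<noteq> 0" and fm: "(fact (n - 1) :: real) = m * fact (n - 2)"
    using n unfolding m_def by (auto simp: fact_reduce numeral_2_eq_2)
  have f0: "(fact (n - 2) :: real) \<noteq> 0" by simp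
  let ?F = "fact (n - 2) :: real"
  let ?I = "{1..n} - {1}" and ?I' = "{1..n} - {2 :: nat}"
  have wM: "pmf (round_law n \<theta> k) x = (1 - \<theta>) / (m * ?F)" if "k \<in> {1..n}" "x \<in> rounds n k" "fst x = Move" for k x
    using that \<theta> by (cases x) (simp add: rounds_def pmf_round_law pmf_decision_Move fm[unfolded One_nat_def])
  define Z where "Z a a' b b' = (\<Sum>f\<in>?I. \<Sum>f'\<in>?I'. heads n 1 2 j f f' * (pert m f a b * pert m f' a' b'))" for a a' b b'
  define Y where "Y a a' = (\<Sum>b\<in>?I. \<Sum>b'\<in>?I'. heads n 1 2 (n - 1) b b' * Z a a' b b')" for a a'
  let ?MM = "\<lambda>x x'. of_bool (fst x = Move \<and> fst x' = Move) :: real"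
  have third: "(\<Sum>z\<in>rounds n 1. \<Sum>z'\<in>rounds n 2. FSD_pert n \<theta> x y z * FSD_pert n \<theta> x' y' z' * of_bool (apart n j [z] [z'])) =
      ?MM x x' * ?MM y y' * ((1 - \<theta>)\<^sup>2 * Z (snd x ! 0) (snd x' ! 0) (snd y ! 0) (snd y' ! 0))" for x x' y y'
  proof -
    let ?P = "\<lambda>f f'. pert m f (snd x ! 0) (snd y ! 0) * pert m f' (snd x' ! 0) (snd y' ! 0)"
    have "(\<Sum>z\<in>rounds n 1. \<Sum>z'\<in>rounds n 2. FSD_pert n \<theta> x y z * FSD_pert n \<theta> x' y' z' * of_bool (apart n j [z] [z'])) =
      (\<Sum>z\<in>rounds n 1. \<Sum>z'\<in>rounds n 2. ?MM x x' * ?MM y y' * ((1 - \<theta>) / ?F)\<^sup>2 *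
         (?MM z z' * (of_bool (apart n j [z] [z']) * ?P (snd z ! 0) (snd z' ! 0))))"
      by (intro sum.cong refl) (auto simp: FSD_pert_def m_def power2_eq_square)
    also have "\<dots> = ?MM x x' * ?MM y y' * ((1 - \<theta>) / ?F)\<^sup>2 * (?F\<^sup>2 * Z (snd x ! 0) (snd x' ! 0) (snd y ! 0) (snd y' ! 0))"
      unfolding sum_distrib_left[symmetric] Z_def using sum_Move_heads[OF j n, of ?P] by (simp only:)
    finally show ?thesis using f0 by (simp add: power_divide)
  qed
  have pair: "(\<Sum>y\<in>rounds n 1. \<Sum>y'\<in>rounds n 2. pmf (round_law n \<theta> 1) y * pmf (round_law n \<theta> 2) y' *
      of_bool (apart n (n - 1) [y] [y']) * (K * ?MM y y' * H (snd y ! 0) (snd y' ! 0))) =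
      K * ((1 - \<theta>)\<^sup>2 / m\<^sup>2) * (\<Sum>b\<in>?I. \<Sum>b'\<in>?I'. heads n 1 2 (n - 1) b b' * H b b')" for K H
  proof -
    have "(\<Sum>y\<in>rounds n 1. \<Sum>y'\<in>rounds n 2. pmf (round_law n \<theta> 1) y * pmf (round_law n \<theta> 2) y' *
        of_bool (apart n (n - 1) [y] [y']) * (K * ?MM y y' * H (snd y ! 0) (snd y' ! 0))) =
      (\<Sum>y\<in>rounds n 1. \<Sum>y'\<in>rounds n 2. K * ((1 - \<theta>) / (m * ?F))\<^sup>2 *
        (?MM y y' * (of_bool (apart n (n - 1) [y] [y']) * H (snd y ! 0) (snd y' ! 0))))"
      using wM[of 1] wM[of 2] n by (intro sum.cong refl) (auto simp: power2_eq_square of_bool_def)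
    also have "\<dots> = K * ((1 - \<theta>) / (m * ?F))\<^sup>2 * (?F\<^sup>2 * (\<Sum>b\<in>?I. \<Sum>b'\<in>?I'. heads n 1 2 (n - 1) b b' * H b b'))"
      unfolding sum_distrib_left[symmetric] using sum_Move_heads[OF order_refl n, of H] by (simp only:)
    finally show ?thesis using f0 by (simp add: power_divide power_mult_distrib)
  qed
  have second: "(\<Sum>y\<in>rounds n 1. \<Sum>y'\<in>rounds n 2. pmf (round_law n \<theta> 1) y * pmf (round_law n \<theta> 2) y' *
      of_bool (apart n (n - 1) [y] [y']) *
      (?MM x x' * ?MM y y' * ((1 - \<theta>)\<^sup>2 * Z (snd x ! 0) (snd x' ! 0) (snd y ! 0) (snd y' ! 0)))) =
      (1 - \<theta>) ^ 4 / m\<^sup>2 * ?MM x x' * Y (snd x ! 0) (snd x' ! 0)" for x x'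
    using pair[of "?MM x x'" "\<lambda>b b'. (1 - \<theta>)\<^sup>2 * Z (snd x ! 0) (snd x' ! 0) b b'"]
    unfolding Y_def by (simp add: sum_distrib_left mult_ac power2_eq_square power4_eq_xxxx)
  have "three_rounds (rounds n 1) (rounds n 2) (pmf (round_law n \<theta> 1)) (pmf (round_law n \<theta> 2))
      (\<lambda>x x'. of_bool (apart n (n - 1) [x] [x'])) (\<lambda>x x'. of_bool (apart n j [x] [x']))
      (FSD_pert n \<theta>) (FSD_pert n \<theta>) =
    (1 - \<theta>) ^ 4 / m\<^sup>2 * ((1 - \<theta>)\<^sup>2 / m\<^sup>2) * (\<Sum>a\<in>?I. \<Sum>a'\<in>?I'. heads n 1 2 (n - 1) a a' * Y a a')"
    unfolding three_rounds_def third second by (rule pair)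
  also have "(1 - \<theta>) ^ 4 / m\<^sup>2 * ((1 - \<theta>)\<^sup>2 / m\<^sup>2) = (1 - \<theta>) ^ 6 / m ^ 4"
    by (simp add: power_add[symmetric])
  finally show ?thesis unfolding Y_def Z_def m_def .
qed

lemma three_rounds_cong:
  assumes "\<And>x y z. x \<in> X \<Longrightarrow> y \<in> X \<Longrightarrow> z \<in> X \<Longrightarrow> u x y z = v x y z"
    and "\<And>x y z. x \<in> Y \<Longrightarrow> y \<in> Y \<Longrightarrow> z \<in> Y \<Longrightarrow> u' x y z = v' x y z"
  shows "three_rounds X Y w w' N N' u u' = three_rounds X Y w w' N N' v v'"
  unfolding three_rounds_def using assms by (intro sum.cong refl arg_cong2[of _ _ _ _ "(*)"]) auto

lemma set_FSD:
  assumes "i \<in> {1..n}" "n \<ge> 4" "x \<in> rounds n i" "y \<in> rounds n i"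
  shows "set_pmf (FSD n \<theta> i 2 ((!) [x, y])) \<subseteq> rounds n i"
proof -
  have "FSD_perms n i x y c \<subseteq> perms n i" for c by (auto simp: FSD_perms_def)
  then show ?thesis
    using FSD_perms_ne[OF assms] unfolding FSD_def rounds_def by (auto split: if_splits)
qed

text \<open>Expanding both third-round laws around the uniform one gives four terms:
  \<open>AW\<close> itself, two with a single deviating player, which vanish, and the one
  displayed.\<close>

lemma apart_prob_FSD_AW:
  assumes n: "n \<ge> 4" and \<theta>: "0 \<le> \<theta>" "\<theta> \<le> 1"
  shows "apart_prob n (FSD n \<theta>) 3 (2 * (n - 1) + j) = apart_prob n (AW n \<theta>) 3 (2 * (n - 1) + j) +
    three_rounds (rounds n 1) (rounds n 2) (pmf (round_law n \<theta> 1)) (pmf (round_law n \<theta> 2))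
      (\<lambda>x x'. of_bool (apart n (n - 1) [x] [x'])) (\<lambda>x x'. of_bool (apart n j [x] [x']))
      (FSD_pert n \<theta>) (FSD_pert n \<theta>)"
proof -
  let ?T = "three_rounds (rounds n 1) (rounds n 2) (pmf (round_law n \<theta> 1)) (pmf (round_law n \<theta> 2))
      (\<lambda>x x'. of_bool (apart n (n - 1) [x] [x'])) (\<lambda>x x'. of_bool (apart n j [x] [x']))"
  let ?w = "\<lambda>_ _. pmf (round_law n \<theta> 1)" and ?w' = "\<lambda>_ _. pmf (round_law n \<theta> 2)"
  have n1: "0 < n - 1" using n by simp
  have A: "apart_prob n (AW n \<theta>) 3 (2 * (n - 1) + j) = ?T ?w ?w'"
    by (subst apart_prob_three_rounds[OF n1, of "AW n \<theta>" \<theta>]) (simp_all only: AW_eq set_round_law)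
  have "apart_prob n (FSD n \<theta>) 3 (2 * (n - 1) + j) =
     ?T (\<lambda>x y. pmf (FSD n \<theta> 1 2 ((!) [x, y]))) (\<lambda>x y. pmf (FSD n \<theta> 2 2 ((!) [x, y])))"
  proof (rule apart_prob_three_rounds[OF n1, of "FSD n \<theta>" \<theta>])
    fix i h x y
    show "FSD n \<theta> i 0 h = round_law n \<theta> i" "FSD n \<theta> i 1 h = round_law n \<theta> i"
      by (rule FSD_eq, simp del: One_nat_def)+
    assume "i \<in> {1, 2 :: nat}" "x \<in> rounds n i" "y \<in> rounds n i"
    then show "set_pmf (FSD n \<theta> i 2 ((!) [x, y])) \<subseteq> rounds n i"
      using n by (intro set_FSD) auto
  qed
  also have "\<dots> = ?T (\<lambda>x y z. ?w x y z + FSD_pert n \<theta> x y z) (\<lambda>x y z. ?w' x y z + FSD_pert n \<theta> x y z)"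
    using n \<theta> by (intro three_rounds_cong pmf_FSD) auto
  also have "\<dots> = ?T ?w ?w' + ?T (FSD_pert n \<theta>) ?w' + ?T ?w (FSD_pert n \<theta>) + ?T (FSD_pert n \<theta>) (FSD_pert n \<theta>)"
    by (simp only: three_rounds_add add.assoc)
  also have "?T (FSD_pert n \<theta>) ?w' = 0"
    using n \<theta> by (intro three_rounds_FSD_pert_eq_0) (auto simp: apart_Move_Move apart_Move_Stay[simplified])
  also have "?T ?w (FSD_pert n \<theta>) = 0"
    using n \<theta>
    by (subst three_rounds_swap, intro three_rounds_FSD_pert_eq_0)
       (auto simp: apart_Move_Move no_match_def apart_Stay_Move[simplified])
  finally show ?thesis unfolding A by simp
qed

text \<open>Moving the sum over the third first locations outermost exposes the correlation of the
  two deviations at fixed \<open>f\<close>, \<open>f'\<close>, so that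
  \<open>pert_correlation\<close> and then \<open>patterned_correlation\<close> apply. The primed
  values describe the whole-round table, the others the table for \<open>j\<close> steps.\<close>

lemma FSD_gain:
  assumes n: "n \<ge> 4" and \<theta>: "0 \<le> \<theta>" "\<theta> \<le> 1" and j: "j \<le> n - 1"
    and m: "m = real n - 1" and d: "d = miss_prob n"
    and P: "patterned 2 1 ({1..n} - {1, 2}) (heads n 1 2 j) \<alpha> \<beta> \<delta> \<gamma>"
    and Q: "patterned 2 1 ({1..n} - {1, 2}) (heads n 1 2 (n - 1)) \<alpha>' \<beta>' \<delta>' \<gamma>'"
  shows "apart_prob n (FSD n \<theta>) 3 (2 * (n - 1) + j) - apart_prob n (AW n \<theta>) 3 (2 * (n - 1) + j) =
    (1 - \<theta>) ^ 6 / (m\<^sup>2 * (m - 2)\<^sup>2) *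
     (((m - 1) * ((\<alpha>' - d)\<^sup>2 - 2 * (\<beta>' - d)\<^sup>2) + (\<delta>' - d)\<^sup>2 + (m - 2) * (\<gamma>' - d)\<^sup>2) *
       ((m - 1) * (\<alpha> - 2 * \<beta>) + \<delta> + (m - 2) * \<gamma>) / m\<^sup>2
      + (m - 2) * ((\<delta>' - d)\<^sup>2 - (\<gamma>' - d)\<^sup>2) * (\<delta> - \<gamma>))"
proof -
  have m': "real (n - 1) = m" "m > 2" using n unfolding m by auto
  let ?B = "{1..n} - {1, 2}"
  let ?I = "{1..n} - {1 :: nat}" and ?I' = "{1..n} - {2 :: nat}"
  have I: "?I = insert 2 ?B" "?I' = insert 1 ?B" using n by auto
  have cB: "real (card ?B) = m - 1" using n unfolding m by (simp add: card_Diff_subset of_nat_diff)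
  have cI: "card ?I = n - 1" "card ?I' = n - 1" using n by (auto simp: card_Diff_singleton)
  let ?V = "heads n 1 2 (n - 1)" and ?W = "heads n 1 2 j"
  let ?K = "\<lambda>f f' a a' b b'. pert m f a b * pert m f' a' b'"
  let ?e = "\<lambda>f a. of_bool (f = a) - 1 / m"
  have rows: "(\<Sum>b\<in>?I'. ?V a b) = real (n - 1) * d" if "a \<in> ?I" for a
    unfolding d using heads_row[of 1 n 2 a] n that by auto
  have sym: "heads n 1 2 (n - 1) a b = heads n 2 1 (n - 1) b a" for a b
  proof -
    have "no_match (n - 1) p q \<longleftrightarrow> no_match (n - 1) q p" for p q :: "nat list" by (auto simp: no_match_def eq_commute)
    then show ?thesis unfolding heads_def avg_def sum_divide_distrib by (subst sum.swap) (simp add: mult.commute)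
  qed
  have cols: "(\<Sum>a\<in>?I. ?V a b) = real (n - 1) * d" if "b \<in> ?I'" for b
    unfolding d sym using heads_row[of 2 n 1 b] n that by auto
  have corr: "(\<Sum>a\<in>?I. \<Sum>a'\<in>?I'. ?V a a' * (\<Sum>b\<in>?I. \<Sum>b'\<in>?I'. ?V b b' * ?K f f' a a' b b')) =
      (m / (m - 2))\<^sup>2 * (\<Sum>a\<in>?I. \<Sum>a'\<in>?I'. (?V a a' - d)\<^sup>2 * (?e f a * ?e f' a'))" if "f \<in> ?I" "f' \<in> ?I'" for f f'
    using pert_correlation[of ?I "n - 1" ?I' ?V d f f'] cI rows cols that n unfolding m'(1) by simp
  have "apart_prob n (FSD n \<theta>) 3 (2 * (n - 1) + j) - apart_prob n (AW n \<theta>) 3 (2 * (n - 1) + j) =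
     (1 - \<theta>) ^ 6 / m ^ 4 * (\<Sum>a\<in>?I. \<Sum>a'\<in>?I'. ?V a a' * (\<Sum>b\<in>?I. \<Sum>b'\<in>?I'. ?V b b' *
        (\<Sum>f\<in>?I. \<Sum>f'\<in>?I'. ?W f f' * ?K f f' a a' b b')))"
    unfolding apart_prob_FSD_AW[OF n \<theta>] three_rounds_FSD_pert[OF n \<theta> j] m' by simp
  also have "(\<Sum>a\<in>?I. \<Sum>a'\<in>?I'. ?V a a' * (\<Sum>b\<in>?I. \<Sum>b'\<in>?I'. ?V b b' *
        (\<Sum>f\<in>?I. \<Sum>f'\<in>?I'. ?W f f' * ?K f f' a a' b b'))) =
      (\<Sum>a\<in>?I. \<Sum>a'\<in>?I'. \<Sum>b\<in>?I. \<Sum>b'\<in>?I'. \<Sum>f\<in>?I. \<Sum>f'\<in>?I'. ?V a a' * ?V b b' * ?W f f' * ?K f f' a a' b b')"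
    by (simp only: sum_distrib_left mult.assoc)
  also have "\<dots> = (\<Sum>a\<in>?I. \<Sum>a'\<in>?I'. \<Sum>f\<in>?I. \<Sum>f'\<in>?I'. \<Sum>b\<in>?I. \<Sum>b'\<in>?I'. ?V a a' * ?V b b' * ?W f f' * ?K f f' a a' b b')"
    by (intro sum.cong refl sum_swap_pairs)
  also have "\<dots> = (\<Sum>f\<in>?I. \<Sum>f'\<in>?I'. \<Sum>a\<in>?I. \<Sum>a'\<in>?I'. \<Sum>b\<in>?I. \<Sum>b'\<in>?I'. ?V a a' * ?V b b' * ?W f f' * ?K f f' a a' b b')"
    by (rule sum_swap_pairs)
  also have "\<dots> = (\<Sum>f\<in>?I. \<Sum>f'\<in>?I'. ?W f f' *
      (\<Sum>a\<in>?I. \<Sum>a'\<in>?I'. ?V a a' * (\<Sum>b\<in>?I. \<Sum>b'\<in>?I'. ?V b b' * ?K f f' a a' b b')))"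
    by (simp only: sum_distrib_left mult_ac)
  also have "\<dots> = (\<Sum>f\<in>?I. \<Sum>f'\<in>?I'. ?W f f' *
      ((m / (m - 2))\<^sup>2 * (\<Sum>a\<in>?I. \<Sum>a'\<in>?I'. (?V a a' - d)\<^sup>2 * (?e f a * ?e f' a'))))"
    by (intro sum.cong refl arg_cong2[of _ _ _ _ "(*)"] corr)
  also have "\<dots> = (m / (m - 2))\<^sup>2 * (\<Sum>f\<in>?I. \<Sum>f'\<in>?I'. \<Sum>a\<in>?I. \<Sum>a'\<in>?I'. ?W f f' * ((?V a a' - d)\<^sup>2 * (?e f a * ?e f' a')))"
    by (simp only: sum_distrib_left mult_ac)
  also have "(\<Sum>f\<in>?I. \<Sum>f'\<in>?I'. \<Sum>a\<in>?I. \<Sum>a'\<in>?I'. ?W f f' * ((?V a a' - d)\<^sup>2 * (?e f a * ?e f' a'))) =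
     (\<Sum>a\<in>?I. \<Sum>a'\<in>?I'. \<Sum>f\<in>?I. \<Sum>f'\<in>?I'. ?W f f' * ((?V a a' - d)\<^sup>2 * (?e f a * ?e f' a')))"
    by (rule sum_swap_pairs)
  also have "\<dots> = (\<Sum>a\<in>?I. \<Sum>a'\<in>?I'. (?V a a' - d)\<^sup>2 * (\<Sum>f\<in>?I. \<Sum>f'\<in>?I'. ?W f f' * (?e f a * ?e f' a')))"
    by (simp only: sum_distrib_left mult_ac)
  also have "\<dots> = ((m - 1) * ((\<alpha>' - d)\<^sup>2 - 2 * (\<beta>' - d)\<^sup>2) + (\<delta>' - d)\<^sup>2 + (m - 2) * (\<gamma>' - d)\<^sup>2) *
       ((m - 1) * (\<alpha> - 2 * \<beta>) + \<delta> + (m - 2) * \<gamma>) / m\<^sup>2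
      + (m - 2) * ((\<delta>' - d)\<^sup>2 - (\<gamma>' - d)\<^sup>2) * (\<delta> - \<gamma>)" (is "_ = ?R")
  proof -
    have "patterned 2 1 ?B (\<lambda>a b. (?V a b - d)\<^sup>2) ((\<alpha>' - d)\<^sup>2) ((\<beta>' - d)\<^sup>2) ((\<delta>' - d)\<^sup>2) ((\<gamma>' - d)\<^sup>2)"
      using Q unfolding patterned_def by auto
    from patterned_correlation[OF this P cB] m'(2) show ?thesis unfolding I by simp
  qed
  also have "(1 - \<theta>) ^ 6 / m ^ 4 * ((m / (m - 2))\<^sup>2 * ?R) = (1 - \<theta>) ^ 6 / (m\<^sup>2 * (m - 2)\<^sup>2) * ?R"
  proof -
    have "(1 - \<theta>) ^ 6 / m ^ 4 * (m / (m - 2))\<^sup>2 = (1 - \<theta>) ^ 6 / (m\<^sup>2 * (m - 2)\<^sup>2)"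
      using m'(2) by (simp add: power_divide power4_eq_xxxx power2_eq_square)
    then show ?thesis by (simp only: mult.assoc[symmetric])
  qed
  finally show ?thesis .
qed

section \<open>Comparison of the expected meeting times\<close>

lemma causal_AW: "causal (AW n \<theta> i)"
  unfolding causal_def AW_eq by simp

lemma causal_FSD: "causal (FSD n \<theta> i)"
  unfolding causal_def
proof (intro allI impI)
  fix k and h h' :: "nat \<Rightarrow> round_data"
  assume a: "\<forall>i<k. h i = h' i"
  show "FSD n \<theta> i k h = FSD n \<theta> i k h'"
  proof (cases "3 dvd k + 1")
    case True
    then have "k \<ge> 2" by presburger
    then have "h (k - 2) = h' (k - 2)" "h (k - 1) = h' (k - 1)" using a by auto
    then show ?thesis by (simp only: FSD_def)
  qed (simp only: FSD_eq not_False_eq_True)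
qed

lemma periodic_AW: "periodic p (AW n \<theta> i)"
  unfolding periodic_def AW_eq by simp

lemma periodic_FSD: "periodic 3 (FSD n \<theta> i)"
  unfolding periodic_def
proof (intro allI)
  fix k :: nat and h :: "nat \<Rightarrow> round_data"
  have d: "3 dvd 3 + k + 1 \<longleftrightarrow> 3 dvd k + 1" by (simp only: add.assoc dvd_add_triv_left_iff)
  show "FSD n \<theta> i (3 + k) h = FSD n \<theta> i k (\<lambda>i. h (3 + i))"
  proof (cases "3 dvd k + 1")
    case True
    then have "k \<ge> 2" by presburger
    then have "3 + k - 2 = 3 + (k - 2)" "3 + k - 1 = 3 + (k - 1)" by auto
    then show ?thesis by (simp only: FSD_def d)
  next
    case False
    with d have "\<not> 3 dvd 3 + k + 1" by simp
    with False show ?thesis by (simp only: FSD_eq not_False_eq_True)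
  qed
qed

lemma history_FSD_AW: "k \<le> 2 \<Longrightarrow> history (FSD n \<theta> i) k = history (AW n \<theta> i) k"
proof (induction k)
  case (Suc k)
  from Suc.prems have "\<not> 3 dvd k + 1" by presburger
  with Suc show ?case by (simp only: history.simps FSD_eq AW_eq not_False_eq_True)
qed simp

text \<open>A mover and a stayer always meet within the round, so either both stay, or both move and
  miss each other.\<close>

lemma apart_prob_AW_1:
  assumes n: "n \<ge> 4" and \<theta>: "0 \<le> \<theta>" "\<theta> \<le> 1"
  shows "apart_prob n (AW n \<theta>) 1 (n - 1) = \<theta>\<^sup>2 + (1 - \<theta>)\<^sup>2 * miss_prob n"
proof -
  define m where "m = real (n - 1)"
  have m: "m \<noteq> 0" and fm: "(fact (n - 1) :: real) = m * fact (n - 2)"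
    using n unfolding m_def by (auto simp: fact_reduce numeral_2_eq_2)
  let ?F = "fact (n - 2) :: real"
  let ?R = "round_law n \<theta>"
  let ?f = "\<lambda>x x'. of_bool (apart n (n - 1) [x] [x']) :: real"
  have wM: "pmf (?R k) (Move, \<pi>) = (1 - \<theta>) / (m * ?F)" if "k \<in> {1..n}" "\<pi> \<in> perms n k" for k \<pi>
    using that \<theta> by (simp add: pmf_round_law pmf_decision_Move fm[unfolded One_nat_def])
  have wS: "pmf (?R k) (Stay, \<pi>) = \<theta> / (m * ?F)" if "k \<in> {1..n}" "\<pi> \<in> perms n k" for k \<pi>
    using that \<theta> by (simp add: pmf_round_law pmf_decision_Stay fm[unfolded One_nat_def])
  have SS: "apart n (n - 1) [(Stay, \<pi>)] [(Stay, \<pi>')]" for \<pi> \<pi>' by (simp add: apart_single)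
  have P: "pair_pmf (history (AW n \<theta> 1) 1) (history (AW n \<theta> 2) 1) =
      bind_pmf (?R 1) (\<lambda>x. bind_pmf (?R 2) (\<lambda>x'. return_pmf ([x], [x'])))"
    by (simp add: AW_eq pair_pmf_def map_pmf_def bind_assoc_pmf bind_return_pmf)
  have "apart_prob n (AW n \<theta>) 1 (n - 1) =
      measure_pmf.expectation (pair_pmf (history (AW n \<theta> 1) 1) (history (AW n \<theta> 2) 1))
        (indicator {x. apart n (n - 1) (fst x) (snd x)})"
    unfolding apart_prob_def by simp
  also have "\<dots> = (\<Sum>x\<in>rounds n 1. \<Sum>x'\<in>rounds n 2. pmf (?R 1) x * pmf (?R 2) x' * ?f x x')"
    unfolding P by (subst expectation_bind_bind[OF finite_rounds finite_rounds set_round_law set_round_law])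
      (auto simp: indicator_def)
  also have "\<dots> = (\<Sum>\<pi>\<in>perms n 1. \<Sum>\<pi>'\<in>perms n 2. (\<theta> / (m * ?F))\<^sup>2) +
      (\<Sum>\<pi>\<in>perms n 1. \<Sum>\<pi>'\<in>perms n 2. ((1 - \<theta>) / (m * ?F))\<^sup>2 * (of_bool (no_match (n - 1) \<pi> \<pi>') * 1))"
    unfolding sum_rounds using n
    by (simp add: wM wS SS[simplified] apart_Move_Stay[simplified] apart_Stay_Move[simplified] apart_Move_Move power2_eq_square)
  also have "(\<Sum>\<pi>\<in>perms n 1. \<Sum>\<pi>'\<in>perms n 2. (\<theta> / (m * ?F))\<^sup>2) = \<theta>\<^sup>2"
    using n m by (simp add: card_perms fm[unfolded One_nat_def] power2_eq_square)
  also have "(\<Sum>\<pi>\<in>perms n 1. \<Sum>\<pi>'\<in>perms n 2. ((1 - \<theta>) / (m * ?F))\<^sup>2 * (of_bool (no_match (n - 1) \<pi> \<pi>') * 1)) =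
      ((1 - \<theta>) / (m * ?F))\<^sup>2 * (?F\<^sup>2 * (\<Sum>a\<in>{1..n} - {1}. \<Sum>b\<in>{1..n} - {2}. heads n 1 2 (n - 1) a b * 1))"
    unfolding sum_distrib_left[symmetric] using n by (subst sum_no_match_heads) auto
  also have "(\<Sum>a\<in>{1..n} - {1}. \<Sum>b\<in>{1..n} - {2}. heads n 1 2 (n - 1) a b * 1) = (\<Sum>a\<in>{1..n} - {1}. m * miss_prob n)"
    unfolding mult_1_right m_def using n by (intro sum.cong refl heads_row) auto
  also have "\<dots> = m * (m * miss_prob n)"
    using n by (simp add: card_Diff_singleton m_def)
  also have "((1 - \<theta>) / (m * ?F))\<^sup>2 * (?F\<^sup>2 * (m * (m * miss_prob n))) = (1 - \<theta>)\<^sup>2 * miss_prob n"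
    using m by (simp add: power2_eq_square)
  finally show ?thesis .
qed

text \<open>\<open>AW\<close> has period 1, so its three rounds are independent copies of
  one.\<close>

lemma apart_prob_AW_3:
  assumes n: "n \<ge> 4" and \<theta>: "0 \<le> \<theta>" "\<theta> \<le> 1"
  shows "apart_prob n (AW n \<theta>) 3 (3 * (n - 1)) = (\<theta>\<^sup>2 + (1 - \<theta>)\<^sup>2 * miss_prob n) ^ 3"
proof -
  have n1: "0 < n - 1" using n by simp
  have step: "apart_prob n (AW n \<theta>) (1 + k) (1 * (n - 1) + s) = apart_prob n (AW n \<theta>) 1 (1 * (n - 1)) * apart_prob n (AW n \<theta>) k s" for k s
    by (rule apart_prob_add[OF periodic_AW periodic_AW n1])
  have "3 * (n - 1) = 1 * (n - 1) + (1 * (n - 1) + (n - 1))" "(3 :: nat) = 1 + (1 + 1)" by auto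
  then have "apart_prob n (AW n \<theta>) 3 (3 * (n - 1)) = apart_prob n (AW n \<theta>) 1 (n - 1) ^ 3"
    unfolding power3_eq_cube using step[of "1 + 1" "1 * (n - 1) + (n - 1)"] step[of 1 "n - 1"] by (simp only: mult_1 mult.assoc)
  then show ?thesis by (simp only: apart_prob_AW_1[OF n \<theta>])
qed

text \<open>The upper bound combines \<open>n / (n - 1) \<le> 4 / 3\<close> with the derangement
  bound \<open>3 / 8\<close>; it is attained at \<open>n = 4\<close>.\<close>

lemma miss_prob_bounds:
  assumes "n \<ge> 4"
  shows "0 < miss_prob n" "miss_prob n \<le> 1 / 2"
proof -
  have d: "0 < derange n" "derange n \<le> 3 / 8" using derange_bounds[OF assms] by auto
  have n: "real n \<ge> 4" using assms by simp
  show "0 < miss_prob n" unfolding miss_prob_def using d n by simp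
  have "real n * derange n \<le> real n * (3 / 8)" using d n by (intro mult_left_mono) auto
  also have "\<dots> \<le> 1 / 2 * (real n - 1)" using n by simp
  finally have "real n * derange n \<le> 1 / 2 * (real n - 1)" .
  then show "miss_prob n \<le> 1 / 2" unfolding miss_prob_def using n by (simp only: pos_divide_le_eq)
qed

text \<open>The ratio of the geometric series: \<open>\<theta> < 1\<close> is what makes the
  expectation finite.\<close>

lemma apart_prob_AW_less_1:
  assumes n: "n \<ge> 4" and \<theta>: "0 \<le> \<theta>" "\<theta> < 1"
  shows "apart_prob n (AW n \<theta>) 3 (3 * (n - 1)) < 1"
proof -
  let ?q = "\<theta>\<^sup>2 + (1 - \<theta>)\<^sup>2 * miss_prob n"
  have "(1 - \<theta>)\<^sup>2 * miss_prob n \<le> (1 - \<theta>) * (1 / 2)"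
    using miss_prob_bounds[OF n] \<theta> by (intro mult_mono) (auto simp: power2_eq_square mult_left_le)
  moreover have "\<theta>\<^sup>2 \<le> \<theta>" using \<theta> by (simp add: power2_eq_square mult_left_le)
  ultimately have "?q < 1" using \<theta> by (simp add: field_simps)
  moreover have "0 \<le> ?q" using miss_prob_bounds(1)[OF n] by simp
  ultimately have "?q ^ 3 < 1 ^ 3" by (intro power_strict_mono) auto
  then show ?thesis by (simp only: apart_prob_AW_3[OF n \<theta>(1) less_imp_le[OF \<theta>(2)]] power_one)
qed

definition survival_sum :: "nat \<Rightarrow> strategy \<Rightarrow> real" where
  "survival_sum n \<sigma> = (\<Sum>s<3 * (n - 1). apart_prob n \<sigma> (s div (n - 1) + 1) s)"

text \<open>The first two rounds have the same law under both strategies, so only times of the third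
  round can differ.\<close>

lemma survival_sum_diff:
  assumes "n \<ge> 4"
  shows "survival_sum n (FSD n \<theta>) - survival_sum n (AW n \<theta>) =
    (\<Sum>j<n - 1. apart_prob n (FSD n \<theta>) 3 (2 * (n - 1) + j) - apart_prob n (AW n \<theta>) 3 (2 * (n - 1) + j))"
proof -
  let ?m = "n - 1"
  let ?f = "\<lambda>s. apart_prob n (FSD n \<theta>) (s div ?m + 1) s - apart_prob n (AW n \<theta>) (s div ?m + 1) s"
  have early: "?f s = 0" if "s < 2 * ?m" for s
  proof -
    have "s div ?m < 2" using that assms by (subst div_less_iff_less_mult) auto
    then have "s div ?m + 1 \<le> 2" by simp
    then show ?thesis unfolding apart_prob_def by (simp only: history_FSD_AW diff_self)
  qed
  have late: "(2 * ?m + j) div ?m + 1 = 3" if "j < ?m" for j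
    using that assms by (simp add: div_mult_self3)
  have split: "sum g {..<a + b} = sum g {..<a} + (\<Sum>j<b. g (a + j))" for g :: "nat \<Rightarrow> real" and a b
    by (induction b) auto
  have "survival_sum n (FSD n \<theta>) - survival_sum n (AW n \<theta>) = sum ?f {..<3 * ?m}"
    by (simp only: survival_sum_def sum_subtractf)
  also have "3 * ?m = 2 * ?m + ?m" by simp
  also have "sum ?f {..<2 * ?m + ?m} = (\<Sum>j<?m. ?f (2 * ?m + j))"
    unfolding split using early by simp
  also have "\<dots> = (\<Sum>j<?m. apart_prob n (FSD n \<theta>) 3 (2 * ?m + j) - apart_prob n (AW n \<theta>) 3 (2 * ?m + j))"
    using late by (intro sum.cong refl) (simp only: lessThan_iff)
  finally show ?thesis .
qed

lemma expected_meeting_time_rounds: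
  assumes "n \<ge> 4" "\<sigma> = AW n \<theta> \<or> \<sigma> = FSD n \<theta>" "apart_prob n \<sigma> 3 (3 * (n - 1)) < 1"
  shows "expected_meeting_time n \<sigma> = ennreal (survival_sum n \<sigma> / (1 - apart_prob n \<sigma> 3 (3 * (n - 1))))"
  unfolding survival_sum_def
  using assms causal_AW causal_FSD periodic_AW periodic_FSD
  by (intro expected_meeting_time_periodic) auto


section \<open>Change of the survival probabilities in the third round\<close>

lemma apart_prob_late_eq:
  assumes n: "n \<ge> 4" and \<theta>: "0 \<le> \<theta>" "\<theta> \<le> 1"
  shows "apart_prob n (FSD n \<theta>) 3 (2 * (n - 1) + 0) = apart_prob n (AW n \<theta>) 3 (2 * (n - 1) + 0)"
proof -
  let ?B = "{1..n} - {1, 2}"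
  have "heads n 1 2 0 a b = 1" for a b by (simp add: heads_def avg_def no_match_def)
  then have P: "patterned 2 1 ?B (heads n 1 2 0) 1 1 1 1" unfolding patterned_def by auto
  have Q: "patterned 2 1 ?B (heads n 1 2 (n - 1)) (avoid (n - 2) (real n - 2) (real n - 2))
      (avoid (n - 2) (real n - 2) (real n - 3)) 0 (avoid (n - 2) (real n - 2) (real n - 4))"
    using heads_patterned[of 1 n 2 "n - 2"] n by (simp add: Suc_diff_Suc numeral_2_eq_2)
  show ?thesis using FSD_gain[OF n \<theta> _ refl refl P Q] by simp
qed

text \<open>\<open>Suc j\<close> because the first step is decided by the first locations
  themselves; the entry for equal locations is therefore 0 in both tables.\<close>

lemma apart_prob_late:
  assumes n: "n \<ge> 4" and \<theta>: "0 \<le> \<theta>" "\<theta> \<le> 1" and j: "j \<le> n - 2"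
  shows "apart_prob n (FSD n \<theta>) 3 (2 * (n - 1) + Suc j) - apart_prob n (AW n \<theta>) 3 (2 * (n - 1) + Suc j) =
    (1 - \<theta>) ^ 6 / ((real n - 1)\<^sup>2 * (real n - 3)\<^sup>2) *
     (((real n - 2) * ((avoid (n - 2) (real n - 2) (real n - 2) - miss_prob n)\<^sup>2
          - 2 * (avoid (n - 2) (real n - 2) (real n - 3) - miss_prob n)\<^sup>2)
        + (miss_prob n)\<^sup>2 + (real n - 3) * (avoid (n - 2) (real n - 2) (real n - 4) - miss_prob n)\<^sup>2) *
       ((real n - 2) * (avoid j (real n - 2) (real n - 2) - 2 * avoid j (real n - 2) (real n - 3))
         + (real n - 3) * avoid j (real n - 2) (real n - 4)) / (real n - 1)\<^sup>2
      - (real n - 3) * ((miss_prob n)\<^sup>2 - (avoid (n - 2) (real n - 2) (real n - 4) - miss_prob n)\<^sup>2) *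
         avoid j (real n - 2) (real n - 4))"
proof -
  let ?B = "{1..n} - {1, 2}"
  have P: "patterned 2 1 ?B (heads n 1 2 (Suc j)) (avoid j (real n - 2) (real n - 2))
      (avoid j (real n - 2) (real n - 3)) 0 (avoid j (real n - 2) (real n - 4))"
    using heads_patterned[of 1 n 2 j] n j by simp
  have Q: "patterned 2 1 ?B (heads n 1 2 (n - 1)) (avoid (n - 2) (real n - 2) (real n - 2))
      (avoid (n - 2) (real n - 2) (real n - 3)) 0 (avoid (n - 2) (real n - 2) (real n - 4))"
    using heads_patterned[of 1 n 2 "n - 2"] n by (simp add: Suc_diff_Suc numeral_2_eq_2)
  have j': "Suc j \<le> n - 1" using j n by simp
  have eqs: "real n - 1 - 1 = real n - 2" "real n - 1 - 2 = real n - 3" by simp_all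
  show ?thesis unfolding FSD_gain[OF n \<theta> j' refl refl P Q] eqs by simp
qed

text \<open>Here \<open>u\<close> is the deviation from the mean \<open>d\<close> for two distinct first locations other than the homes.\<close>

lemma apart_prob_late_le:
  assumes n: "n \<ge> 4" and \<theta>: "0 \<le> \<theta>" "\<theta> \<le> 1" and j: "j \<le> n - 2"
    and m: "m = real n - 1" and d: "d = miss_prob n"
    and u: "u = ((m - 2) * d + derange (n - 2)) / ((m - 1) * (m - 2))"
  shows "apart_prob n (FSD n \<theta>) 3 (2 * (n - 1) + Suc j) - apart_prob n (AW n \<theta>) 3 (2 * (n - 1) + Suc j)
    \<le> - ((1 - \<theta>) ^ 6 * (d\<^sup>2 - u\<^sup>2) * avoid j (m - 1) (m - 3) / (m\<^sup>2 * (m - 2)))"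
proof -
  let ?B = "{1..n} - {1, 2}"
  have n': "real (n - 2) = m - 1" "real n - 2 = m - 1" "real n - 3 = m - 2" "real n - 4 = m - 3" "m \<ge> 3"
    using n unfolding m by (auto simp: of_nat_diff)
  define \<alpha> \<beta> \<gamma> where "\<alpha> = avoid (n - 2) (m - 1) (m - 1)" and "\<beta> = avoid (n - 2) (m - 1) (m - 2)"
    and "\<gamma> = avoid (n - 2) (m - 1) (m - 3)"
  have \<alpha>: "\<alpha> = derange (n - 2)" unfolding \<alpha>_def derange_def n'(1) ..
  have Q: "patterned 2 1 ?B (heads n 1 2 (n - 1)) \<alpha> \<beta> 0 \<gamma>"
    using heads_patterned[of 1 n 2 "n - 2"] n unfolding \<alpha>_def \<beta>_def \<gamma>_def n'
    by (simp add: Suc_diff_Suc numeral_2_eq_2)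
  have I: "{1..n} - {1} = insert 2 ?B" "{1..n} - {2 :: nat} = insert 1 ?B" using n by auto
  have cB: "real (card ?B) = m - 1" using n unfolding m by (simp add: card_Diff_subset of_nat_diff)
  have rm: "real (n - 1) = m" using n unfolding m by (simp add: of_nat_diff)
  \<comment> \<open>The constant row sums determine \<open>\<beta>\<close> and
    \<open>\<gamma>\<close> from \<open>\<alpha>\<close> and \<open>d\<close>; eliminating
    \<open>\<beta>\<close> gives the formula for \<open>u\<close>.\<close>
  have r1: "\<alpha> + (m - 1) * \<beta> = m * d"
    using patterned_row(1)[OF Q] heads_row[of 1 n 2 2] n unfolding I cB rm d by simp
  have "3 \<in> ?B" "(3 :: nat) \<in> {1..n} - {1}" using n by auto
  then have r2: "\<beta> + (m - 2) * \<gamma> = m * d"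
    using patterned_row(2)[OF Q, of 3] heads_row[of 1 n 2 3] n unfolding I cB rm d by simp
  have "(\<gamma> - d) * ((m - 1) * (m - 2)) = (m - 2) * d + \<alpha>"
    using r1 r2 by algebra
  moreover have "(m - 1) * (m - 2) \<noteq> 0" using n' by simp
  ultimately have u': "\<gamma> - d = u" unfolding u \<alpha>[symmetric] by (metis nonzero_eq_divide_eq)
  \<comment> \<open>The deviations in the private row sum to zero, so the one at
    \<open>\<alpha>\<close> is \<open>m - 1 \<ge> 2\<close> times that at \<open>\<beta>\<close> in
    absolute value.\<close>
  have "(m - 1) * (\<beta> - d) = d - \<alpha>" using r1 by algebra
  then have b: "(m - 1)\<^sup>2 * (\<beta> - d)\<^sup>2 = (\<alpha> - d)\<^sup>2"
    by (metis power_mult_distrib power2_commute)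
  have "2 ^ 2 \<le> (m - 1)\<^sup>2" using n' by (intro power_mono) auto
  then have "2 * (\<beta> - d)\<^sup>2 \<le> (m - 1)\<^sup>2 * (\<beta> - d)\<^sup>2" by (intro mult_right_mono) auto
  then have "0 \<le> (\<alpha> - d)\<^sup>2 - 2 * (\<beta> - d)\<^sup>2" unfolding b by simp
  then have A: "0 \<le> (m - 1) * ((\<alpha> - d)\<^sup>2 - 2 * (\<beta> - d)\<^sup>2) + d\<^sup>2 + (m - 2) * (\<gamma> - d)\<^sup>2" (is "0 \<le> ?A")
    using n' by (intro add_nonneg_nonneg mult_nonneg_nonneg) auto
  let ?C = "(m - 1) * (avoid j (m - 1) (m - 1) - 2 * avoid j (m - 1) (m - 2)) + (m - 2) * avoid j (m - 1) (m - 3)"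
  have C: "?C \<le> 0"
    using avoid_contrast[of "n - 2" j] n j unfolding n' by (simp add: algebra_simps)
  have "apart_prob n (FSD n \<theta>) 3 (2 * (n - 1) + Suc j) - apart_prob n (AW n \<theta>) 3 (2 * (n - 1) + Suc j) =
     (1 - \<theta>) ^ 6 / (m\<^sup>2 * (m - 2)\<^sup>2) * (?A * ?C / m\<^sup>2 - (m - 2) * (d\<^sup>2 - u\<^sup>2) * avoid j (m - 1) (m - 3))"
    unfolding apart_prob_late[OF n \<theta> j] u'[symmetric] \<alpha>_def \<beta>_def \<gamma>_def d m[symmetric] n'(2-4) ..
  also have "\<dots> \<le> (1 - \<theta>) ^ 6 / (m\<^sup>2 * (m - 2)\<^sup>2) * (0 - (m - 2) * (d\<^sup>2 - u\<^sup>2) * avoid j (m - 1) (m - 3))"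
    using A C \<theta> n' by (intro mult_left_mono diff_mono order_refl divide_nonpos_nonneg mult_nonneg_nonpos) auto
  also have "\<dots> = - ((1 - \<theta>) ^ 6 * (d\<^sup>2 - u\<^sup>2) * avoid j (m - 1) (m - 3) / (m\<^sup>2 * (m - 2)))"
    using n' by (simp add: power2_eq_square)
  finally show ?thesis .
qed


text \<open>The factor \<open>1 + avoid 1 (m - 1) (m - 3)\<close> collects \<open>j = 0\<close> and
  \<open>j = 1\<close>, the only times kept in the final bound; dividing by
  \<open>m^8 (m - 2)\<close> turns the second claim into that bound.\<close>

lemma late_coefficient_ge:
  assumes n: "n \<ge> 5" and m: "m = real n - 1" and d: "d = miss_prob n"
    and u: "u = ((m - 2) * d + derange (n - 2)) / ((m - 1) * (m - 2))"
  shows "0 \<le> d\<^sup>2 - u\<^sup>2" "483 * (m - 2) \<le> (d\<^sup>2 - u\<^sup>2) * (1 + avoid 1 (m - 1) (m - 3)) * m ^ 6"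
proof -
  have avoid1: "avoid 1 (m - 1) (m - 3) = 1 - (m - 3) / (m - 1)\<^sup>2" by simp
  have "0 \<le> d\<^sup>2 - u\<^sup>2 \<and> 483 * (m - 2) \<le> (d\<^sup>2 - u\<^sup>2) * (1 + avoid 1 (m - 1) (m - 3)) * m ^ 6"
  \<comment> \<open>For \<open>n = 5\<close> the value \<open>derange 3\<close> is outside the range
    of \<open>derange_bounds\<close>, so exact values are inserted.\<close>
  proof (cases "n = 5")
    case True
    then have m4: "m = 4" and d5: "d = 11 / 24" and p3: "derange (n - 2) = 1 / 3"
      unfolding m d miss_prob_def by (simp_all add: derange_5 derange_3)
    have u5: "u = 5 / 24" unfolding u m4 d5 p3 by simp
    show ?thesis unfolding avoid1 m4 d5 u5 by (simp add: power2_eq_square)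
  next
    case False
    then have n6: "n \<ge> 6" and m5: "m \<ge> 5" using n unfolding m by auto
    have n2: "4 \<le> n - 2" using n6 by simp
    have p: "11 / 30 \<le> derange n" and a: "0 \<le> derange (n - 2)" "derange (n - 2) \<le> 3 / 8"
      using derange_bounds[of n] derange_bounds[OF n2] n6 by auto
    have "11 / 30 * m \<le> derange n * (m + 1)" using p m5 by (intro mult_mono) auto
    then have d1: "11 / 30 \<le> d" unfolding d miss_prob_def m[symmetric] using m5 m
      by (simp add: pos_le_divide_eq mult.commute)
    have u_eq: "u = d / (m - 1) + derange (n - 2) / ((m - 1) * (m - 2))"
      unfolding u using m5 by (simp add: add_divide_distrib)
    have "d / (m - 1) \<le> d / 4" using d1 m5 by (intro divide_left_mono) auto
    moreover have "derange (n - 2) / ((m - 1) * (m - 2)) \<le> (3 / 8) / (4 * 3)"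
      using a m5 by (intro frac_le mult_mono) auto
    ultimately have u1: "u \<le> d / 4 + 1 / 32" unfolding u_eq by linarith
    have u0: "0 \<le> u" unfolding u_eq using a d1 m5 by (intro add_nonneg_nonneg divide_nonneg_nonneg) auto
    \<comment> \<open>\<open>d - u \<ge> 3 d / 4 - 1 / 32 \<ge> 39 / 160\<close>, and
      \<open>d + u \<ge> d \<ge> 11 / 30\<close>.\<close>
    have "(39 / 160) * (11 / 30) \<le> (d - u) * (d + u)"
      using d1 u1 u0 by (intro mult_mono) auto
    then have du: "1 / 12 \<le> d\<^sup>2 - u\<^sup>2" by (simp add: power2_eq_square algebra_simps)
    \<comment> \<open>The quotient \<open>(m - 3) / (m - 1)^2\<close> is largest at
      \<open>m = 5\<close>, where it equals \<open>1 / 8\<close>.\<close>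
    have "0 \<le> (m - 5)\<^sup>2" by simp
    then have "8 * (m - 3) \<le> (m - 1)\<^sup>2" by (simp add: power2_eq_square algebra_simps)
    then have "(m - 3) / (m - 1)\<^sup>2 \<le> 1 / 8" using m5 by (simp add: pos_divide_le_eq)
    then have g: "15 / 8 \<le> 1 + avoid 1 (m - 1) (m - 3)" unfolding avoid1 by simp
    have "(1 / 12) * (15 / 8) * (625 * m\<^sup>2) \<le> (d\<^sup>2 - u\<^sup>2) * (1 + avoid 1 (m - 1) (m - 3)) * m ^ 6"
    proof -
      have "5 ^ 4 \<le> m ^ 4" using m5 by (intro power_mono) auto
      then have "5 ^ 4 * m\<^sup>2 \<le> m ^ 4 * m\<^sup>2" by (intro mult_right_mono) auto
      then have "625 * m\<^sup>2 \<le> m ^ 6" by (simp add: power_add[symmetric])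
      moreover have "(1 / 12) * (15 / 8) * (625 * m\<^sup>2) \<le> X * Y * Z"
        if "1 / 12 \<le> X" "15 / 8 \<le> Y" "625 * m\<^sup>2 \<le> Z" for X Y Z :: real
        using that by (intro mult_mono mult_nonneg_nonneg) auto
      ultimately show ?thesis using du g by blast
    qed
    moreover have "483 * (m - 2) \<le> (1 / 12) * (15 / 8) * (625 * m\<^sup>2)"
    proof -
      \<comment> \<open>The tangent of \<open>m^2\<close> at \<open>5 / 2\<close> reduces the
        comparison to a linear one.\<close>
      have "0 \<le> (m - 5 / 2)\<^sup>2" by simp
      then have "5 * m \<le> m\<^sup>2 + 25 / 4" by (simp add: power2_eq_square algebra_simps)
      then show ?thesis using m5 by simp
    qed
    ultimately have "483 * (m - 2) \<le> (d\<^sup>2 - u\<^sup>2) * (1 + avoid 1 (m - 1) (m - 3)) * m ^ 6"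
      by (rule order_trans[rotated])
    moreover have "0 \<le> d\<^sup>2 - u\<^sup>2" using du by linarith
    ultimately show ?thesis by blast
  qed
  then show "0 \<le> d\<^sup>2 - u\<^sup>2" "483 * (m - 2) \<le> (d\<^sup>2 - u\<^sup>2) * (1 + avoid 1 (m - 1) (m - 3)) * m ^ 6" by blast+
qed

text \<open>At \<open>n = 4\<close> one has \<open>u = d = 1 / 2\<close>, so
  \<open>apart_prob_late_le\<close> only gives the bound 0 and the exact formula is evaluated
  instead. The whole change comes from the first coordinates: \<open>1 / 2\<close> for the squared
  deviations against \<open>-1\<close>, \<open>-1\<close>, \<open>0\<close> for
  \<open>j = 0, 1, 2\<close>.\<close>

lemma apart_prob_late_4:
  assumes \<theta>: "0 \<le> \<theta>" "\<theta> \<le> 1"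
  shows "apart_prob 4 (FSD 4 \<theta>) 3 7 - apart_prob 4 (AW 4 \<theta>) 3 7 = - ((1 - \<theta>) ^ 6 / 162)"
    and "apart_prob 4 (FSD 4 \<theta>) 3 8 - apart_prob 4 (AW 4 \<theta>) 3 8 = - ((1 - \<theta>) ^ 6 / 162)"
    and "apart_prob 4 (FSD 4 \<theta>) 3 9 = apart_prob 4 (AW 4 \<theta>) 3 9"
proof -
  have d: "miss_prob 4 = 1 / 2" by (simp add: miss_prob_def derange_4)
  note late = apart_prob_late[of 4 \<theta>, OF order_refl \<theta>, unfolded d]
  show "apart_prob 4 (FSD 4 \<theta>) 3 7 - apart_prob 4 (AW 4 \<theta>) 3 7 = - ((1 - \<theta>) ^ 6 / 162)"
    using late[of 0] by (simp add: numeral_2_eq_2 power2_eq_square)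
  show "apart_prob 4 (FSD 4 \<theta>) 3 8 - apart_prob 4 (AW 4 \<theta>) 3 8 = - ((1 - \<theta>) ^ 6 / 162)"
    using late[of 1] by (simp add: numeral_2_eq_2 power2_eq_square)
  show "apart_prob 4 (FSD 4 \<theta>) 3 9 = apart_prob 4 (AW 4 \<theta>) 3 9"
    using late[of 2] by (simp add: numeral_2_eq_2 power2_eq_square)
qed

text \<open>A smaller block sum and a smaller ratio both help; the gain from the ratio and the
  factor \<open>1 / (1 - q) \<ge> 1\<close> are given away.\<close>

lemma quotient_diff_ge:
  fixes A A' q q' :: real
  assumes "A' \<le> A" "q' \<le> q" "0 \<le> A'" "0 \<le> q" "q < 1"
  shows "A - A' \<le> A / (1 - q) - A' / (1 - q')"
proof -
  have "A' / (1 - q') \<le> A' / (1 - q)" using assms by (intro divide_left_mono) auto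
  moreover have "A - A' \<le> (A - A') / (1 - q)"
    using assms mult_left_le[of "1 - q" "A - A'"] by (simp add: pos_le_divide_eq)
  ultimately show ?thesis by (simp add: diff_divide_distrib)
qed

theorem theorem2:
  fixes n :: nat and \<theta> :: real
  assumes "n \<ge> 4" and "0 \<le> \<theta>" and "\<theta> < 1"
  shows "expected_meeting_time n (AW n \<theta>) < \<infinity> \<and>
    expected_meeting_time n (FSD n \<theta>) < expected_meeting_time n (AW n \<theta>) \<and>
    (n = 4 \<longrightarrow>
      enn2real (expected_meeting_time n (AW n \<theta>)) - enn2real (expected_meeting_time n (FSD n \<theta>)) =
        8 * (1 - \<theta>) ^ 6 / (81 * (8 - (3 * \<theta>\<^sup>2 - 2 * \<theta> + 1) ^ 3))) \<and>
    (n \<ge> 5 \<longrightarrow>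
      enn2real (expected_meeting_time n (AW n \<theta>)) - enn2real (expected_meeting_time n (FSD n \<theta>))
        \<ge> 483 * (1 - \<theta>) ^ 6 / (real n - 1) ^ 8)"
proof -
  let ?P = "\<lambda>\<sigma>. apart_prob n \<sigma> 3" and ?AW = "AW n \<theta>" and ?FSD = "FSD n \<theta>" and ?m = "n - 1"
  have \<theta>: "0 \<le> \<theta>" "\<theta> \<le> 1" using assms by auto
  define A A' where "A = survival_sum n ?AW" and "A' = survival_sum n ?FSD"
  define q q' where "q = ?P ?AW (3 * ?m)" and "q' = ?P ?FSD (3 * ?m)"
  define c where "c = (1 - \<theta>) ^ 6"
  have c: "c > 0" using assms unfolding c_def by simp
  have q: "0 \<le> q" "q < 1"
    using apart_prob_AW_less_1[OF assms] unfolding q_def by (auto simp: apart_prob_def)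
  have A'0: "0 \<le> A'" "0 \<le> q'" unfolding A'_def q'_def survival_sum_def apart_prob_def by (auto intro: sum_nonneg)
  have diff: "A - A' = (\<Sum>j<?m. ?P ?AW (2 * ?m + j) - ?P ?FSD (2 * ?m + j))"
    using survival_sum_diff[OF assms(1), of \<theta>] unfolding A_def A'_def sum_subtractf by linarith
  define k where "k = n - 2"
  have k: "?m = Suc k" "k = n - 2" using assms(1) unfolding k_def by auto
  have late0: "?P ?AW (2 * ?m + 0) - ?P ?FSD (2 * ?m + 0) = 0"
    using apart_prob_late_eq[OF assms(1) \<theta>] by simp
  \<comment> \<open>For \<open>n = 4\<close> the equality \<open>q' = q\<close> preserves an exact
    formula; for \<open>n \<ge> 5\<close> the inequality suffices.\<close>
  have main: "q' \<le> q \<and> 0 < A - A' \<and>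
      (n = 4 \<longrightarrow> q' = q \<and> A - A' = c / 81) \<and> (n \<ge> 5 \<longrightarrow> 483 * c / (real n - 1) ^ 8 \<le> A - A')"
  proof (cases "n = 4")
    case True
    \<comment> \<open>Two of the three times, 7 and 8, contribute \<open>c / 162\<close>
      each.\<close>
    have "A - A' = c / 81"
      using diff late0 apart_prob_late_4[OF \<theta>] unfolding True c_def by (simp add: eval_nat_numeral)
    moreover have "q' = q"
      using apart_prob_late_4(3)[OF \<theta>] unfolding q_def q'_def True by simp
    ultimately show ?thesis using c True by simp
  next
    case False
    then have n5: "n \<ge> 5" using assms(1) by simp
    define m d u where "m = real n - 1" and "d = miss_prob n"
      and "u = ((m - 2) * d + derange (n - 2)) / ((m - 1) * (m - 2))"
    have m4: "m \<ge> 4" using n5 unfolding m_def by simp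
    note coeff = late_coefficient_ge[OF n5 m_def d_def u_def]
    define g where "g j = avoid j (m - 1) (m - 3)" for j
    have g0: "0 \<le> g j" if "j \<le> n - 2" for j
      using avoid_nonneg[of j "n - 2" "n - 4"] that n5 unfolding g_def m_def by (simp add: of_nat_diff)
    let ?K = "c * (d\<^sup>2 - u\<^sup>2) / (m\<^sup>2 * (m - 2))"
    have K0: "0 \<le> ?K" using c coeff(1) m4 by (intro divide_nonneg_nonneg mult_nonneg_nonneg) auto
    have late: "?K * g j \<le> ?P ?AW (2 * ?m + Suc j) - ?P ?FSD (2 * ?m + Suc j)" if "j \<le> n - 2" for j
      using apart_prob_late_le[OF assms(1) \<theta> that m_def d_def u_def] unfolding g_def c_def by simp
    have nonneg: "0 \<le> ?P ?AW (2 * ?m + Suc j) - ?P ?FSD (2 * ?m + Suc j)" if "j \<le> n - 2" for j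
      using late[OF that] mult_nonneg_nonneg[OF K0 g0[OF that]] by linarith
    \<comment> \<open>The end of the block, time \<open>3 (n - 1)\<close>: it enters
      \<open>q\<close> and not the sum \<open>A\<close>.\<close>
    have "0 \<le> ?P ?AW (2 * ?m + Suc k) - ?P ?FSD (2 * ?m + Suc k)" by (rule nonneg) (simp add: k(2))
    moreover have "3 * ?m = 2 * ?m + Suc k" using k(1) by linarith
    ultimately have "q' \<le> q" unfolding q_def q'_def by (simp only: diff_ge_0_iff_ge)
    have "?K * (1 + g 1) \<le> A - A'"
    proof -
      have "A - A' = (\<Sum>j<k. ?P ?AW (2 * ?m + Suc j) - ?P ?FSD (2 * ?m + Suc j))"
        unfolding diff k(1) sum.lessThan_Suc_shift late0[unfolded k(1)] by simp
      \<comment> \<open>All terms are nonnegative, and the first two suffice.\<close>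
      also have "\<dots> \<ge> (\<Sum>j\<in>{0, 1}. ?P ?AW (2 * ?m + Suc j) - ?P ?FSD (2 * ?m + Suc j))"
        using k n5 nonneg by (intro sum_mono2) auto
      also have "(\<Sum>j\<in>{0, 1}. ?P ?AW (2 * ?m + Suc j) - ?P ?FSD (2 * ?m + Suc j)) =
          (?P ?AW (2 * ?m + Suc 0) - ?P ?FSD (2 * ?m + Suc 0)) + (?P ?AW (2 * ?m + Suc 1) - ?P ?FSD (2 * ?m + Suc 1))"
        by simp
      finally have "(?P ?AW (2 * ?m + Suc 0) - ?P ?FSD (2 * ?m + Suc 0)) +
          (?P ?AW (2 * ?m + Suc 1) - ?P ?FSD (2 * ?m + Suc 1)) \<le> A - A'" .
      moreover have "?K * g 0 \<le> ?P ?AW (2 * ?m + Suc 0) - ?P ?FSD (2 * ?m + Suc 0)"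
        by (rule late) simp
      moreover have "?K * g 1 \<le> ?P ?AW (2 * ?m + Suc 1) - ?P ?FSD (2 * ?m + Suc 1)"
        using n5 by (intro late) simp
      moreover have "g 0 = 1" by (simp add: g_def)
      ultimately show ?thesis by (simp only: distrib_left)
    qed
    moreover have "483 * c / m ^ 8 \<le> ?K * (1 + g 1)"
    proof -
      have "c * (483 * (m - 2)) \<le> c * ((d\<^sup>2 - u\<^sup>2) * (1 + g 1) * m ^ 6)"
        using coeff(2) c unfolding g_def by (intro mult_left_mono) auto
      then have "c * (483 * (m - 2)) / (m ^ 8 * (m - 2)) \<le> c * ((d\<^sup>2 - u\<^sup>2) * (1 + g 1) * m ^ 6) / (m ^ 8 * (m - 2))"
        using m4 by (intro divide_right_mono) auto
      moreover have "c * (483 * (m - 2)) / (m ^ 8 * (m - 2)) = 483 * c / m ^ 8"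
      proof -
        have "c * (483 * (m - 2)) / (m ^ 8 * (m - 2)) = 483 * c * (m - 2) / (m ^ 8 * (m - 2))"
          by (simp only: mult_ac)
        also have "\<dots> = 483 * c / m ^ 8" using m4 by (intro mult_divide_mult_cancel_right) simp
        finally show ?thesis .
      qed
      moreover have "c * (x * y * m ^ 6) / (m ^ 8 * (m - 2)) = c * x / (m\<^sup>2 * (m - 2)) * y" for x y
      proof -
        have "c * (x * y * m ^ 6) / (m ^ 8 * (m - 2)) = (m ^ 6 * (c * x * y)) / (m ^ 6 * (m\<^sup>2 * (m - 2)))"
          by (simp add: power_add[symmetric] mult_ac)
        also have "\<dots> = c * x * y / (m\<^sup>2 * (m - 2))" using m4 by (intro mult_divide_mult_cancel_left) simp
        finally show ?thesis by simp
      qed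
      ultimately show ?thesis by (simp only:)
    qed
    moreover have "0 < 483 * c / m ^ 8" using c m4 by simp
    ultimately show ?thesis using False \<open>q' \<le> q\<close> unfolding m_def by linarith
  qed
  then have q': "q' < 1" using q by linarith
  have E: "expected_meeting_time n ?AW = ennreal (A / (1 - q))"
    unfolding A_def q_def using q assms(1) by (intro expected_meeting_time_rounds[of n _ \<theta>]) (auto simp: q_def)
  have E': "expected_meeting_time n ?FSD = ennreal (A' / (1 - q'))"
    unfolding A'_def q'_def using q' assms(1) by (intro expected_meeting_time_rounds[of n _ \<theta>]) (auto simp: q'_def)
  have pos: "0 \<le> A / (1 - q)" "0 \<le> A' / (1 - q')"
    using A'0 q q' main by (auto intro!: divide_nonneg_nonneg)
  have ge: "A - A' \<le> A / (1 - q) - A' / (1 - q')"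
    using main A'0 q by (intro quotient_diff_ge) auto
  have "A' / (1 - q') < A / (1 - q)" using ge main by linarith
  moreover have "A / (1 - q) - A' / (1 - q') = 8 * (1 - \<theta>) ^ 6 / (81 * (8 - (3 * \<theta>\<^sup>2 - 2 * \<theta> + 1) ^ 3))" if "n = 4"
  proof -
    have mp: "miss_prob n = 1 / 2" unfolding that by (simp add: miss_prob_def derange_4)
    have "q = (\<theta>\<^sup>2 + (1 - \<theta>)\<^sup>2 * (1 / 2)) ^ 3"
      unfolding q_def apart_prob_AW_3[OF assms(1) \<theta>] mp ..
    \<comment> \<open>The survival probability of one round is half of
      \<open>3 \<theta>^2 - 2 \<theta> + 1\<close>; cubing it accounts for the 8 in the
      denominator.\<close>
    also have "\<theta>\<^sup>2 + (1 - \<theta>)\<^sup>2 * (1 / 2) = (3 * \<theta>\<^sup>2 - 2 * \<theta> + 1) / 2"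
      by (simp add: power2_eq_square field_simps)
    finally have q8: "8 - (3 * \<theta>\<^sup>2 - 2 * \<theta> + 1) ^ 3 = 8 * (1 - q)" by (simp add: power_divide)
    have "A / (1 - q) - A' / (1 - q') = (c / 81) / (1 - q)"
    proof -
      have "q' = q" "A - A' = c / 81" using main that by auto
      then show ?thesis by (simp only: diff_divide_distrib[symmetric])
    qed
    also have "\<dots> = 8 * c / (81 * (8 * (1 - q)))"
    proof -
      have "c / 81 / r = 8 * c / (81 * (8 * r))" for r :: real by simp
      then show ?thesis .
    qed
    finally show ?thesis unfolding q8 c_def .
  qed
  moreover have "483 * (1 - \<theta>) ^ 6 / (real n - 1) ^ 8 \<le> A / (1 - q) - A' / (1 - q')" if "n \<ge> 5"
    using main ge that unfolding c_def by linarith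
  ultimately show ?thesis
    unfolding E E' using pos by (simp add: ennreal_less_iff)
qed

end
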